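(* Let $\lambda=(n-k,1^k)$ be a hook partition of $n$ with $0\le k\le n-2$. Then $$\operatorname{ch}(L_{(n-k,1^k)})=\sum_{\mu\vdash n}\bigl|\{T\in\operatorname{SYT}_{(n-k,1^k)}(\mu):\operatorname{Des}(T)\subseteq[n-k]\}\bigr|\,s_\mu.$$
   Context: Let $V=\mathbb{C}^N$, let $\operatorname{Lie}(V)$ be the free Lie algebra on $V$ inside the tensor algebra $T(V)$ (generated by $V$ under the commutator bracket), and $\mathcal L_m(V)=\operatorname{Lie}(V)\cap V^{\otimes m}$. For a partition $\lambda$ with $m_i(\lambda)$ parts equal to $i$, the higher Lie module is the $\operatorname{GL}(V)$-module $L_\lambda=\bigotimes_{i\ge1}\operatorname{Sym}^{m_i(\lambda)}(\mathcal L_i(V))$, and $L_n:=L_{(n)}$. $\operatorname{ch}(L_\lambda)$ denotes its character as a symmetric function of the eigenvalues $x_1,\dots,x_N$ of $g\in \operatorname{GL}(V)$, in the limit $N\to\infty$ (a symmetric function in infinitely many variables). Equivalently $\operatorname{ch}(L_\lambda)=\prod_{i\ge1}h_{m_i(\lambda)}[\operatorname{ch}(L_i)]$ (plethysm). $s_\mu$ is the Schur function. $\operatorname{SYT}(\mu)$ is the set of standard Young tableaux of shape $\mu$ (English notation). $\operatorname{Des}(T)=\{i: i+1$ lies in a lower row of $T$ than $i\}$. $[a,b]$ is the set of integers from $a$ to $b$, $[a]=[1,a]$. For $\lambda=(\lambda_1,\dots,\lambda_r)\vdash n$ let $B_{\lambda,i}=[\lambda_1+\cdots+\lambda_{i-1}+1,\lambda_1+\cdots+\lambda_i]$,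 let $\operatorname{Des}_{\lambda,i}(T)=\{d-(\lambda_1+\cdots+\lambda_{i-1}): d\in \operatorname{Des}(T),\ d,d+1\in B_{\lambda,i}\}$, and let $\operatorname{maj}_{\lambda,i}(T)$ be the sum of the elements of $\operatorname{Des}_{\lambda,i}(T)$. Set $\operatorname{SYT}_\lambda(\mu)=\{T\in\operatorname{SYT}(\mu):\operatorname{maj}_{\lambda,i}(T)\equiv1\pmod{\lambda_i}\text{ for all }i\}$. *)

theory Defs
  imports
    "HOL-Library.Poly_Mapping"
    "HOL-Library.Multiset"
    "HOL-Number_Theory.Cong"
    "Jordan_Normal_Form.Char_Poly"
begin

section \<open>Free vector spaces, free algebras, traces\<close>

text \<open>
  \<open>'a \<Rightarrow>\<^sub>0 complex\<close> is the complex vector space with basis \<open>'a\<close>; if \<open>'a\<close> is an additive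
  monoid, its ring structure is the monoid algebra.
\<close>

definition scal :: "complex \<Rightarrow> ('a \<Rightarrow>\<^sub>0 complex) \<Rightarrow> ('a \<Rightarrow>\<^sub>0 complex)" where
  "scal c p = Poly_Mapping.map ((*) c) p"

lemma lookup_scal: "Poly_Mapping.lookup (scal c p) k = c * Poly_Mapping.lookup p k"
  by (simp add: scal_def Poly_Mapping.map.rep_eq when_def)

interpretation free_vs: vector_space "scal :: complex \<Rightarrow> ('a \<Rightarrow>\<^sub>0 complex) \<Rightarrow> _"
  by unfold_locales
    (auto intro!: poly_mapping_eqI simp: lookup_scal Poly_Mapping.lookup_add algebra_simps)

definition lin_ext ::
    "('a \<Rightarrow> ('b \<Rightarrow>\<^sub>0 complex)) \<Rightarrow> ('a \<Rightarrow>\<^sub>0 complex) \<Rightarrow> ('b \<Rightarrow>\<^sub>0 complex)" where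
  "lin_ext f p = (\<Sum>k\<in>Poly_Mapping.keys p. scal (Poly_Mapping.lookup p k) (f k))"

text \<open>
  Trace of an operator \<open>\<phi>\<close> on a finite-dimensional \<open>\<phi>\<close>-invariant subspace \<open>W\<close>: the sum of the
  diagonal entries of its matrix in some basis of \<open>W\<close>.
\<close>

definition trace_on ::
    "('a \<Rightarrow>\<^sub>0 complex) set \<Rightarrow> (('a \<Rightarrow>\<^sub>0 complex) \<Rightarrow> ('a \<Rightarrow>\<^sub>0 complex)) \<Rightarrow> complex" where
  "trace_on W \<phi> =
     (let B = (SOME B. free_vs.independent B \<and> free_vs.span B = W)
      in \<Sum>b\<in>B. free_vs.representation B (\<phi> b) b)"

text \<open>Words under concatenation: the free monoid.\<close>

instantiation list :: (type) monoid_add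
begin
definition zero_list_def: "0 = []"
definition plus_list_def: "xs + ys = xs @ ys"
instance by standard (simp_all add: zero_list_def plus_list_def)
end

text \<open>
  With \<open>V = \<complex>\<^sup>N\<close> having basis \<open>e\<^sub>0, \<dots>, e\<^bsub>N-1\<^esub>\<close>, the tensor algebra \<open>T(V)\<close> is the monoid algebra of
  the words in the letters \<open>0, \<dots>, N - 1\<close>. The type below is the increasing union of these
  algebras over all \<open>N\<close>.
\<close>

type_synonym tensor_alg = "nat list \<Rightarrow>\<^sub>0 complex"

definition tensor_power :: "nat \<Rightarrow> nat \<Rightarrow> tensor_alg set" where
  "tensor_power N m =
     {p. \<forall>w \<in> Poly_Mapping.keys p. length w = m \<and> set w \<subseteq> {..<N}}"

inductive_set free_lie :: "nat \<Rightarrow> tensor_alg set" for N :: nat where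
  generator: "v \<in> tensor_power N 1 \<Longrightarrow> v \<in> free_lie N"
| add: "p \<in> free_lie N \<Longrightarrow> q \<in> free_lie N \<Longrightarrow> p + q \<in> free_lie N"
| scale: "p \<in> free_lie N \<Longrightarrow> scal c p \<in> free_lie N"
| bracket: "p \<in> free_lie N \<Longrightarrow> q \<in> free_lie N \<Longrightarrow> p * q - q * p \<in> free_lie N"

definition lie_part :: "nat \<Rightarrow> nat \<Rightarrow> tensor_alg set" where
  "lie_part N m = free_lie N \<inter> tensor_power N m"


section \<open>Higher Lie modules\<close>

text \<open>
  The symmetric algebra \<open>S(T(V))\<close> is the (commutative) monoid algebra of finite multisets of
  words, and for a subspace \<open>W\<close> of \<open>T(V)\<close> the space \<open>Sym\<^sup>m(W)\<close> is its subspace spanned by the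
  \<open>m\<close>-fold products of elements of \<open>W\<close>. The spaces \<open>V\<^bsup>\<otimes>i\<^esup>\<close> for different \<open>i\<close> are linearly
  independent, so that \<open>S(\<Oplus>\<^sub>i V\<^bsup>\<otimes>i\<^esup>) = \<Otimes>\<^sub>i S(V\<^bsup>\<otimes>i\<^esup>)\<close> through multiplication; hence the
  tensor product of the \<open>Sym\<^bsup>m\<^sub>i\<^esup>(lie_part N i)\<close> is the span of their products in \<open>S(T(V))\<close>.
\<close>

type_synonym sym_tensor_alg = "nat list multiset \<Rightarrow>\<^sub>0 complex"

definition sym_incl :: "tensor_alg \<Rightarrow> sym_tensor_alg" where
  "sym_incl = lin_ext (\<lambda>w. Poly_Mapping.single {#w#} 1)"

definition sym_power :: "nat \<Rightarrow> tensor_alg set \<Rightarrow> sym_tensor_alg set" where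
  "sym_power m W = free_vs.span {\<Prod>j<m. sym_incl (w j) | w. \<forall>j<m. w j \<in> W}"

text \<open>A partition is the list of its parts; only the \<open>i\<close> with \<open>m\<^sub>i(lam) > 0\<close> contribute factors.\<close>

definition higher_lie :: "nat \<Rightarrow> nat list \<Rightarrow> sym_tensor_alg set" where
  "higher_lie N lam = free_vs.span
     {\<Prod>i\<in>set lam. s i | s. \<forall>i\<in>set lam. s i \<in> sym_power (count_list lam i) (lie_part N i)}"

text \<open>
  The action of a matrix on \<open>V\<close>, and its extensions to \<open>T(V)\<close> and \<open>S(T(V))\<close> as algebra
  homomorphisms.
\<close>

definition act_vec :: "complex mat \<Rightarrow> nat \<Rightarrow> tensor_alg" where
  "act_vec g j = (\<Sum>i<dim_row g. Poly_Mapping.single [i] (g $$ (i, j)))"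

definition act_tensor :: "complex mat \<Rightarrow> tensor_alg \<Rightarrow> tensor_alg" where
  "act_tensor g = lin_ext (\<lambda>w. prod_list (map (act_vec g) w))"

definition act_sym :: "complex mat \<Rightarrow> sym_tensor_alg \<Rightarrow> sym_tensor_alg" where
  "act_sym g = lin_ext (\<lambda>M. \<Prod>w\<in>#M. sym_incl (act_tensor g (Poly_Mapping.single w 1)))"


section \<open>Symmetric functions and characters\<close>

text \<open>
  A formal power series in \<open>x\<^sub>0, x\<^sub>1, \<dots>\<close> is given by its coefficients, indexed by exponent
  vectors.
\<close>

type_synonym power_series = "(nat \<Rightarrow>\<^sub>0 nat) \<Rightarrow> int"

definition symmetric_function :: "power_series \<Rightarrow> bool" where
  "symmetric_function f \<longleftrightarrow>
     (\<exists>d. \<forall>\<alpha>. f \<alpha> \<noteq> 0 \<longrightarrow> (\<Sum>i\<in>Poly_Mapping.keys \<alpha>. Poly_Mapping.lookup \<alpha> i) \<le> d) \<and>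
     (\<forall>\<pi> \<alpha>. bij \<pi> \<longrightarrow> f (Poly_Mapping.map_key \<pi> \<alpha>) = f \<alpha>)"

text \<open>The value \<open>f(x\<^sub>0, \<dots>, x\<^bsub>N-1\<^esub>, 0, 0, \<dots>)\<close>.\<close>

definition eval_sym :: "power_series \<Rightarrow> complex list \<Rightarrow> complex" where
  "eval_sym f xs =
     (\<Sum>\<alpha> | Poly_Mapping.keys \<alpha> \<subseteq> {..<length xs} \<and> f \<alpha> \<noteq> 0.
        of_int (f \<alpha>) * (\<Prod>i<length xs. xs ! i ^ Poly_Mapping.lookup \<alpha> i))"

text \<open>
  The limit for \<open>N \<rightarrow> \<infinity>\<close> of the characters on \<open>\<complex>\<^sup>N\<close>: the symmetric function in infinitely many
  variables which, for every \<open>N\<close>, gives the trace of each \<open>g \<in> GL\<^sub>N(\<complex>)\<close> when it is evaluated at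
  the eigenvalues of \<open>g\<close> (with multiplicity).
\<close>

definition ch_higher_lie :: "nat list \<Rightarrow> power_series" where
  "ch_higher_lie lam = (THE f. symmetric_function f \<and>
     (\<forall>N g xs. g \<in> carrier_mat N N \<and> invertible_mat g \<and>
        char_poly g = (\<Prod>x\<leftarrow>xs. [:- x, 1:]) \<longrightarrow>
        trace_on (higher_lie N lam) (act_sym g) = eval_sym f xs))"


section \<open>Tableaux\<close>

definition is_partition :: "nat \<Rightarrow> nat list \<Rightarrow> bool" where
  "is_partition n \<mu> \<longleftrightarrow> sorted_wrt (\<ge>) \<mu> \<and> (\<forall>p\<in>set \<mu>. 0 < p) \<and> sum_list \<mu> = n"

text \<open>A tableau is the list of its rows from top to bottom (English notation).\<close>

definition columns_strict :: "nat list list \<Rightarrow> bool" where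
  "columns_strict T \<longleftrightarrow>
     (\<forall>r c. Suc r < length T \<and> c < length (T ! r) \<and> c < length (T ! Suc r) \<longrightarrow>
        T ! r ! c < T ! Suc r ! c)"

definition SSYT :: "nat list \<Rightarrow> nat list list set" where
  "SSYT \<mu> = {T. map length T = \<mu> \<and> (\<forall>R\<in>set T. sorted_wrt (\<le>) R) \<and> columns_strict T}"

definition SYT :: "nat list \<Rightarrow> nat list list set" where
  "SYT \<mu> = {T. map length T = \<mu> \<and> (\<forall>R\<in>set T. sorted_wrt (<) R) \<and> columns_strict T \<and>
              distinct (concat T) \<and> set (concat T) = {1..sum_list \<mu>}}"

text \<open>Here an entry \<open>i\<close> stands for the variable \<open>x\<^sub>i\<close>, so entries start at \<open>0\<close>.\<close>

definition schur :: "nat list \<Rightarrow> power_series" where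
  "schur \<mu> \<alpha> =
     int (card {T \<in> SSYT \<mu>. \<forall>i. count_list (concat T) i = Poly_Mapping.lookup \<alpha> i})"

definition Des :: "nat list list \<Rightarrow> nat set" where
  "Des T = {i. \<exists>r s. r < s \<and> s < length T \<and> i \<in> set (T ! r) \<and> Suc i \<in> set (T ! s)}"

text \<open>Parts are numbered from \<open>0\<close> in the following three definitions.\<close>

definition block :: "nat list \<Rightarrow> nat \<Rightarrow> nat set" where
  "block lam i = {sum_list (take i lam) + 1 .. sum_list (take (Suc i) lam)}"

definition Des_block :: "nat list \<Rightarrow> nat \<Rightarrow> nat list list \<Rightarrow> nat set" where
  "Des_block lam i T =
     {d - sum_list (take i lam) | d. d \<in> Des T \<and> d \<in> block lam i \<and> Suc d \<in> block lam i}"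

definition maj_block :: "nat list \<Rightarrow> nat \<Rightarrow> nat list list \<Rightarrow> nat" where
  "maj_block lam i T = \<Sum>(Des_block lam i T)"

definition SYT_maj :: "nat list \<Rightarrow> nat list \<Rightarrow> nat list list set" where
  "SYT_maj lam \<mu> = {T \<in> SYT \<mu>. \<forall>i<length lam. [maj_block lam i T = 1] (mod lam ! i)}"

definition hook :: "nat \<Rightarrow> nat \<Rightarrow> nat list" where
  "hook n k = (n - k) # replicate k 1"

end

theory Submission
  imports Defs "Jordan_Normal_Form.Schur_Decomposition"
begin

text \<open>
  Put \<open>m = n - k\<close>. Row insertion turns the right-hand side into the generating function of the words
  \<open>v s\<close> with \<open>v\<close> of length \<open>m\<close>, \<open>maj v \<equiv> 1 (mod m)\<close> and \<open>s\<close> weakly increasing, that is, into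
  \<open>h\<^sub>k\<close> times the generating function of the words of length \<open>m\<close> with \<open>maj \<equiv> 1\<close>. At a root of unity of
  order \<open>d\<close> dividing \<open>m\<close>, the generating function of \<open>q\<^bsup>maj\<^esup>\<close> becomes \<open>p\<^sub>d\<^bsup>m/d\<^esup>\<close>, which counts the words
  fixed by a rotation of order \<open>d\<close>; hence the second factor is the trace of \<open>g \<zeta>\<close>
  on \<open>V\<^bsup>\<otimes>m\<^esup>\<close>, where \<open>\<zeta>\<close> is the idempotent \<open>\<Sum>\<^sub>j \<omega>\<^bsup>j\<^esup> c\<^bsup>j\<^esup> / m\<close> of the cyclic group.

  On the Lie side, let \<open>r\<close> be the left-normed bracketing. Modulo the kernel of \<open>\<zeta>\<close> one has
  \<open>r(x v) \<equiv> x M(v)\<close> with \<open>M(x v) = x M(v) - \<omega> M(v) x\<close>, and \<open>M\<close> is invertible in degrees below \<open>m\<close> because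
  \<open>\<omega>\<^bsup>e\<^esup> \<noteq> 1\<close> for \<open>0 < e < m\<close>. So with \<open>X(x v) = x M\<^bsup>-1\<^esup>(v)\<close> the operator \<open>r X \<zeta>\<close> satisfies
  \<open>\<zeta> r X = \<zeta>\<close>; it is a projection onto the Lie elements of degree \<open>m\<close>, and by cyclicity
  \<open>tr (g r X \<zeta>) = tr (g \<zeta>)\<close>. The factor \<open>Sym\<^sup>k V\<close> contributes \<open>h\<^sub>k\<close>.
\<close>

text \<open>The characteristic is a definite description, so besides the trace formula one needs
  uniqueness and the symmetry of the proposed coefficients. Symmetry is not visible on the
  combinatorial side, because relabelling the letters changes the major index; it becomes visible
  once the counts are rewritten through words fixed by rotations. Traces are taken in an unspecified
  basis. They are computed from a spanning family that may be linearly dependent, with coefficients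
  of words as coordinates, so that no basis of the free Lie algebra is ever built. The delicate
  point is that \<open>r X \<zeta>\<close> fixes Lie elements: the relation with \<zeta> alone
  determines the result only modulo the kernel of \<zeta>. It suffices where some letter occurs
  exactly once, and since all operators permute positions without looking at the letters, the
  identity then passes to arbitrary words by substitution. Matrices need not be diagonalizable; they
  are brought to triangular form, and words are filtered by the sum of their letters, which
  rotations preserve.\<close>

abbreviation lookup :: "('a \<Rightarrow>\<^sub>0 'b::zero) \<Rightarrow> 'a \<Rightarrow> 'b" where "lookup \<equiv> Poly_Mapping.lookup"
abbreviation keys :: "('a \<Rightarrow>\<^sub>0 'b::zero) \<Rightarrow> 'a set" where "keys \<equiv> Poly_Mapping.keys"
abbreviation single :: "'a \<Rightarrow> 'b \<Rightarrow> 'a \<Rightarrow>\<^sub>0 'b::zero" where "single \<equiv> Poly_Mapping.single"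

section \<open>Row insertion and the Robinson--Schensted--Knuth correspondence\<close>

definition row_pos :: "nat \<Rightarrow> nat list \<Rightarrow> nat" where
  "row_pos x R = length (takeWhile (\<lambda>z. z \<le> x) R)"

definition dominates :: "nat list \<Rightarrow> nat list \<Rightarrow> bool" where
  "dominates R S \<longleftrightarrow> length S \<le> length R \<and> (\<forall>c<length S. R ! c < S ! c)"

text \<open>The shape is not mentioned, and rows must be nonempty: then \<open>map length T\<close>
  is automatically a partition, and insertion needs no bookkeeping of shapes.\<close>

fun tableau :: "nat list list \<Rightarrow> bool" where
  "tableau [] = True"
| "tableau (R # T) = (R \<noteq> [] \<and> sorted R \<and> (T \<noteq> [] \<longrightarrow> dominates R (hd T)) \<and> tableau T)"

fun ins :: "nat \<Rightarrow> nat list list \<Rightarrow> nat list list" where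
  "ins x [] = [[x]]"
| "ins x (R # T) = (let i = row_pos x R in
     if i = length R then (R @ [x]) # T else R[i := x] # ins (R ! i) T)"

text \<open>The row in which the bumping path ends, that is, where the shape gains a cell; the value
  \<open>length T\<close> stands for a new bottom row.\<close>

fun ins_row :: "nat \<Rightarrow> nat list list \<Rightarrow> nat" where
  "ins_row x [] = 0"
| "ins_row x (R # T) = (let i = row_pos x R in
     if i = length R then 0 else Suc (ins_row (R ! i) T))"

text \<open>Reverse insertion from the last cell of row \<open>r\<close>; the second component is
  the letter expelled from the top row. Above the starting row, the incoming letter \<open>y\<close>
  displaces the rightmost entry smaller than \<open>y\<close>, whence the \<open>- 1\<close>. The
  first equation is a default value for rows that do not exist.\<close>

fun del :: "nat \<Rightarrow> nat list list \<Rightarrow> nat list list \<times> nat" where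
  "del r [] = ([], 0)"
| "del 0 (R # T) = (if length R = 1 then T else butlast R # T, last R)"
| "del (Suc r) (R # T) = (let (T', y) = del r T; i = length (takeWhile (\<lambda>z. z < y) R) - 1
     in (R[i := y] # T', R ! i))"

definition add_cell :: "nat \<Rightarrow> 'a \<Rightarrow> 'a list list \<Rightarrow> 'a list list" where
  "add_cell r x T = (if r < length T then T[r := T ! r @ [x]] else T @ [[x]])"

lemma row_pos_le: "row_pos x R \<le> length R"
  by (simp add: row_pos_def length_takeWhile_le)

lemma row_pos_less_iff:
  assumes "sorted R" "c < length R"
  shows "R ! c \<le> x \<longleftrightarrow> c < row_pos x R"
proof
  assume "R ! c \<le> x"
  show "c < row_pos x R"
  proof (rule ccontr)
    assume "\<not> ?thesis"
    then have "row_pos x R \<le> c" by simp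
    then have "row_pos x R < length R" using assms by simp
    then have "\<not> R ! row_pos x R \<le> x" unfolding row_pos_def by (rule nth_length_takeWhile)
    moreover have "R ! row_pos x R \<le> R ! c"
      using sorted_nth_mono[OF assms(1) \<open>row_pos x R \<le> c\<close> assms(2)] .
    ultimately show False using \<open>R ! c \<le> x\<close> by simp
  qed
next
  assume "c < row_pos x R"
  then show "R ! c \<le> x" unfolding row_pos_def
    by (metis nth_mem set_takeWhileD takeWhile_nth)
qed

lemma row_pos_nth_gt: "row_pos x R < length R \<Longrightarrow> x < R ! row_pos x R"
  unfolding row_pos_def using nth_length_takeWhile[of "\<lambda>z. z \<le> x" R] by simp

lemma length_takeWhile_eqI:
  assumes "p \<le> length R" "\<And>c. c < p \<Longrightarrow> P (R ! c)" "p < length R \<Longrightarrow> \<not> P (R ! p)"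
  shows "length (takeWhile P R) = p"
proof (rule antisym)
  show "p \<le> length (takeWhile P R)"
    using assms(1,2) by (metis (full_types) length_takeWhile_less_P_nth)
  show "length (takeWhile P R) \<le> p"
  proof (rule ccontr)
    assume *: "\<not> ?thesis"
    then have "P (R ! p)" by (metis not_le nth_mem set_takeWhileD takeWhile_nth)
    moreover have "p < length R" using * length_takeWhile_le[of P R] by simp
    ultimately show False using assms(3) by simp
  qed
qed

lemma row_pos_unique:
  assumes "p \<le> length R" "\<And>c. c < p \<Longrightarrow> R ! c \<le> x" "p < length R \<Longrightarrow> x < R ! p"
  shows "row_pos x R = p"
  unfolding row_pos_def by (rule length_takeWhile_eqI) (use assms in auto)

lemma dominates_append_leftD: "dominates (A @ [z]) B \<Longrightarrow> length B \<le> length A \<Longrightarrow> dominates A B"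
  unfolding dominates_def by (metis nth_append order.strict_trans2)

lemma dominates_append_rightD: "dominates A (B @ [z]) \<Longrightarrow> dominates A B"
  unfolding dominates_def by (simp add: nth_append) (metis less_Suc_eq)

lemma hd_ins:
  "hd (ins y T) = (if T = [] then [y] else let R = hd T; i = row_pos y R in
     if i = length R then R @ [y] else R[i := y])"
  by (cases T) (auto simp: Let_def)

lemma sorted_row_insert:
  assumes "sorted R" "row_pos x R = i"
  shows "if i = length R then sorted (R @ [x]) else sorted (R[i := x])"
proof (cases "i = length R")
  case True
  have "z \<le> x" if "z \<in> set R" for z
    using that assms row_pos_less_iff[of R _ x] True by (auto simp: in_set_conv_nth)
  then show ?thesis using assms True by (simp add: sorted_append)
next
  case False
  then have il: "i < length R" using assms row_pos_le[of x R] by simp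
  have "R[i := x] ! a \<le> R[i := x] ! b" if "a < b" "b < length R" for a b
  proof -
    have "R ! a \<le> R ! b" using that assms(1) sorted_nth_mono[of R a b] by simp
    moreover have "R ! a \<le> x" if "b = i"
      using row_pos_less_iff[of R a x] that assms \<open>a < b\<close> il by auto
    moreover have "x \<le> R ! b" if "a = i"
      using row_pos_less_iff[of R b x] that assms \<open>a < b\<close> \<open>b < length R\<close> il by auto
    ultimately show ?thesis using that il by (auto simp: nth_list_update)
  qed
  then show ?thesis using False by (auto simp: sorted_wrt_iff_nth_less)
qed

text \<open>Bumping paths move weakly to the left: an entry of the next row below the bumped letter
  is already larger than it, so the letter lands in some column \<open>j \<le> i\<close>. In the
  columns up to \<open>i\<close> the upper row now has entries at most \<open>x\<close>, which is
  smaller than the bumped letter.\<close>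

lemma dominates_ins:
  assumes R: "sorted R" and T: "tableau T" "T \<noteq> [] \<longrightarrow> dominates R (hd T)"
    and i: "i = row_pos x R" "i < length R"
  shows "dominates (R[i := x]) (hd (ins (R ! i) T))"
proof (cases T)
  case Nil
  have "0 < length R" using i by auto
  moreover have "R[i := x] ! 0 < R ! i"
  proof (cases "i = 0")
    case False
    then have "R ! 0 \<le> x" using row_pos_less_iff[OF R \<open>0 < length R\<close>] i by simp
    then show ?thesis using False i row_pos_nth_gt[of x R] by simp
  qed (use i row_pos_nth_gt[of x R] in simp)
  ultimately show ?thesis using Nil i by (simp add: dominates_def Suc_le_eq)
next
  case (Cons S T')
  define y where "y = R ! i"
  have xy: "x < y" using i row_pos_nth_gt[of x R] by (simp add: y_def)
  have S: "sorted S" "length S \<le> length R" "\<And>c. c < length S \<Longrightarrow> R ! c < S ! c"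
    using T Cons by (auto simp: dominates_def)
  define j where "j = row_pos y S"
  have ji: "j \<le> i"
  proof (rule ccontr)
    assume "\<not> j \<le> i"
    then have "i < j" by simp
    then have "i < length S" using row_pos_le[of y S] by (simp add: j_def)
    with \<open>i < j\<close> have "S ! i \<le> y" using row_pos_less_iff[OF S(1), of i y] by (simp add: j_def)
    with S(3)[OF \<open>i < length S\<close>] show False by (simp add: y_def)
  qed
  have Rx: "R[i := x] ! c \<le> R ! c" "c \<le> i \<Longrightarrow> R[i := x] ! c \<le> x" if "c < length R" for c
    using that i xy row_pos_less_iff[OF R that, of x] by (auto simp: nth_list_update y_def)
  show ?thesis
  proof (cases "j = length S")
    case True
    have "dominates (R[i := x]) (S @ [y])"
      using ji i S Rx xy True unfolding dominates_def
      by (auto simp: nth_append less_Suc_eq) (metis order.strict_trans1 order.strict_trans2)+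
    then show ?thesis using Cons True by (simp add: hd_ins j_def y_def)
  next
    case False
    then have "j < length S" using row_pos_le[of y S] by (simp add: j_def)
    have "dominates (R[i := x]) (S[j := y])"
      unfolding dominates_def
    proof (intro conjI allI impI)
      show "length (S[j := y]) \<le> length (R[i := x])" using S by simp
      fix c assume c: "c < length (S[j := y])"
      show "R[i := x] ! c < S[j := y] ! c"
      proof (cases "c = j")
        case True
        then show ?thesis using Rx(2)[of c] ji c S xy by simp
      next
        case False
        then show ?thesis using Rx(1)[of c] S(3)[of c] S(2) c by simp
      qed
    qed
    then show ?thesis using Cons False by (simp add: hd_ins j_def y_def Let_def)
  qed
qed

lemma tableau_ins: "tableau T \<Longrightarrow> tableau (ins x T)"
proof (induction x T rule: ins.induct)
  case (2 x R T)
  define i where "i = row_pos x R"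
  show ?case
  proof (cases "i = length R")
    case True
    have "T \<noteq> [] \<longrightarrow> dominates (R @ [x]) (hd T)"
      using 2 by (auto simp: dominates_def nth_append)
    then show ?thesis using True 2 sorted_row_insert[of R x i] by (simp add: i_def)
  next
    case False
    then have "i < length R" using row_pos_le[of x R] by (simp add: i_def)
    moreover have "tableau (ins (R ! i) T)" using 2 False by (simp add: i_def)
    ultimately show ?thesis using False 2 sorted_row_insert[of R x i] dominates_ins[of R T i x]
      by (auto simp: i_def Let_def)
  qed
qed simp

definition incr :: "nat \<Rightarrow> nat list \<Rightarrow> nat list" where
  "incr r \<mu> = (if r < length \<mu> then \<mu>[r := Suc (\<mu> ! r)] else \<mu> @ [1])"

lemma length_add_cell: "map length (add_cell r x T) = incr r (map length T)"
  by (simp add: add_cell_def incr_def map_update)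

lemma incr_Cons: "incr (Suc r) (l # \<mu>) = l # incr r \<mu>" "incr 0 (l # \<mu>) = Suc l # \<mu>"
  by (simp_all add: incr_def)

lemma length_ins: "map length (ins x T) = incr (ins_row x T) (map length T)"
proof (induction x T rule: ins.induct)
  case (2 x R T)
  then show ?case by (auto simp: Let_def incr_Cons)
qed (simp add: incr_def)

lemma ins_row_le: "ins_row x T \<le> length T"
  by (induction x T rule: ins.induct) (auto simp: Let_def)

lemma mset_ins: "mset (concat (ins x T)) = add_mset x (mset (concat T))"
proof (induction x T rule: ins.induct)
  case (2 x R T)
  then show ?case using row_pos_le[of x R] by (auto simp: Let_def mset_update)
qed simp

section \<open>The row bumping lemma\<close>

text \<open>The second bumping path stays strictly to the right of the first: in each row it
  displaces a letter at least as large as the one displaced before, so the hypothesis is inherited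
  by the next row.\<close>

lemma ins_row_mono:
  "x \<le> y \<Longrightarrow> tableau T \<Longrightarrow> ins_row y (ins x T) \<le> ins_row x T"
proof (induction x T arbitrary: y rule: ins.induct)
  case (1 x)
  then show ?case by (simp add: row_pos_def)
next
  case (2 x R T)
  define i where "i = row_pos x R"
  have R: "sorted R" using 2 by simp
  show ?case
  proof (cases "i = length R")
    case True
    have "row_pos y (R @ [x]) = length (R @ [x])"
      using True row_pos_less_iff[OF R, of _ x] 2(2)
      by (intro row_pos_unique) (auto simp: nth_append less_Suc_eq i_def intro: order_trans)
    then show ?thesis using True by (simp add: i_def)
  next
    case False
    then have il: "i < length R" using row_pos_le[of x R] by (simp add: i_def)
    define R' where "R' = R[i := x]"
    define j where "j = row_pos y R'"
    have R': "sorted R'" using sorted_row_insert[of R x i] R False by (simp add: R'_def i_def)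
    show ?thesis
    proof (cases "j = length R'")
      case True
      then show ?thesis using False by (simp add: i_def j_def R'_def Let_def)
    next
      case jl: False
      have "i < j" using row_pos_less_iff[OF R', of i y] 2(2) il by (simp add: R'_def j_def)
      moreover have "j < length R" using jl row_pos_le[of y R'] by (simp add: j_def R'_def)
      ultimately have "R ! i \<le> R' ! j" using sorted_nth_mono[OF R, of i j] by (simp add: R'_def)
      then have "ins_row (R' ! j) (ins (R ! i) T) \<le> ins_row (R ! i) T"
        using 2 False by (simp add: i_def)
      then show ?thesis using False jl by (simp add: i_def j_def R'_def Let_def)
    qed
  qed
qed

text \<open>Here the second path stays weakly to the left of the first and displaces a smaller
  letter in every row. It cannot stop where the first one stopped, because the cell just created
  offers an entry to bump.\<close>

lemma ins_row_antimono:
  "y < x \<Longrightarrow> tableau T \<Longrightarrow> ins_row x T < ins_row y (ins x T)"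
proof (induction x T arbitrary: y rule: ins.induct)
  case (1 x)
  then show ?case by (simp add: row_pos_def)
next
  case (2 x R T)
  define i where "i = row_pos x R"
  have R: "sorted R" using 2 by simp
  show ?case
  proof (cases "i = length R")
    case True
    have "sorted (R @ [x])" using sorted_row_insert[of R x i] R True by (simp add: i_def)
    then have "row_pos y (R @ [x]) \<le> length R"
      using row_pos_less_iff[of "R @ [x]" "length R" y] 2(2) by (simp add: nth_append)
    then show ?thesis using True by (auto simp: i_def Let_def)
  next
    case False
    then have il: "i < length R" using row_pos_le[of x R] by (simp add: i_def)
    define R' where "R' = R[i := x]"
    define j where "j = row_pos y R'"
    have R': "sorted R'" using sorted_row_insert[of R x i] R False by (simp add: R'_def i_def)
    have ji: "j \<le> i" using row_pos_less_iff[OF R', of i y] 2(2) il by (simp add: R'_def j_def)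
    have "R' ! j \<le> x" using sorted_nth_mono[OF R' ji] il by (simp add: R'_def)
    then have "R' ! j < R ! i" using row_pos_nth_gt[of x R] il by (simp add: i_def)
    then have "ins_row (R ! i) T < ins_row (R' ! j) (ins (R ! i) T)"
      using 2 False by (simp add: i_def)
    then show ?thesis using False ji il by (simp add: i_def j_def R'_def Let_def)
  qed
qed

section \<open>Reverse insertion\<close>

definition corner :: "nat \<Rightarrow> 'a list list \<Rightarrow> bool" where
  "corner r T \<longleftrightarrow> r < length T \<and> (Suc r < length T \<longrightarrow> length (T ! Suc r) < length (T ! r))"

lemma corner_Suc: "corner (Suc r) (R # T) \<longleftrightarrow> corner r T"
  by (simp add: corner_def)

lemma corner_0: "corner 0 (R # T) \<longleftrightarrow> (T \<noteq> [] \<longrightarrow> length (hd T) < length R)"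
  by (auto simp: corner_def hd_conv_nth)

lemma del_ins: "tableau T \<Longrightarrow> del (ins_row x T) (ins x T) = (T, x)"
proof (induction x T rule: ins.induct)
  case (2 x R T)
  define i where "i = row_pos x R"
  have R: "sorted R" "R \<noteq> []" using 2 by auto
  show ?case
  proof (cases "i = length R")
    case True
    then show ?thesis using R by (simp add: i_def Let_def)
  next
    case False
    then have il: "i < length R" using row_pos_le[of x R] by (simp add: i_def)
    have xy: "x < R ! i" using row_pos_nth_gt[of x R] il by (simp add: i_def)
    have "length (takeWhile (\<lambda>z. z < R ! i) (R[i := x])) = Suc i"
    proof (rule length_takeWhile_eqI)
      show "Suc i \<le> length (R[i := x])" using il by simp
      fix c assume "c < Suc i"
      then have "R[i := x] ! c \<le> x"
        using row_pos_less_iff[OF R(1), of c x] il by (auto simp: nth_list_update i_def)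
      then show "R[i := x] ! c < R ! i" using xy by simp
    next
      assume "Suc i < length (R[i := x])"
      then show "\<not> R[i := x] ! Suc i < R ! i"
        using sorted_nth_mono[OF R(1), of i "Suc i"] by simp
    qed
    moreover have "del (ins_row (R ! i) T) (ins (R ! i) T) = (T, R ! i)"
      using 2 False by (simp add: i_def)
    ultimately show ?thesis using False il by (simp add: i_def[symmetric] Let_def)
  qed
qed simp

text \<open>The existential clause is the strengthening that carries the induction to the row above.
  The expelled letter comes from column \<open>j\<close> of the top row, the entries of the new top
  row are no smaller than the old ones, and from column \<open>j\<close> on they exceed the expelled
  letter. That letter is then written into the row above in a column \<open>i\<close> with
  \<open>j \<le> i\<close>, where exactly this is needed for strict columns.\<close>

lemma del_correct:
  assumes "tableau T" "corner r T" "del r T = (T', x)"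
  shows "tableau T' \<and> ins x T' = T \<and> ins_row x T' = r \<and>
    (\<exists>j<length (hd T). x = hd T ! j \<and> (T' \<noteq> [] \<longrightarrow> length (hd T') \<le> length (hd T) \<and>
      (\<forall>c<length (hd T'). hd T ! c \<le> hd T' ! c \<and> (j \<le> c \<longrightarrow> x < hd T' ! c))))"
  using assms
proof (induction r T arbitrary: T' x rule: del.induct)
  case (1 r)
  then show ?case by (simp add: corner_def)
next
  case (2 R T)
  then have R: "sorted R" "R \<noteq> []" "tableau T" "T \<noteq> [] \<longrightarrow> dominates R (hd T)" by auto
  have c: "T \<noteq> [] \<longrightarrow> length (hd T) < length R" using 2 by (simp add: corner_0)
  show ?case
  proof (cases "length R = 1")
    case True
    then obtain a where a: "R = [a]" by (cases R) auto
    have "T = []"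
    proof (rule ccontr)
      assume "T \<noteq> []"
      with R(3) have "hd T \<noteq> []" by (cases T) auto
      with c \<open>T \<noteq> []\<close> True show False by simp
    qed
    then show ?thesis using 2 a by simp
  next
    case False
    then have bl: "butlast R \<noteq> []" using R(2) by (cases R rule: rev_cases) auto
    have T': "T' = butlast R # T" "x = last R" using 2 False by auto
    have Rx: "R = butlast R @ [x]" using R(2) T' by simp
    have "dominates (butlast R) (hd T)" if "T \<noteq> []"
    proof -
      have "length (hd T) \<le> length (butlast R)" using c that by simp
      moreover have "butlast R ! c < hd T ! c" if "c < length (hd T)" for c
        using R(4) that calculation \<open>T \<noteq> []\<close> by (simp add: dominates_def nth_butlast)
      ultimately show ?thesis by (simp add: dominates_def)
    qed
    moreover have "sorted (butlast R)" using R(1) Rx by (metis sorted_append)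
    moreover have "row_pos x (butlast R) = length (butlast R)"
    proof -
      have "\<forall>z\<in>set (butlast R). z \<le> x" using R(1) Rx by (metis sorted_append list.set_intros(1))
      then show ?thesis by (simp add: row_pos_def takeWhile_eq_all_conv[THEN iffD2])
    qed
    moreover have "x = R ! (length R - 1)" using T' R by (simp add: last_conv_nth)
    ultimately show ?thesis using T' R bl Rx
      by (auto simp: Let_def nth_butlast intro!: exI[of _ "length R - 1"])
  qed
next
  case (3 r R T)
  then have R: "sorted R" "R \<noteq> []" "tableau T" "T \<noteq> [] \<longrightarrow> dominates R (hd T)" by auto
  have cr: "corner r T" using 3 by (simp add: corner_Suc)
  then have "T \<noteq> []" by (auto simp: corner_def)
  obtain T1 y where d: "del r T = (T1, y)" by (cases "del r T")
  from 3(1)[OF R(3) cr d]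
  obtain j where T1: "tableau T1" "ins y T1 = T" "ins_row y T1 = r" and j: "j < length (hd T)" "y = hd T ! j"
    and jj: "T1 \<noteq> [] \<Longrightarrow> length (hd T1) \<le> length (hd T)"
      "\<And>c. T1 \<noteq> [] \<Longrightarrow> c < length (hd T1) \<Longrightarrow> hd T ! c \<le> hd T1 ! c"
      "\<And>c. T1 \<noteq> [] \<Longrightarrow> c < length (hd T1) \<Longrightarrow> j \<le> c \<Longrightarrow> y < hd T1 ! c"
    by auto
  have dm: "length (hd T) \<le> length R" "\<And>c. c < length (hd T) \<Longrightarrow> R ! c < hd T ! c"
    using R(4) \<open>T \<noteq> []\<close> by (auto simp: dominates_def)
  define p where "p = length (takeWhile (\<lambda>z. z < y) R)"
  have pl: "p \<le> length R" by (simp add: p_def length_takeWhile_le)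
  have lt: "R ! c < y" if "c < p" for c
    using that unfolding p_def by (metis nth_mem set_takeWhileD takeWhile_nth)
  have ge: "y \<le> R ! c" if "p \<le> c" "c < length R" for c
  proof -
    have "\<not> R ! p < y" using that nth_length_takeWhile[of "\<lambda>z. z < y" R] by (simp add: p_def)
    then show ?thesis using sorted_nth_mono[OF R(1) that] by simp
  qed
  \<comment> \<open>Strict columns give \<open>R ! j < hd T ! j = y\<close>, so an entry smaller
    than \<open>y\<close> exists and the displaced column lies weakly to the right of
    \<open>j\<close>.\<close>
  have "j < p"
  proof (rule ccontr)
    assume "\<not> j < p"
    then have "y \<le> R ! j" using ge[of j] j dm by simp
    with dm(2)[OF j(1)] j show False by simp
  qed
  define i where "i = p - 1"
  have i: "p = Suc i" "j \<le> i" "i < length R" using \<open>j < p\<close> pl by (auto simp: i_def)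
  have T': "T' = R[i := y] # T1" "x = R ! i" using 3 d by (auto simp: Let_def i_def p_def)
  have xy: "x < y" using lt[of i] i T' by simp
  have srt: "sorted (R[i := y])"
  proof -
    have "R[i := y] ! a \<le> R[i := y] ! b" if "a < b" "b < length R" for a b
      using that sorted_nth_mono[OF R(1), of a b] lt[of a] ge[of b] i
      by (auto simp: nth_list_update)
    then show ?thesis by (auto simp: sorted_wrt_iff_nth_less)
  qed
  have pos: "row_pos x (R[i := y]) = i"
    using i xy T' sorted_nth_mono[OF R(1)] by (intro row_pos_unique) auto
  have dominates: "dominates (R[i := y]) (hd T1)" if "T1 \<noteq> []"
    unfolding dominates_def
  proof (intro conjI allI impI)
    show "length (hd T1) \<le> length (R[i := y])" using jj(1)[OF that] dm by simp
    fix c assume c: "c < length (hd T1)"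
    show "R[i := y] ! c < hd T1 ! c"
      using jj(2)[OF that c] jj(3)[OF that c] dm(2)[of c] jj(1)[OF that] c i
      by (cases "c = i") auto
  qed
  have "R[i := y] \<noteq> []" using R by simp
  moreover have "\<forall>c<length R. R ! c \<le> R[i := y] ! c \<and> (i \<le> c \<longrightarrow> x < R[i := y] ! c)"
    using i xy T' ge by (auto simp: nth_list_update) (metis Suc_leI le_neq_implies_less order.strict_trans2)
  ultimately show ?case
    using T' T1 srt pos dominates i by (auto simp: Let_def)
qed

section \<open>Adding and removing the largest entry\<close>

lemma tableau_iff:
  "tableau T \<longleftrightarrow> (\<forall>R\<in>set T. R \<noteq> [] \<and> sorted R) \<and> (\<forall>r. Suc r < length T \<longrightarrow> dominates (T ! r) (T ! Suc r))"
proof (induction T)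
  case (Cons R T)
  have "(\<forall>r. Suc r < length (R # T) \<longrightarrow> dominates ((R # T) ! r) ((R # T) ! Suc r)) \<longleftrightarrow>
    (T \<noteq> [] \<longrightarrow> dominates R (hd T)) \<and> (\<forall>r. Suc r < length T \<longrightarrow> dominates (T ! r) (T ! Suc r))" (is "?l \<longleftrightarrow> ?r")
  proof
    assume l: ?l
    have "dominates R (hd T)" if "T \<noteq> []" using l[rule_format, of 0] that by (simp add: hd_conv_nth)
    moreover have "dominates (T ! r) (T ! Suc r)" if "Suc r < length T" for r
      using l[rule_format, of "Suc r"] that by simp
    ultimately show ?r by blast
  next
    assume r: ?r
    show ?l
    proof (intro allI impI)
      fix i assume "Suc i < length (R # T)"
      then show "dominates ((R # T) ! i) ((R # T) ! Suc i)"
        using r by (cases i) (auto simp: hd_conv_nth)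
    qed
  qed
  then show ?case using Cons by auto
qed simp

definition part :: "nat list \<Rightarrow> bool" where
  "part \<mu> \<longleftrightarrow> sorted_wrt (\<ge>) \<mu> \<and> (\<forall>p\<in>set \<mu>. 0 < p)"

lemma part_tableau: "tableau T \<Longrightarrow> part (map length T)"
proof (induction T)
  case (Cons R T)
  then have IH: "part (map length T)" and R: "0 < length R" by auto
  have "length S \<le> length R" if "S \<in> set T" for S
  proof -
    obtain U T' where T: "T = U # T'" using \<open>S \<in> set T\<close> by (cases T) auto
    then have "length U \<le> length R" using Cons.prems by (simp add: dominates_def)
    moreover have "length S \<le> length U" using IH T that by (auto simp: part_def)
    ultimately show ?thesis by simp
  qed
  then show ?case using IH R by (simp add: part_def)
qed (simp add: part_def)

lemma part_nth: "part \<mu> \<Longrightarrow> i \<le> j \<Longrightarrow> j < length \<mu> \<Longrightarrow> \<mu> ! j \<le> \<mu> ! i"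
  using sorted_wrt_nth_less[of "(\<ge>)" \<mu> i j] unfolding part_def by (cases "i = j") auto

text \<open>The enlarged row reveals whether it existed before: parts are positive, so a row that
  has been extended has length at least 2, while a new row has length 1.\<close>

lemma incr_inj:
  assumes "part \<mu>" "part \<nu>" "r \<le> length \<mu>" "r \<le> length \<nu>" "incr r \<mu> = incr r \<nu>"
  shows "\<mu> = \<nu>"
proof -
  have pos: "0 < \<mu> ! r" if "r < length \<mu>" using that assms(1) by (simp add: part_def)
  have pos': "0 < \<nu> ! r" if "r < length \<nu>" using that assms(2) by (simp add: part_def)
  have n: "incr r \<mu> ! r = (if r < length \<mu> then Suc (\<mu> ! r) else 1)"
    "incr r \<nu> ! r = (if r < length \<nu> then Suc (\<nu> ! r) else 1)"
    using assms(3,4) by (auto simp: incr_def nth_append)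
  have e: "(if r < length \<mu> then Suc (\<mu> ! r) else 1) = (if r < length \<nu> then Suc (\<nu> ! r) else 1)"
    using n assms(5) by metis
  show ?thesis
  proof (cases "r < length \<mu>")
    case True
    then have r: "r < length \<nu>" "\<mu> ! r = \<nu> ! r" using e pos by (auto split: if_splits)
    then have "\<mu>[r := Suc (\<mu> ! r)] = \<nu>[r := Suc (\<nu> ! r)]"
      using assms(5) True by (simp add: incr_def)
    then show ?thesis using r(2) by (metis list_update_id list_update_overwrite)
  next
    case False
    then have "\<not> r < length \<nu>" using e pos' by (auto split: if_splits)
    then show ?thesis using False assms(5) by (simp add: incr_def)
  qed
qed

lemma in_add_cell:
  assumes "r \<le> length T"
  shows "s < length (add_cell r z T) \<and> y \<in> set (add_cell r z T ! s) \<longleftrightarrow>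
    s < length T \<and> y \<in> set (T ! s) \<or> s = r \<and> y = z"
  using assms by (auto simp: add_cell_def nth_list_update nth_append less_Suc_eq)

lemma mset_add_cell: "r \<le> length T \<Longrightarrow> mset (concat (add_cell r z T)) = add_mset z (mset (concat T))"
proof (induction T arbitrary: r)
  case (Cons R T)
  have "add_cell (Suc r) z (R # T) = R # add_cell r z T" "add_cell 0 z (R # T) = (R @ [z]) # T" for r
    by (simp_all add: add_cell_def)
  then show ?case using Cons by (cases r) auto
qed (simp add: add_cell_def)

lemma add_cell_inj:
  assumes "length T = length S" "add_cell r z T = add_cell r z S"
  shows "T = S"
proof (cases "r < length T")
  case True
  then have *: "T[r := T ! r @ [z]] = S[r := S ! r @ [z]]" using assms by (simp add: add_cell_def)
  then have "T ! r = S ! r" using True assms(1)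
    by (metis append1_eq_conv nth_list_update_eq)
  then show ?thesis using * by (metis list_update_id list_update_overwrite)
qed (use assms in \<open>simp add: add_cell_def\<close>)

text \<open>The new entry exceeds all others, so rows and columns stay increasing wherever it is
  compared. Only the shape could go wrong, and the partition hypothesis guarantees a cell above the
  new one.\<close>

lemma tableau_add_cell:
  assumes "tableau T" "r \<le> length T" "part (map length (add_cell r z T))"
    "\<And>y. y \<in> set (concat T) \<Longrightarrow> y < z"
  shows "tableau (add_cell r z T)"
proof -
  have T: "\<And>R. R \<in> set T \<Longrightarrow> R \<noteq> [] \<and> sorted R" "\<And>s. Suc s < length T \<Longrightarrow> dominates (T ! s) (T ! Suc s)"
    using assms(1) by (auto simp: tableau_iff)
  have lz: "R ! c < z" if "R \<in> set T" "c < length R" for R c using assms(4)[of "R ! c"] nth_mem[OF that(2)] that(1) by auto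
  let ?T = "add_cell r z T"
  have len: "length (?T ! b) \<le> length (?T ! a)" if "a \<le> b" "b < length ?T" for a b
    using part_nth[OF assms(3), of a b] that by simp
  have row: "R \<noteq> [] \<and> sorted R" if "R \<in> set ?T" for R
  proof -
    have "R \<in> set T \<or> R = [z] \<or> (\<exists>S\<in>set T. R = S @ [z])"
      using that set_update_subset_insert[of T r "T ! r @ [z]"] nth_mem[of r T]
      by (auto simp: add_cell_def split: if_splits)
    moreover have "\<forall>y\<in>set S. y \<le> z" if "S \<in> set T" for S
      using that assms(4) by (force intro: less_imp_le)
    ultimately show ?thesis using T(1) by (auto simp: sorted_append)
  qed
  have "dominates (?T ! s) (?T ! Suc s)" if s: "Suc s < length ?T" for s
    unfolding dominates_def
  proof (intro conjI allI impI)
    show le: "length (?T ! Suc s) \<le> length (?T ! s)" using len[of s "Suc s"] s by simp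
    fix c assume c: "c < length (?T ! Suc s)"
    show "?T ! s ! c < ?T ! Suc s ! c"
    proof (cases "Suc s = r \<and> c = length (?T ! Suc s) - 1")
      case True
      then have "?T ! Suc s ! c = z" using assms(2) by (auto simp: add_cell_def nth_append)
      moreover have "?T ! s = T ! s" "s < length T" using True assms(2)
        by (auto simp: add_cell_def nth_append)
      ultimately show ?thesis using lz[of "T ! s" c] le c by simp
    next
      case False
      have ls: "Suc s < length T"
        using s False c assms(2) by (auto simp: add_cell_def nth_append split: if_splits)
      have c': "c < length (T ! Suc s)"
        using c False ls by (auto simp: add_cell_def nth_list_update nth_append split: if_splits)
      have "T ! s ! c < T ! Suc s ! c" "c < length (T ! s)"
        using T(2)[OF ls] c' by (auto simp: dominates_def)
      moreover have "?T ! s ! c = T ! s ! c" "?T ! Suc s ! c = T ! Suc s ! c"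
        using calculation(2) c' ls by (auto simp: add_cell_def nth_list_update nth_append)
      ultimately show ?thesis by simp
    qed
  qed
  with row show ?thesis by (auto simp: tableau_iff)
qed

text \<open>The multiset equation says in one stroke that the entries are distinct and fill
  \<open>{1..n}\<close>; it is the form that \<open>mset_add_cell\<close> updates.\<close>

definition std_tab :: "nat \<Rightarrow> nat list list \<Rightarrow> bool" where
  "std_tab n T \<longleftrightarrow> tableau T \<and> mset (concat T) = mset [1..<Suc n]"

lemma std_tab_set: "std_tab n T \<Longrightarrow> set (concat T) = {1..n}"
  unfolding std_tab_def by (metis set_mset_mset set_upt atLeastLessThanSuc_atLeastAtMost)

lemma std_tab_nth: "std_tab n T \<Longrightarrow> s < length T \<Longrightarrow> y \<in> set (T ! s) \<Longrightarrow> y \<le> n"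
proof -
  assume "std_tab n T" "s < length T" "y \<in> set (T ! s)"
  then have "y \<in> set (concat T)" using nth_mem by fastforce
  then show "y \<le> n" unfolding std_tab_set[OF \<open>std_tab n T\<close>] by simp
qed

text \<open>The entry \<open>Suc n\<close> occurs only in the new cell, so \<open>n\<close> is the
  only possible new descent, and it is one exactly when it stands in a higher row.\<close>

lemma Des_add_cell:
  assumes "set (concat T) \<subseteq> {1..n}" "r \<le> length T"
  shows "Des (add_cell r (Suc n) T) = Des T \<union> {i. i = n \<and> (\<exists>s<r. s < length T \<and> n \<in> set (T ! s))}"
proof -
  have le: "y \<le> n" if "s < length T" "y \<in> set (T ! s)" for s y
    using assms(1) that(2) nth_mem[OF that(1)] by fastforce
  have D: "Des U = {i. \<exists>p q. p < q \<and> (p < length U \<and> i \<in> set (U ! p)) \<and> (q < length U \<and> Suc i \<in> set (U ! q))}"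
    for U unfolding Des_def by (rule Collect_cong) (meson order.strict_trans)
  show ?thesis unfolding D in_add_cell[OF assms(2)]
    using le by (auto dest: le)
qed

text \<open>The largest entry ends its row and has no cell below it, so it occupies a corner and can
  be taken off.\<close>

lemma std_tab_remove:
  assumes "std_tab (Suc n) T"
  obtains r S where "r \<le> length S" "T = add_cell r (Suc n) S" "std_tab n S" "corner r T"
proof -
  have tab: "tableau T" using assms by (simp add: std_tab_def)
  have T: "\<And>R. R \<in> set T \<Longrightarrow> R \<noteq> [] \<and> sorted R" "\<And>s. Suc s < length T \<Longrightarrow> dominates (T ! s) (T ! Suc s)"
    using tab by (auto simp: tableau_iff)
  have "Suc n \<in> set (concat T)" using std_tab_set[OF assms] by simp
  then obtain R0 where "R0 \<in> set T" "Suc n \<in> set R0" by auto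
  then obtain r where r: "r < length T" "Suc n \<in> set (T ! r)"
    by (metis in_set_conv_nth)
  note le = std_tab_nth[OF assms]
  define R where "R = butlast (T ! r)"
  have "sorted (T ! r)" "T ! r \<noteq> []" using T(1)[of "T ! r"] r by auto
  then have "last (T ! r) = Suc n"
  proof -
    obtain c where c: "c < length (T ! r)" "T ! r ! c = Suc n" using r(2) by (metis in_set_conv_nth)
    then have "Suc n \<le> last (T ! r)"
      using sorted_nth_mono[OF \<open>sorted (T ! r)\<close>, of c "length (T ! r) - 1"] \<open>T ! r \<noteq> []\<close>
      by (simp add: last_conv_nth)
    then show ?thesis using le[OF r(1), of "last (T ! r)"] \<open>T ! r \<noteq> []\<close> by simp
  qed
  then have TR: "T ! r = R @ [Suc n]" using \<open>T ! r \<noteq> []\<close> by (metis R_def append_butlast_last_id)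
  have cor: "corner r T"
    unfolding corner_def
  proof (intro conjI impI)
    show "r < length T" by fact
    assume s: "Suc r < length T"
    have d: "dominates (T ! r) (T ! Suc r)" using T(2) s .
    show "length (T ! Suc r) < length (T ! r)"
    proof (rule ccontr)
      assume "\<not> ?thesis"
      then have "length R < length (T ! Suc r)" using TR by simp
      then have "Suc n < T ! Suc r ! length R" using d TR by (auto simp: dominates_def)
      with le[OF s, of "T ! Suc r ! length R"] \<open>length R < length (T ! Suc r)\<close> show False by simp
    qed
  qed
  \<comment> \<open>A row that held only the removed entry must disappear, because rows of a tableau
    are nonempty. Being a corner, it is then the bottom row.\<close>
  define S where "S = (if R = [] then butlast T else T[r := R])"
  have last: "r = length T - 1" if "R = []"
  proof (rule ccontr)
    assume "r \<noteq> length T - 1"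
    then have s: "Suc r < length T" using r by simp
    then have "T ! Suc r = []" using cor TR that by (simp add: corner_def)
    with T(1)[OF nth_mem[OF s]] show False by simp
  qed
  have rS: "r \<le> length S" using r by (auto simp: S_def)
  have TS: "T = add_cell r (Suc n) S"
  proof (cases "R = []")
    case True
    then have "T = butlast T @ [T ! r]" using last r
      by (metis append_butlast_last_id last_conv_nth length_0_conv not_less_zero)
    then show ?thesis using True TR last by (simp add: S_def add_cell_def)
  next
    case False
    then show ?thesis using r TR by (simp add: S_def add_cell_def) (metis TR list_update_id)
  qed
  have "tableau S"
  proof (cases "R = []")
    case True
    then show ?thesis using T by (auto simp: S_def tableau_iff nth_butlast dest: in_set_butlastD)
  next
    case False
    have 1: "sorted R" using \<open>sorted (T ! r)\<close> TR by (simp add: sorted_append)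
    have "dominates (T[r := R] ! s) (T[r := R] ! Suc s)" if s: "Suc s < length T" for s
    proof -
      have d: "dominates (T ! s) (T ! Suc s)" using T(2) s .
      consider "s = r" | "Suc s = r" | "s \<noteq> r" "Suc s \<noteq> r" by blast
      then show ?thesis
      proof cases
        case 1
        then have "length (T ! Suc r) \<le> length R" using cor s TR by (simp add: corner_def)
        then show ?thesis using 1 d s TR dominates_append_leftD[of R "Suc n" "T ! Suc r"] by simp
      next
        case 2
        then show ?thesis using d s TR dominates_append_rightD[of "T ! s" R "Suc n"] by simp
      next
        case 3
        then show ?thesis using d by simp
      qed
    qed
    then show ?thesis using False 1 T(1) set_update_subset_insert[of T r R]
      by (auto simp: S_def tableau_iff)
  qed
  moreover have "mset (concat S) = mset [1..<Suc n]"
    using assms mset_add_cell[OF rS, of "Suc n"] by (simp add: std_tab_def TS[symmetric])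
  ultimately show ?thesis using that rS TS cor by (simp add: std_tab_def)
qed

section \<open>The correspondence between words and pairs of tableaux\<close>

text \<open>The list is consumed from its end, since the tail is inserted before the head; this
  keeps the recursion structural. Inserting a word in reading order therefore means applying
  \<open>rsk\<close> to its reversal.\<close>

fun rsk :: "nat list \<Rightarrow> nat list list \<times> nat list list" where
  "rsk [] = ([], [])"
| "rsk (x # v) = (let (P, Q) = rsk v in (ins x P, add_cell (ins_row x P) (Suc (length v)) Q))"

definition rsk_pairs :: "nat \<Rightarrow> (nat list list \<times> nat list list) set" where
  "rsk_pairs n = {(P, Q). tableau P \<and> std_tab n Q \<and> map length P = map length Q}"

lemma rsk_in_pairs: "rsk v \<in> rsk_pairs (length v)"
proof (induction v)
  case (Cons x v)
  obtain P Q where PQ: "rsk v = (P, Q)" by fastforce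
  with Cons have h: "tableau P" "std_tab (length v) Q" "map length P = map length Q"
    by (auto simp: rsk_pairs_def)
  have r: "ins_row x P \<le> length Q" using ins_row_le[of x P] h(3) by (metis length_map)
  have sh: "map length (ins x P) = map length (add_cell (ins_row x P) (Suc (length v)) Q)"
    by (simp add: length_ins length_add_cell h)
  have "tableau (add_cell (ins_row x P) (Suc (length v)) Q)"
  proof (rule tableau_add_cell[OF _ r])
    show "tableau Q" using h by (simp add: std_tab_def)
    show "part (map length (add_cell (ins_row x P) (Suc (length v)) Q))"
      using part_tableau[OF tableau_ins[OF h(1)]] sh by metis
    show "y < Suc (length v)" if "y \<in> set (concat Q)" for y
      using that unfolding std_tab_set[OF h(2)] by simp
  qed
  then have "std_tab (length (x # v)) (add_cell (ins_row x P) (Suc (length v)) Q)"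
    using h mset_add_cell[OF r] by (simp add: std_tab_def)
  then show ?case using PQ h sh tableau_ins by (simp add: rsk_pairs_def)
qed (simp add: rsk_pairs_def std_tab_def)

lemma rsk_inj: "rsk v = rsk w \<Longrightarrow> length v = length w \<Longrightarrow> v = w"
proof (induction v arbitrary: w)
  case (Cons x v)
  then obtain y u where w: "w = y # u" "length u = length v" by (cases w) auto
  obtain P Q where PQ: "rsk v = (P, Q)" by fastforce
  obtain P' Q' where PQ': "rsk u = (P', Q')" by fastforce
  have h: "tableau P" "std_tab (length v) Q" "map length P = map length Q"
    using rsk_in_pairs[of v] PQ by (auto simp: rsk_pairs_def)
  have h': "tableau P'" "std_tab (length v) Q'" "map length P' = map length Q'"
    using rsk_in_pairs[of u] PQ' w by (auto simp: rsk_pairs_def)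
  let ?r = "ins_row x P" and ?r' = "ins_row y P'" and ?n = "Suc (length v)"
  have r: "?r \<le> length Q" "?r' \<le> length Q'"
    using ins_row_le[of x P] ins_row_le[of y P'] h(3) h'(3) by (metis length_map)+
  have e: "ins x P = ins y P'" "add_cell ?r ?n Q = add_cell ?r' ?n Q'"
    using Cons PQ PQ' w by auto
  have nin: "\<not> (s < length Q \<and> ?n \<in> set (Q ! s))" "\<not> (s < length Q' \<and> ?n \<in> set (Q' ! s))" for s
    using std_tab_nth[OF h(2), of s ?n] std_tab_nth[OF h'(2), of s ?n] by auto
  \<comment> \<open>The largest entry of the recording tableau marks the row where the last
    insertion ended, so equal recording tableaux give equal rows, and \<open>del_ins\<close>
    recovers both the letter and the previous tableau.\<close>
  have rr: "?r = ?r'"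
    using in_add_cell[OF r(1), of ?r ?n ?n] in_add_cell[OF r(2), of ?r ?n ?n] nin e by auto
  have PP: "P = P'" "x = y" using del_ins[OF h(1), of x] del_ins[OF h'(1), of y]
    by (metis e(1) rr prod.inject)+
  have "length Q = length Q'" using h(3) h'(3) PP by (metis length_map)
  then have "Q = Q'" using e(2) rr by (metis add_cell_inj)
  then have "rsk v = rsk u" using PQ PQ' PP by simp
  then show ?case using Cons w PP by simp
qed simp

text \<open>The corner of \<open>Q\<close> that holds the largest entry names the row in which the
  last insertion must have ended; reverse insertion from the same row of \<open>P\<close> undoes
  it.\<close>

lemma rsk_surj: "(P, Q) \<in> rsk_pairs n \<Longrightarrow> \<exists>v. length v = n \<and> rsk v = (P, Q)"
proof (induction n arbitrary: P Q)
  case 0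
  then have "concat Q = []" "tableau Q" by (auto simp: rsk_pairs_def std_tab_def)
  then have "Q = []" by (cases Q) auto
  then show ?case using 0 by (auto simp: rsk_pairs_def)
next
  case (Suc n)
  then have h: "tableau P" "std_tab (Suc n) Q" "map length P = map length Q"
    by (auto simp: rsk_pairs_def)
  obtain r S where S: "r \<le> length S" "Q = add_cell r (Suc n) S" "std_tab n S" "corner r Q"
    using std_tab_remove[OF h(2)] .
  have ln: "length P = length Q" using h(3) by (metis length_map)
  have ln': "length (P ! i) = length (Q ! i)" if "i < length Q" for i
    using h(3) that ln by (metis nth_map)
  have cP: "corner r P" using S(4) ln ln' by (auto simp: corner_def)
  obtain P' x where d: "del r P = (P', x)" by fastforce
  have P': "tableau P'" "ins x P' = P" "ins_row x P' = r" using del_correct[OF h(1) cP d] by auto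
  have "incr r (map length P') = incr r (map length S)"
    using h(3) length_ins[of x P', unfolded P'(2,3)] length_add_cell[of r "Suc n" S, folded S(2)]
    by simp
  then have "map length P' = map length S"
  proof (rule incr_inj[rotated 4])
    show "part (map length P')" "part (map length S)"
      using part_tableau P'(1) S(3) by (auto simp: std_tab_def)
    show "r \<le> length (map length P')" using ins_row_le[of x P'] P'(3) by simp
    show "r \<le> length (map length S)" using S(1) by simp
  qed
  then obtain v where "length v = n" "rsk v = (P', S)"
    using Suc.IH[of P' S] P' S by (auto simp: rsk_pairs_def)
  moreover from this have "rsk (x # v) = (P, Q)" using P'(2,3) S(2) by simp
  ultimately show ?case by (intro exI[of _ "x # v"]) simp
qed

lemma rsk_content: "mset (concat (fst (rsk v))) = mset v"
  by (induction v) (simp_all add: mset_ins split_beta)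

text \<open>Positions count from 1 as for tableaux: \<open>i\<close> is the gap between the list
  entries with indices \<open>i - 1\<close> and \<open>i\<close>.\<close>

definition word_des :: "nat list \<Rightarrow> nat set" where
  "word_des w = {i. 0 < i \<and> i < length w \<and> w ! i < w ! (i - 1)}"

lemma word_des_snoc:
  "word_des (w @ [x]) = word_des w \<union> {i. i = length w \<and> w \<noteq> [] \<and> x < last w}"
proof (rule Set.set_eqI)
  fix i
  consider "i < length w" | "i = length w" | "length w < i" by linarith
  then show "i \<in> word_des (w @ [x]) \<longleftrightarrow> i \<in> word_des w \<union> {i. i = length w \<and> w \<noteq> [] \<and> x < last w}"
  proof cases
    case 2
    then show ?thesis by (cases w rule: rev_cases) (auto simp: word_des_def nth_append)
  qed (auto simp: word_des_def nth_append)
qed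

text \<open>By the row bumping lemma the cell added last lies in a lower row than its predecessor
  exactly when the letter inserted last is smaller than the one before. That is a descent of the
  tableau and of the word at the same position.\<close>

lemma rsk_Des: "Des (snd (rsk v)) = word_des (rev v)"
proof (induction v)
  case Nil
  then show ?case by (simp add: Des_def word_des_def)
next
  case (Cons x v)
  obtain P Q where PQ: "rsk v = (P, Q)" by fastforce
  have h: "tableau P" "std_tab (length v) Q" "map length P = map length Q"
    using rsk_in_pairs[of v] PQ by (auto simp: rsk_pairs_def)
  have r: "ins_row x P \<le> length Q" using ins_row_le[of x P] h(3) by (metis length_map)
  have "(\<exists>s<ins_row x P. s < length Q \<and> length v \<in> set (Q ! s)) \<longleftrightarrow> v \<noteq> [] \<and> x < last (rev v)"
  proof (cases v)
    case Nil
    then show ?thesis using PQ by simp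
  next
    case (Cons y u)
    obtain P' Q' where PQ': "rsk u = (P', Q')" by fastforce
    have h': "tableau P'" "std_tab (length u) Q'" "map length P' = map length Q'"
      using rsk_in_pairs[of u] PQ' by (auto simp: rsk_pairs_def)
    let ?r = "ins_row y P'"
    have r': "?r \<le> length Q'" using ins_row_le[of y P'] h'(3) by (metis length_map)
    have P: "P = ins y P'" "Q = add_cell ?r (length v) Q'" using PQ PQ' Cons by auto
    have nin: "\<not> (s < length Q' \<and> length v \<in> set (Q' ! s))" for s
      using std_tab_nth[OF h'(2), of s "length v"] Cons by auto
    have "(s < length Q \<and> length v \<in> set (Q ! s)) \<longleftrightarrow> s = ?r" for s
      using in_add_cell[OF r', of s "length v" "length v"] nin P by blast
    then have "(\<exists>s<ins_row x P. s < length Q \<and> length v \<in> set (Q ! s)) \<longleftrightarrow> ?r < ins_row x P" by simp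
    also have "\<dots> \<longleftrightarrow> x < y"
      using ins_row_mono[of y x P'] ins_row_antimono[of x y P'] h'(1) unfolding P(1)
      by (cases "x < y") auto
    finally show ?thesis using Cons by simp
  qed
  then show ?case
    using Cons PQ Des_add_cell[of Q "length v" "ins_row x P"] r std_tab_set[OF h(2)] word_des_snoc[of "rev v" x]
    by auto
qed

section \<open>Passing to tableaux of a prescribed shape\<close>

lemma columns_strict_iff:
  assumes "part (map length T)"
  shows "columns_strict T \<longleftrightarrow> (\<forall>r. Suc r < length T \<longrightarrow> dominates (T ! r) (T ! Suc r))"
proof -
  have "length (T ! Suc r) \<le> length (T ! r)" if "Suc r < length T" for r
    using part_nth[OF assms, of r "Suc r"] that by simp
  then show ?thesis unfolding columns_strict_def dominates_def
    by (meson order.strict_trans2)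
qed

lemma SSYT_iff:
  assumes "part \<mu>"
  shows "T \<in> SSYT \<mu> \<longleftrightarrow> map length T = \<mu> \<and> tableau T"
proof (cases "map length T = \<mu>")
  case True
  then have "\<forall>R\<in>set T. R \<noteq> []" using assms by (auto simp: part_def)
  then show ?thesis using True columns_strict_iff[of T] assms by (auto simp: SSYT_def tableau_iff)
qed (simp add: SSYT_def)

text \<open>Strictly increasing rows are weakly increasing rows with distinct entries, and
  distinctness is already contained in the multiset condition of \<open>std_tab\<close>.\<close>

lemma SYT_iff:
  assumes "part \<mu>" "sum_list \<mu> = n"
  shows "T \<in> SYT \<mu> \<longleftrightarrow> map length T = \<mu> \<and> std_tab n T"
proof (cases "map length T = \<mu>")
  case True
  have ne: "\<forall>R\<in>set T. R \<noteq> []" using True assms by (auto simp: part_def)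
  have *: "distinct (concat T) \<and> set (concat T) = {1..n} \<longleftrightarrow> mset (concat T) = mset [1..<Suc n]"
    by (metis atLeastLessThanSuc_atLeastAtMost distinct_upt mset_eq_imp_distinct_iff set_eq_iff_mset_eq_distinct
        set_mset_mset set_upt)
  have dist: "distinct R" if "distinct (concat T)" "R \<in> set T" for R
    using that by (induction T) auto
  show ?thesis
    using True columns_strict_iff[of T] assms ne dist *
    unfolding SYT_def std_tab_def tableau_iff mem_Collect_eq strict_sorted_iff by blast
qed (simp add: SYT_def)

lemma finite_partitions: "finite {\<mu>. is_partition n \<mu>}"
proof (rule finite_subset)
  show "{\<mu>. is_partition n \<mu>} \<subseteq> {\<mu>. set \<mu> \<subseteq> {..n} \<and> length \<mu> \<le> n}"
  proof
    fix \<mu> assume "\<mu> \<in> {\<mu>. is_partition n \<mu>}"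
    then have h: "\<forall>p\<in>set \<mu>. 0 < p" "sum_list \<mu> = n" by (auto simp: is_partition_def)
    have "length \<nu> \<le> sum_list \<nu>" if "\<forall>p\<in>set \<nu>. 0 < p" for \<nu> :: "nat list"
      using that by (induction \<nu>) auto
    then show "\<mu> \<in> {\<mu>. set \<mu> \<subseteq> {..n} \<and> length \<mu> \<le> n}"
      using h member_le_sum_list[of _ \<mu>] by auto
  qed
qed (rule finite_lists_length_le, simp)

lemma finite_words_content:
  "finite {w. length w = n \<and> (\<forall>i. count_list w i = lookup \<alpha> i)}"
proof (rule finite_subset)
  show "{w. length w = n \<and> (\<forall>i. count_list w i = lookup \<alpha> i)} \<subseteq>
      {w. set w \<subseteq> keys \<alpha> \<and> length w = n}"
  proof (intro subsetI CollectI conjI)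
    fix w i assume "w \<in> {w. length w = n \<and> (\<forall>i. count_list w i = lookup \<alpha> i)}" "i \<in> set w"
    then show "i \<in> keys \<alpha>" by (metis (mono_tags, lifting) count_list_0_iff in_keys_iff mem_Collect_eq)
  qed simp
qed (rule finite_lists_length_eq, simp)

text \<open>Insertion preserves the content in \<open>P\<close> and the descent set in
  \<open>Q\<close>, so both sides count the same words, grouped on the left by the common shape. The
  condition \<open>C\<close> on descent sets is kept arbitrary, so that the hook condition can be
  inserted as a whole.\<close>

theorem sum_tableaux_schur:
  "(\<Sum>\<mu> | is_partition n \<mu>. int (card {T \<in> SYT \<mu>. C (Des T)}) * schur \<mu> \<alpha>) =
    int (card {w. length w = n \<and> (\<forall>i. count_list w i = lookup \<alpha> i) \<and> C (word_des w)})"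
proof -
  define cont where "cont = (\<lambda>w. \<forall>i. count_list w i = lookup \<alpha> i)"
  define W where "W = {w. length w = n \<and> cont w \<and> C (word_des w)}"
  define A where "A = (\<lambda>\<mu>. {T \<in> SSYT \<mu>. cont (concat T)})"
  define B where "B = (\<lambda>\<mu>. {T \<in> SYT \<mu>. C (Des T)})"
  define f where "f = (\<lambda>w. rsk (rev w))"
  have part: "is_partition n \<mu> \<longleftrightarrow> part \<mu> \<and> sum_list \<mu> = n" for \<mu>
    by (auto simp: is_partition_def part_def)
  have cont: "cont (concat (fst (f w))) \<longleftrightarrow> cont w" for w
    using rsk_content[of "rev w"] by (simp add: cont_def f_def count_mset[symmetric])
  have Des: "Des (snd (f w)) = word_des w" for w using rsk_Des[of "rev w"] by (simp add: f_def)
  have fin: "finite W"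
    by (rule finite_subset[OF _ finite_words_content[of n \<alpha>]]) (auto simp: W_def cont_def)
  have inj: "inj_on f W"
    using rsk_inj by (auto simp: inj_on_def f_def W_def) (metis length_rev rev_rev_ident)
  have img: "f ` W = (\<Union>\<mu>\<in>{\<mu>. is_partition n \<mu>}. A \<mu> \<times> B \<mu>)"
  proof (intro equalityI subsetI)
    fix p assume "p \<in> f ` W"
    then obtain w where w: "w \<in> W" "p = f w" by blast
    obtain P Q where PQ: "f w = (P, Q)" by fastforce
    have h: "tableau P" "std_tab n Q" "map length P = map length Q"
      using rsk_in_pairs[of "rev w"] PQ w by (auto simp: f_def W_def rsk_pairs_def)
    let ?m = "map length P"
    have pm: "part ?m" using part_tableau h(1) .
    have "sum_list ?m = n"
    proof -
      have "size (mset (concat Q)) = n" using h(2) by (simp add: std_tab_def)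
      then show ?thesis by (simp add: length_concat h(3))
    qed
    then have "is_partition n ?m" "P \<in> A ?m" "Q \<in> B ?m"
      using pm h cont[of w] Des[of w] w PQ part SSYT_iff[OF pm] SYT_iff[OF pm]
      by (auto simp: A_def B_def W_def)
    then show "p \<in> (\<Union>\<mu>\<in>{\<mu>. is_partition n \<mu>}. A \<mu> \<times> B \<mu>)" using w PQ by auto
  next
    fix p assume "p \<in> (\<Union>\<mu>\<in>{\<mu>. is_partition n \<mu>}. A \<mu> \<times> B \<mu>)"
    then obtain \<mu> P Q where p: "p = (P, Q)" "is_partition n \<mu>" "P \<in> A \<mu>" "Q \<in> B \<mu>" by auto
    have \<mu>: "part \<mu>" "sum_list \<mu> = n" using p part by auto
    have "(P, Q) \<in> rsk_pairs n"
      using p SSYT_iff[OF \<mu>(1)] SYT_iff[OF \<mu>] by (auto simp: rsk_pairs_def A_def B_def)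
    then obtain v where v: "length v = n" "rsk v = (P, Q)" using rsk_surj by blast
    then have "f (rev v) = (P, Q)" by (simp add: f_def)
    then have "rev v \<in> W"
      using v p cont[of "rev v"] Des[of "rev v"] by (auto simp: W_def A_def B_def)
    then show "p \<in> f ` W" using \<open>f (rev v) = (P, Q)\<close> p by (metis image_eqI)
  qed
  have "card W = card (f ` W)" using inj by (simp add: card_image)
  also have "\<dots> = (\<Sum>\<mu> | is_partition n \<mu>. card (A \<mu> \<times> B \<mu>))"
    unfolding img
  proof (rule card_UN_disjoint)
    show "finite {\<mu>. is_partition n \<mu>}" by (rule finite_partitions)
    show "\<forall>\<mu>\<in>{\<mu>. is_partition n \<mu>}. finite (A \<mu> \<times> B \<mu>)"
    proof
      fix \<mu> assume "\<mu> \<in> {\<mu>. is_partition n \<mu>}"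
      then have "A \<mu> \<times> B \<mu> \<subseteq> f ` W" unfolding img by blast
      then show "finite (A \<mu> \<times> B \<mu>)" using fin finite_subset by blast
    qed
    show "\<forall>\<mu>\<in>{\<mu>. is_partition n \<mu>}. \<forall>\<nu>\<in>{\<mu>. is_partition n \<mu>}. \<mu> \<noteq> \<nu> \<longrightarrow>
        A \<mu> \<times> B \<mu> \<inter> A \<nu> \<times> B \<nu> = {}"
      by (auto simp: A_def SSYT_def)
  qed
  also have "\<dots> = (\<Sum>\<mu> | is_partition n \<mu>. card (B \<mu>) * card (A \<mu>))"
    by (simp add: card_cartesian_product mult.commute)
  finally have "int (card W) = (\<Sum>\<mu> | is_partition n \<mu>. int (card (B \<mu>)) * int (card (A \<mu>)))"
    by simp
  then show ?thesis by (simp add: W_def cont_def schur_def A_def B_def)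
qed

section \<open>The major index at roots of unity\<close>

definition words :: "nat \<Rightarrow> nat \<Rightarrow> nat list set" where
  "words N m = {w. length w = m \<and> set w \<subseteq> {..<N}}"

definition word_maj :: "nat list \<Rightarrow> nat" where
  "word_maj w = \<Sum>(word_des w)"

lemma finite_words [simp]: "finite (words N m)"
proof -
  have "words N m = {w. set w \<subseteq> {..<N} \<and> length w = m}" by (auto simp: words_def)
  then show ?thesis by (simp add: finite_lists_length_eq)
qed

lemma words_0 [simp]: "words N 0 = {[]}"
  by (auto simp: words_def)

lemma sum_words_snoc: "(\<Sum>w\<in>words N (Suc m). f w) = (\<Sum>j<N. \<Sum>v\<in>words N m. f (v @ [j]))"
proof -
  have "bij_betw (\<lambda>(j, v). v @ [j]) ({..<N} \<times> words N m) (words N (Suc m))"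
  proof (rule bij_betw_imageI)
    show "(\<lambda>(j, v). v @ [j]) ` ({..<N} \<times> words N m) = words N (Suc m)"
    proof (intro equalityI subsetI)
      fix w assume "w \<in> words N (Suc m)"
      then show "w \<in> (\<lambda>(j, v). v @ [j]) ` ({..<N} \<times> words N m)"
        by (cases w rule: rev_cases) (auto simp: words_def image_iff)
    qed (auto simp: words_def)
  qed (auto simp: inj_on_def)
  from sum.reindex_bij_betw[OF this, of f] show ?thesis
    by (simp add: sum.cartesian_product case_prod_unfold)
qed

section \<open>The major index through a q-difference equation\<close>

definition tau :: "'a::comm_ring_1 \<Rightarrow> nat \<Rightarrow> (nat \<Rightarrow> 'a) \<Rightarrow> nat \<Rightarrow> 'a" where
  "tau q i x = (\<lambda>j. if i < j then q * x j else x j)"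

fun Gam :: "'a::comm_ring_1 \<Rightarrow> nat \<Rightarrow> nat \<Rightarrow> (nat \<Rightarrow> 'a) \<Rightarrow> 'a" where
  "Gam q N 0 x = 1"
| "Gam q N (Suc m) x = (\<Sum>j<N. x j * Gam q N m (tau q j x))"

lemma Gam_cong: "(\<And>j. j < N \<Longrightarrow> x j = y j) \<Longrightarrow> Gam q N m x = Gam q N m y"
proof (induction m arbitrary: x y)
  case (Suc m)
  have "Gam q N m (tau q j x) = Gam q N m (tau q j y)" if "j < N" for j
    by (rule Suc.IH) (simp add: tau_def Suc.prems)
  then show ?case using Suc.prems by simp
qed simp

declare Gam.simps(2) [simp del]

lemma tau_fun_upd: "tau q i (x(j := q * x j)) = (tau q i x)(j := q * tau q i x j)"
  by (auto simp: tau_def fun_eq_iff)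

lemma tau_Suc: "tau q i x = (tau q (Suc i) x)(Suc i := q * tau q (Suc i) x (Suc i))"
  by (auto simp: tau_def fun_eq_iff less_Suc_eq)

text \<open>Multiplying the variables with indices \<open>N - 1\<close> down to \<open>i + 1\<close>
  by \<open>q\<close>, one at a time, leads from \<open>x\<close> to \<open>tau q i x\<close>, and
  \<open>star\<close> evaluates each single change. It is a hypothesis because the induction that
  proves it uses this lemma one degree lower.\<close>

lemma Gam_telescope:
  assumes star: "\<And>j x. j < N \<Longrightarrow>
      Gam q N (Suc m) x - Gam q N (Suc m) (x(j := q * x j)) = (1 - q ^ Suc m) * x j * Gam q N m x"
    and i: "i < N"
  shows "(1 - q ^ Suc m) * (\<Sum>k\<in>{i<..<N}. x k * Gam q N m (tau q k x)) =
    Gam q N (Suc m) x - Gam q N (Suc m) (tau q i x)"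
proof -
  have "i \<le> N - 1" using i by simp
  then show ?thesis
  proof (induction rule: inc_induct)
    case base
    have "Gam q N (Suc m) (tau q (N - 1) x) = Gam q N (Suc m) x"
      by (rule Gam_cong) (auto simp: tau_def)
    moreover have "{N - 1<..<N} = {}" by auto
    ultimately show ?case by simp
  next
    case (step i)
    have *: "{i<..<N} = insert (Suc i) {Suc i<..<N}" using step by auto
    have e1: "Gam q N (Suc m) (tau q (Suc i) x) - Gam q N (Suc m) (tau q i x) =
        (1 - q ^ Suc m) * x (Suc i) * Gam q N m (tau q (Suc i) x)"
      using star[of "Suc i" "tau q (Suc i) x"] step tau_Suc[of q i x] by (simp add: tau_def)
    have e2: "(1 - q ^ Suc m) * (\<Sum>k\<in>{i<..<N}. x k * Gam q N m (tau q k x)) =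
        (1 - q ^ Suc m) * x (Suc i) * Gam q N m (tau q (Suc i) x) +
        (1 - q ^ Suc m) * (\<Sum>k\<in>{Suc i<..<N}. x k * Gam q N m (tau q k x))"
      unfolding * by (simp add: algebra_simps)
    show ?case unfolding e2 e1[symmetric] step.IH by simp
  qed
qed

lemma sum_split_lt:
  fixes f :: "nat \<Rightarrow> 'a::comm_monoid_add"
  assumes "j < N"
  shows "sum f {..<N} = sum f {..<j} + f j + sum f {j<..<N}"
proof -
  have "{..<N} = insert j {..<j} \<union> {j<..<N}" using assms by auto
  then have "sum f {..<N} = sum f (insert j {..<j}) + sum f {j<..<N}"
    by (metis (no_types, lifting) finite.insertI finite_greaterThanLessThan finite_lessThan
        sum.union_disjoint Int_emptyI greaterThanLessThan_iff insert_iff lessThan_iff not_less_iff_gr_or_eq)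
  then show ?thesis by (simp add: add.commute)
qed

text \<open>This \<open>q\<close>-difference equation is why \<open>Gam\<close>, which counts words by the number of pairs of
  letters in increasing order, also counts them by major index.\<close>

lemma Gam_star:
  "j < N \<Longrightarrow> Gam q N (Suc m) x - Gam q N (Suc m) (x(j := q * x j)) = (1 - q ^ Suc m) * x j * Gam q N m x"
proof (induction m arbitrary: j x)
  case 0
  have "sum (x(j := q * x j)) {..<j} = sum x {..<j}" "sum (x(j := q * x j)) {j<..<N} = sum x {j<..<N}"
    by (auto intro: sum.cong)
  then show ?case
    by (simp add: sum_split_lt[OF 0] algebra_simps Gam.simps(2) del: fun_upd_apply) (simp add: algebra_simps)
next
  case (Suc m)
  define G where "G = Gam q N (Suc m)"
  define x' where "x' = x(j := q * x j)"
  let ?a = "\<Sum>i<j. x i * Gam q N m (tau q i x)" and ?b = "\<Sum>i\<in>{j<..<N}. x i * Gam q N m (tau q i x)"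
  let ?c = "Gam q N m (tau q j x)"
  have IH: "G (tau q i x) = G (tau q i x') + (1 - q ^ Suc m) * tau q i x j * Gam q N m (tau q i x)" for i
    using Suc.IH[OF Suc.prems, of "tau q i x"] unfolding x'_def tau_fun_upd G_def
    by (simp add: algebra_simps del: fun_upd_apply)
  \<comment> \<open>For \<open>i < j\<close> the variable \<open>j\<close> already carries a factor
    \<open>q\<close> in \<open>tau q i x\<close>; this is the extra \<open>q\<close> that the sum
    over larger indices does not have.\<close>
  have low: "(\<Sum>i<j. x i * G (tau q i x)) - (\<Sum>i<j. x' i * G (tau q i x')) =
      (1 - q ^ Suc m) * q * x j * ?a"
    unfolding sum_subtractf[symmetric] sum_distrib_left
    by (rule sum.cong) (auto simp: IH x'_def[THEN fun_cong] tau_def[THEN fun_cong] algebra_simps)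
  have high: "(\<Sum>i\<in>{j<..<N}. x i * G (tau q i x)) - (\<Sum>i\<in>{j<..<N}. x' i * G (tau q i x')) =
      (1 - q ^ Suc m) * x j * ?b"
    unfolding sum_subtractf[symmetric] sum_distrib_left
    by (rule sum.cong) (auto simp: IH x'_def[THEN fun_cong] tau_def[THEN fun_cong] algebra_simps)
  have mid: "x j * G (tau q j x) - x' j * G (tau q j x') =
      x j * ((1 - q) * G (tau q j x) + q * (1 - q ^ Suc m) * x j * ?c)"
    by (simp add: IH x'_def[THEN fun_cong] tau_def[THEN fun_cong] algebra_simps)
  \<comment> \<open>The sums \<open>?a\<close>, \<open>?b\<close> and the term \<open>?c\<close>
    express everything else in the goal; the telescoped equation does the same for
    \<open>G (tau q j x)\<close>, after which only polynomial algebra is left.\<close>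
  have tel: "G (tau q j x) = G x - (1 - q ^ Suc m) * ?b"
    using Gam_telescope[OF Suc.IH Suc.prems, of x] by (simp add: G_def)
  have G: "G x = ?a + x j * ?c + ?b" unfolding G_def Gam.simps by (rule sum_split_lt[OF Suc.prems])
  have "Gam q N (Suc (Suc m)) x - Gam q N (Suc (Suc m)) x' =
    (1 - q ^ Suc m) * q * x j * ?a + x j * ((1 - q) * G (tau q j x) + q * (1 - q ^ Suc m) * x j * ?c)
      + (1 - q ^ Suc m) * x j * ?b"
    unfolding Gam.simps(2)[of q N "Suc m"] low[symmetric] high[symmetric] mid[symmetric]
      sum_split_lt[OF Suc.prems] G_def[symmetric] by (simp only: algebra_simps)
  also have "\<dots> = (1 - q ^ Suc (Suc m)) * x j * G x"
    unfolding tel G by (simp add: algebra_simps)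
  finally show ?case unfolding G_def x'_def .
qed

lemma word_maj_snoc:
  "word_maj (w @ [i]) = word_maj w + (if w \<noteq> [] \<and> i < last w then length w else 0)"
proof -
  have "finite (word_des w)" "length w \<notin> word_des w" by (auto simp: word_des_def)
  moreover have "word_des (w @ [i]) = (if w \<noteq> [] \<and> i < last w then insert (length w) (word_des w) else word_des w)"
    unfolding word_des_snoc by auto
  ultimately show ?thesis by (simp add: word_maj_def)
qed

text \<open>Fixing the letter that follows closes the recursion: a last letter \<open>j\<close>
  makes a descent exactly if \<open>i < j\<close>, and then contributes \<open>q ^ Suc m\<close> at
  once. In \<open>Gam\<close> the same letters contribute single factors \<open>q\<close> spread
  over the word; the telescoped difference equation reconciles the two.\<close>

lemma sum_words_maj_last:
  "i < N \<Longrightarrow> (\<Sum>w\<in>words N m. q ^ word_maj (w @ [i]) * prod_list (map x w)) = Gam q N m (tau q i x)"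
proof (induction m arbitrary: i)
  case 0
  have "word_des [i] = {}" by (auto simp: word_des_def)
  then show ?case by (simp add: word_maj_def)
next
  case (Suc m)
  have "(\<Sum>w\<in>words N (Suc m). q ^ word_maj (w @ [i]) * prod_list (map x w)) =
    (\<Sum>j<N. (if i < j then q ^ Suc m else 1) * x j *
      (\<Sum>v\<in>words N m. q ^ word_maj (v @ [j]) * prod_list (map x v)))"
    unfolding sum_words_snoc sum_distrib_left
  proof (intro sum.cong refl)
    fix j v assume "v \<in> words N m"
    then have "length v = m" by (simp add: words_def)
    then show "q ^ word_maj ((v @ [j]) @ [i]) * prod_list (map x (v @ [j])) =
       (if i < j then q ^ Suc m else 1) * x j * (q ^ word_maj (v @ [j]) * prod_list (map x v))"
      unfolding word_maj_snoc[of "v @ [j]"] by (simp add: power_add algebra_simps)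
  qed
  also have "\<dots> = (\<Sum>j<N. (if i < j then q ^ Suc m else 1) * (x j * Gam q N m (tau q j x)))"
    using Suc.IH by (intro sum.cong) (auto simp: algebra_simps)
  also have "\<dots> = (\<Sum>j<i. x j * Gam q N m (tau q j x)) + x i * Gam q N m (tau q i x) +
      q ^ Suc m * (\<Sum>j\<in>{i<..<N}. x j * Gam q N m (tau q j x))"
    unfolding sum_split_lt[OF Suc.prems] sum_distrib_left by (intro arg_cong2[of _ _ _ _ "(+)"] sum.cong) auto
  also have "\<dots> = Gam q N (Suc m) x - (1 - q ^ Suc m) * (\<Sum>j\<in>{i<..<N}. x j * Gam q N m (tau q j x))"
    unfolding Gam.simps sum_split_lt[OF Suc.prems] by (simp add: algebra_simps)
  also have "\<dots> = Gam q N (Suc m) (tau q i x)"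
    using Gam_telescope[where q = q and m = m and x = x, OF Gam_star Suc.prems] by simp
  finally show ?case .
qed

lemma sum_words_maj: "(\<Sum>w\<in>words N m. q ^ word_maj w * prod_list (map x w)) = Gam q N m x"
proof (cases m)
  case 0
  then show ?thesis by (simp add: word_maj_def word_des_def)
next
  case (Suc m')
  have "(\<Sum>w\<in>words N (Suc m'). q ^ word_maj w * prod_list (map x w)) =
    (\<Sum>j<N. x j * (\<Sum>v\<in>words N m'. q ^ word_maj (v @ [j]) * prod_list (map x v)))"
    unfolding sum_words_snoc sum_distrib_left by (intro sum.cong) (auto simp: algebra_simps)
  then show ?thesis using Suc sum_words_maj_last[of _ N q x m'] by (simp add: Gam.simps(2))
qed

section \<open>Gaussian binomial coefficients at roots of unity\<close>

text \<open>The Gaussian binomial coefficient, given by its Pascal rule because the quotient formula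
  divides by zero at the roots of unity where it is needed.\<close>

fun gauss :: "'a::comm_ring_1 \<Rightarrow> nat \<Rightarrow> nat \<Rightarrow> 'a" where
  "gauss q n 0 = 1"
| "gauss q 0 (Suc k) = 0"
| "gauss q (Suc n) (Suc k) = q ^ Suc k * gauss q n (Suc k) + gauss q n k"

lemma gauss_eq_0: "n < k \<Longrightarrow> gauss q n k = 0"
  by (induction q n k rule: gauss.induct) auto

lemma gauss_refl: "gauss q n n = 1"
  by (induction n) (auto simp: gauss_eq_0)

text \<open>A division-free form of the quotient formula. If \<open>q\<close> has exact order
  \<open>n + 1\<close>, the right-hand side vanishes while the factor \<open>1 - q ^ Suc k\<close>
  does not for \<open>k < n\<close>, so all middle coefficients of that row are zero.\<close>

lemma gauss_absorb: "(1 - q ^ Suc k) * gauss q (Suc n) (Suc k) = (1 - q ^ Suc n) * gauss q n k"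
proof (induction n arbitrary: k)
  case 0
  then show ?case by (cases k) auto
next
  case (Suc n)
  show ?case
  proof (cases k)
    case 0
    have "(1 - q) * gauss q (Suc n) (Suc 0) = 1 - q ^ Suc n" using Suc[of 0] by simp
    moreover have "(1 - q) * gauss q (Suc (Suc n)) (Suc 0) = q * ((1 - q) * gauss q (Suc n) (Suc 0)) + (1 - q)"
      unfolding gauss.simps(3)[of q "Suc n"] by (simp add: algebra_simps del: gauss.simps(3))
    ultimately have "(1 - q) * gauss q (Suc (Suc n)) (Suc 0) = q * (1 - q ^ Suc n) + (1 - q)" by metis
    then show ?thesis unfolding 0 by (simp add: algebra_simps del: gauss.simps(3))
  next
    case (Suc l)
    have 1: "(1 - q ^ Suc k) * gauss q (Suc n) (Suc k) = (1 - q ^ Suc n) * gauss q n k"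
      and 2: "(1 - q ^ k) * gauss q (Suc n) k = (1 - q ^ Suc n) * gauss q n l"
      using Suc.IH[of k] Suc.IH[of l] Suc by simp_all
    have 3: "gauss q (Suc n) k = q ^ k * gauss q n k + gauss q n l" using Suc by simp
    have "(1 - q ^ Suc k) * gauss q (Suc (Suc n)) (Suc k) =
      q ^ Suc k * ((1 - q ^ Suc k) * gauss q (Suc n) (Suc k)) + (1 - q ^ Suc k) * gauss q (Suc n) k"
      by (simp only: gauss.simps algebra_simps)
    also have "\<dots> = q * ((1 - q ^ Suc n) * (q ^ k * gauss q n k)) + (1 - q ^ Suc k) * gauss q (Suc n) k"
      unfolding 1 by (simp add: algebra_simps)
    also have "q ^ k * gauss q n k = gauss q (Suc n) k - gauss q n l" unfolding 3 by simp
    also have "(1 - q ^ Suc n) * (gauss q (Suc n) k - gauss q n l) =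
        (1 - q ^ Suc n) * gauss q (Suc n) k - (1 - q ^ k) * gauss q (Suc n) k"
      unfolding 2 by (simp add: algebra_simps)
    finally show ?thesis by (simp add: algebra_simps)
  qed
qed

lemma gauss_root_of_unity:
  fixes q :: "'a::{comm_ring_1,ring_no_zero_divisors}"
  assumes "0 < d" "q ^ d = 1" "\<And>e. 0 < e \<Longrightarrow> e < d \<Longrightarrow> q ^ e \<noteq> 1"
  shows "gauss q d k = (if k = 0 \<or> k = d then 1 else 0)"
proof (cases "k = 0 \<or> k = d \<or> d < k")
  case True
  then show ?thesis using gauss_eq_0[of d k q] assms(1) by (auto simp: gauss_refl)
next
  case False
  then obtain l d' where l: "k = Suc l" "d = Suc d'" by (cases k; cases d) auto
  have "(1 - q ^ k) * gauss q d k = 0" using gauss_absorb[of q l d'] assms(2) l by simp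
  moreover have "1 - q ^ k \<noteq> 0" using assms(3)[of k] False by auto
  ultimately show ?thesis using False by simp
qed

text \<open>One step of the q-Lucas theorem: as the middle coefficients of row \<open>d\<close>
  vanish, going down \<open>d\<close> rows in the triangle adds to each entry the one
  \<open>d\<close> places to its left.\<close>

lemma gauss_add_order:
  fixes q :: "'a::{comm_ring_1,ring_no_zero_divisors}"
  assumes "0 < d" "q ^ d = 1" "\<And>e. 0 < e \<Longrightarrow> e < d \<Longrightarrow> q ^ e \<noteq> 1"
  shows "gauss q (n + d) k = gauss q n k + (if d \<le> k then gauss q n (k - d) else 0)"
proof (induction n arbitrary: k)
  case 0
  show ?case using gauss_root_of_unity[OF assms, of k] assms(1) gauss_eq_0[of 0 "k - d" q] gauss_eq_0[of 0 k q]
    by (cases "k = 0"; cases "k = d"; auto)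
next
  case (Suc n)
  show ?case
  proof (cases k)
    case 0
    then show ?thesis using assms(1) by simp
  next
    case (Suc l)
    have e: "gauss q (Suc n + d) k = q ^ k * gauss q (n + d) k + gauss q (n + d) l"
      and e': "gauss q (Suc n) k = q ^ k * gauss q n k + gauss q n l" using Suc by simp_all
    consider "k < d" | "k = d" | "d < k" by linarith
    then show ?thesis
    proof cases
      case 1
      then show ?thesis unfolding e Suc.IH using Suc by simp
    next
      case 2
      then show ?thesis unfolding e Suc.IH e' using Suc assms(2) by (auto simp: algebra_simps)
    next
      case 3
      then obtain r where r: "k = Suc r + d" "l = r + d" using Suc less_imp_Suc_add by (metis add.commute add_Suc add_Suc_right nat.inject)
      have "q ^ k = q ^ Suc r" unfolding r power_add assms(2) by simp
      then have "q ^ k * gauss q n (Suc r) = q ^ Suc r * gauss q n (Suc r)" by simp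
      then show ?thesis unfolding e Suc.IH using r Suc by (simp add: algebra_simps)
    qed
  qed
qed

text \<open>The largest letter leaves the weights of all later letters unchanged, but every smaller
  letter before it contributes a factor \<open>q\<close>. Placing \<open>k\<close> copies of it
  among \<open>m\<close> positions thus sums to a Gaussian coefficient.\<close>

lemma Gam_Suc_letters:
  "Gam q (Suc N) m x = (\<Sum>k\<le>m. gauss q m k * x N ^ k * Gam q N (m - k) x)"
proof (induction m arbitrary: x)
  case (Suc m)
  have "Gam q (Suc N) (Suc m) x = (\<Sum>j<N. x j * Gam q (Suc N) m (tau q j x)) + x N * Gam q (Suc N) m (tau q N x)"
    by (simp add: Gam.simps(2))
  also have "Gam q (Suc N) m (tau q N x) = Gam q (Suc N) m x"
    by (rule Gam_cong) (simp add: tau_def)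
  also have "(\<Sum>j<N. x j * Gam q (Suc N) m (tau q j x)) =
    (\<Sum>j<N. \<Sum>k\<le>m. gauss q m k * (q * x N) ^ k * (x j * Gam q N (m - k) (tau q j x)))"
    unfolding Suc sum_distrib_left by (intro sum.cong) (auto simp: tau_def algebra_simps)
  also have "\<dots> = (\<Sum>k\<le>m. \<Sum>j<N. gauss q m k * (q * x N) ^ k * (x j * Gam q N (m - k) (tau q j x)))"
    by (rule sum.swap)
  also have "\<dots> = (\<Sum>k\<le>m. q ^ k * gauss q m k * x N ^ k * Gam q N (Suc m - k) x)"
    by (intro sum.cong refl) (simp add: Suc_diff_le Gam.simps(2) sum_distrib_left power_mult_distrib algebra_simps)
  also have "\<dots> = (\<Sum>k\<le>Suc m. q ^ k * gauss q m k * x N ^ k * Gam q N (Suc m - k) x)"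
    by (simp add: gauss_eq_0)
  also have "\<dots> = Gam q N (Suc m) x + (\<Sum>k\<le>m. q ^ Suc k * gauss q m (Suc k) * x N ^ Suc k * Gam q N (m - k) x)"
    unfolding sum.atMost_Suc_shift by simp
  also have "x N * Gam q (Suc N) m x = (\<Sum>k\<le>m. gauss q m k * x N ^ Suc k * Gam q N (m - k) x)"
    unfolding Suc sum_distrib_left by (intro sum.cong) (auto simp: algebra_simps)
  finally have "Gam q (Suc N) (Suc m) x = Gam q N (Suc m) x +
      (\<Sum>k\<le>m. gauss q (Suc m) (Suc k) * x N ^ Suc k * Gam q N (m - k) x)"
    by (simp add: sum.distrib algebra_simps)
  then show ?case unfolding sum.atMost_Suc_shift by simp
qed simp

text \<open>Induction on the alphabet. Each coefficient in the expansion by the largest letter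
  splits in two: one half reproduces the power sum of the smaller alphabet, the other supplies the
  missing summand \<open>x N ^ d\<close>.\<close>

lemma Gam_add_order:
  fixes q :: "'a::{comm_ring_1,ring_no_zero_divisors}"
  assumes "0 < d" "q ^ d = 1" "\<And>e. 0 < e \<Longrightarrow> e < d \<Longrightarrow> q ^ e \<noteq> 1"
  shows "Gam q N (m + d) x = (\<Sum>j<N. x j ^ d) * Gam q N m x"
proof (induction N arbitrary: m)
  case 0
  then show ?case using assms(1) by (cases d) (auto simp: Gam.simps(2))
next
  case (Suc N)
  have "Gam q (Suc N) (m + d) x = (\<Sum>k\<le>m + d. gauss q m k * x N ^ k * Gam q N (m + d - k) x) +
     (\<Sum>k\<le>m + d. if d \<le> k then gauss q m (k - d) * x N ^ k * Gam q N (m + d - k) x else 0)"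
    unfolding Gam_Suc_letters sum.distrib[symmetric]
  proof (intro sum.cong refl)
    fix k
    show "gauss q (m + d) k * x N ^ k * Gam q N (m + d - k) x = gauss q m k * x N ^ k * Gam q N (m + d - k) x +
      (if d \<le> k then gauss q m (k - d) * x N ^ k * Gam q N (m + d - k) x else 0)"
      by (subst gauss_add_order[OF assms]) (simp_all add: algebra_simps)
  qed
  also have "(\<Sum>k\<le>m + d. gauss q m k * x N ^ k * Gam q N (m + d - k) x) =
     (\<Sum>k\<le>m. gauss q m k * x N ^ k * Gam q N (m - k + d) x)"
    by (rule sum.mono_neutral_cong_right) (auto simp: gauss_eq_0)
  also have "\<dots> = (\<Sum>j<N. x j ^ d) * Gam q (Suc N) m x"
    unfolding Suc Gam_Suc_letters sum_distrib_left by (intro sum.cong) (auto simp: algebra_simps)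
  also have "(\<Sum>k\<le>m + d. if d \<le> k then gauss q m (k - d) * x N ^ k * Gam q N (m + d - k) x else 0) =
      (\<Sum>k\<in>{0 + d..m + d}. gauss q m (k - d) * x N ^ k * Gam q N (m + d - k) x)"
    by (rule sum.mono_neutral_cong_right) auto
  also have "\<dots> = (\<Sum>k\<in>{0..m}. gauss q m k * x N ^ (k + d) * Gam q N (m - k) x)"
    unfolding sum.shift_bounds_cl_nat_ivl by simp
  also have "\<dots> = x N ^ d * Gam q (Suc N) m x"
    unfolding Gam_Suc_letters sum_distrib_left atMost_atLeast0
    by (intro sum.cong) (auto simp: algebra_simps power_add)
  finally show ?case by (simp add: algebra_simps)
qed

lemma Gam_mult_order:
  fixes q :: "'a::{comm_ring_1,ring_no_zero_divisors}"
  assumes "0 < d" "q ^ d = 1" "\<And>e. 0 < e \<Longrightarrow> e < d \<Longrightarrow> q ^ e \<noteq> 1"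
  shows "Gam q N (g * d) x = (\<Sum>j<N. x j ^ d) ^ g"
proof (induction g)
  case (Suc g)
  have "Suc g * d = g * d + d" by simp
  then show ?case using Gam_add_order[OF assms, of N "g * d" x] Suc by (metis power_Suc)
qed simp

section \<open>Words fixed by a rotation\<close>

lemma sum_words_power: "(\<Sum>w\<in>words N m. prod_list (map x w)) = (\<Sum>j<N. x j :: 'a::comm_ring_1) ^ m"
proof (induction m)
  case (Suc m)
  then show ?case unfolding sum_words_snoc
    by (simp add: sum_distrib_left[symmetric] sum_distrib_right[symmetric] mult.commute)
qed simp

lemma rotate_mult_fixed: "rotate j w = w \<Longrightarrow> rotate (a * j) w = w"
  by (induction a) (auto simp: rotate_rotate[symmetric])

lemma rotate_gcd_fixed:
  assumes "rotate j w = w"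
  shows "rotate (gcd j (length w)) w = w"
proof (cases "j = 0")
  case False
  obtain a b where ab: "a * j = length w * b + gcd j (length w)"
    using bezout_nat[OF False, of "length w"] by (metis mult.commute)
  have "rotate (b * length w) w = w" by (rule rotate_mult_fixed) simp
  then have "rotate (gcd j (length w)) w = rotate (a * j) w"
    unfolding ab by (metis mult.commute rotate_rotate add.commute)
  then show ?thesis using rotate_mult_fixed[OF assms, of a] by simp
qed simp

lemma comm_append_concat_replicate:
  "u @ v = v @ u \<Longrightarrow> length v = e * length u \<Longrightarrow> v = concat (replicate e u)"
proof (induction e arbitrary: v)
  case (Suc e)
  have "length u \<le> length v" using Suc by simp
  then obtain v' where v': "v = u @ v'" using Suc.prems(1) by (metis append_eq_append_conv_if append_eq_conv_conj)
  then show ?case using Suc by simp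
qed simp

lemma rotate_concat_replicate: "rotate (length u) (concat (replicate d u)) = concat (replicate d u)"
proof (cases d)
  case (Suc e)
  have "concat (replicate e u) @ u = concat (replicate (Suc e) u)"
    by (induction e) auto
  then show ?thesis using rotate_append[of u "concat (replicate e u)"] Suc by simp
qed simp

text \<open>A word fixed by rotation by \<open>j\<close> is fixed by rotation by \<open>g\<close>,
  hence it is the \<open>d\<close>-fold repetition of its prefix of length \<open>g\<close>. That
  prefix is arbitrary, and each of its letters is counted \<open>d\<close> times.\<close>

lemma sum_rotation_fixed_words:
  fixes x :: "nat \<Rightarrow> 'a::comm_ring_1"
  assumes "0 < m" "g = gcd j m" "m = d * g"
  shows "(\<Sum>w | w \<in> words N m \<and> rotate j w = w. prod_list (map x w)) = (\<Sum>i<N. x i ^ d) ^ g"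
proof -
  have "0 < d" using assms(1,3) by simp
  have "bij_betw (\<lambda>u. concat (replicate d u)) (words N g) {w \<in> words N m. rotate j w = w}"
  proof (rule bij_betw_imageI)
    show "inj_on (\<lambda>u. concat (replicate d u)) (words N g)"
    proof (rule inj_onI)
      fix u v assume uv: "u \<in> words N g" "v \<in> words N g" "concat (replicate d u) = concat (replicate d v)"
      obtain e where "d = Suc e" using \<open>0 < d\<close> by (cases d) auto
      then have "u @ concat (replicate e u) = v @ concat (replicate e v)" using uv(3) by simp
      moreover have "length u = length v" using uv by (simp add: words_def)
      ultimately show "u = v" by (metis append_eq_append_conv)
    qed
    show "(\<lambda>u. concat (replicate d u)) ` words N g = {w \<in> words N m. rotate j w = w}"
    proof (intro equalityI subsetI)
      fix w assume "w \<in> (\<lambda>u. concat (replicate d u)) ` words N g"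
      then obtain u where u: "u \<in> words N g" "w = concat (replicate d u)" by blast
      then have w: "w \<in> words N m" using assms(3) by (auto simp: words_def length_concat sum_list_replicate)
      have "rotate g w = w" using rotate_concat_replicate[of u d] u by (simp add: words_def)
      moreover have "g dvd j" using assms(2) by simp
      ultimately have "rotate j w = w" using rotate_mult_fixed by (metis dvd_def mult.commute)
      then show "w \<in> {w \<in> words N m. rotate j w = w}" using w by simp
    next
      fix w assume "w \<in> {w \<in> words N m. rotate j w = w}"
      then have w: "w \<in> words N m" "rotate j w = w" "length w = m" by (auto simp: words_def)
      then have r: "rotate g w = w" using rotate_gcd_fixed[of j w] unfolding assms(2) by simp
      define u v where "u = take g w" and "v = drop g w"
      have gm: "g \<le> m" using assms(3) \<open>0 < d\<close> by simp
      have lu: "length u = g" using w gm by (simp add: u_def)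
      \<comment> \<open>Invariance under rotation by \<open>g\<close> says that the prefix and the
        rest commute as words; since \<open>g\<close> divides the length, the rest is a power of the
        prefix.\<close>
      have "rotate (length u) (u @ v) = v @ u" by (rule rotate_append)
      then have "v @ u = u @ v" using r lu by (simp add: u_def v_def)
      moreover have "length v = (d - 1) * length u"
        using w lu assms(3) by (simp add: v_def diff_mult_distrib)
      ultimately have "v = concat (replicate (d - 1) u)" using comm_append_concat_replicate by metis
      then have "u @ v = concat (replicate (Suc (d - 1)) u)" by simp
      then have "w = concat (replicate d u)" using \<open>0 < d\<close> by (simp add: u_def v_def)
      moreover have "u \<in> words N g" using lu w by (auto simp: words_def u_def dest: in_set_takeD)
      ultimately show "w \<in> (\<lambda>u. concat (replicate d u)) ` words N g" by blast
    qed
  qed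
  then have "(\<Sum>w\<in>{w \<in> words N m. rotate j w = w}. prod_list (map x w)) =
      (\<Sum>u\<in>words N g. prod_list (map x (concat (replicate d u))))"
    using sum.reindex_bij_betw[of _ _ _ "\<lambda>w. prod_list (map x w)"] by metis
  also have "\<dots> = (\<Sum>u\<in>words N g. prod_list (map (\<lambda>i. x i ^ d) u))"
  proof (intro sum.cong refl)
    fix u
    have "prod_list (map (\<lambda>i. x i ^ d) u) = prod_list (map x u) ^ d"
      by (induction u) (auto simp: power_mult_distrib)
    moreover have "prod_list (map x (concat (replicate d u))) = prod_list (map x u) ^ d"
      by (induction d) auto
    ultimately show "prod_list (map x (concat (replicate d u))) = prod_list (map (\<lambda>i. x i ^ d) u)" by simp
  qed
  finally show ?thesis unfolding sum_words_power by simp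
qed

section \<open>Cyclic sieving for the major index\<close>

definition primitive_root_of_unity :: "nat \<Rightarrow> complex \<Rightarrow> bool" where
  "primitive_root_of_unity m w \<longleftrightarrow> (\<forall>a. w ^ a = 1 \<longleftrightarrow> m dvd a)"

lemma primitive_root_inverse: "primitive_root_of_unity m w \<Longrightarrow> primitive_root_of_unity m (inverse w)"
  by (simp add: primitive_root_of_unity_def power_inverse)

lemma sum_maj_root_of_unity:
  assumes "primitive_root_of_unity m w" "0 < m"
  shows "(\<Sum>v\<in>words N m. (w ^ j) ^ word_maj v * prod_list (map x v)) =
    (\<Sum>v | v \<in> words N m \<and> rotate j v = v. prod_list (map x v))"
proof -
  define g where "g = gcd j m"
  define d where "d = m div g"
  have g: "0 < g" "m = d * g" using assms(2) by (auto simp: g_def d_def)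
  then have "0 < d" using assms(2) by simp
  obtain j' where j': "j = j' * g" "coprime j' d"
    using gcd_coprime_exists[of j m] g(1) unfolding g_def[symmetric]
    by (metis d_def g_def nonzero_mult_div_cancel_right neq0_conv)
  \<comment> \<open>The exact order of \<open>w ^ j\<close> is \<open>d\<close>, which is also the
    order of rotation by \<open>j\<close> on \<open>m\<close> positions; this coincidence is what
    makes the two generating functions agree.\<close>
  have one: "(w ^ j) ^ e = 1 \<longleftrightarrow> d dvd e" for e
  proof -
    have "(w ^ j) ^ e = 1 \<longleftrightarrow> m dvd j * e"
      using assms(1) by (simp add: primitive_root_of_unity_def power_mult[symmetric])
    also have "\<dots> \<longleftrightarrow> d * g dvd (j' * e) * g" using g j' by (simp add: algebra_simps)
    also have "\<dots> \<longleftrightarrow> d dvd j' * e" using g(1) by simp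
    also have "\<dots> \<longleftrightarrow> d dvd e" using j'(2) by (simp add: coprime_commute coprime_dvd_mult_right_iff)
    finally show ?thesis .
  qed
  have "(\<Sum>v\<in>words N m. (w ^ j) ^ word_maj v * prod_list (map x v)) = (\<Sum>i<N. x i ^ d) ^ g"
  proof -
    have "(w ^ j) ^ e \<noteq> 1" if "0 < e" "e < d" for e using that one by (auto dest: dvd_imp_le)
    then have "Gam (w ^ j) N (g * d) x = (\<Sum>i<N. x i ^ d) ^ g"
      using \<open>0 < d\<close> one by (intro Gam_mult_order) auto
    then show ?thesis unfolding sum_words_maj g(2) by (simp add: mult.commute)
  qed
  then show ?thesis using sum_rotation_fixed_words[OF assms(2) g_def g(2), of x N] by simp
qed

lemma root_of_unity_filter:
  assumes "primitive_root_of_unity m w" "0 < m"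
  shows "(\<Sum>j<m. w ^ j * (inverse w ^ j) ^ a) = (if [a = 1] (mod m) then of_nat m else 0)"
proof -
  have w0: "w \<noteq> 0" using assms unfolding primitive_root_of_unity_def by (metis dvd_refl power_0_left zero_neq_one less_numeral_extra(3))
  define z where "z = w * inverse w ^ a"
  have "w ^ m = 1" "w ^ (a * m) = 1" using assms by (simp_all add: primitive_root_of_unity_def)
  then have zm: "z ^ m = 1"
    by (simp add: z_def power_mult_distrib power_inverse power_mult[symmetric])
  have z1: "z = 1 \<longleftrightarrow> [a = 1] (mod m)"
  proof -
    have "z = 1 \<longleftrightarrow> w ^ a = w" using w0 by (auto simp: z_def power_inverse field_simps)
    \<comment> \<open>The exponent \<open>a - 1\<close> is truncated for \<open>a = 0\<close>;
      adding \<open>m - 1\<close> instead gives the same power of \<open>w\<close> without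
      subtraction.\<close>
    also have "\<dots> \<longleftrightarrow> w ^ (a + (m - 1)) = 1"
    proof -
      have "w ^ (a + (m - 1)) * w = w ^ a * w ^ m" using assms(2)
        by (metis Suc_diff_1 add_Suc_right power_Suc2 power_add)
      also have "w ^ m = 1" using assms(1) by (simp add: primitive_root_of_unity_def)
      finally show ?thesis using w0 by (metis mult.right_neutral mult_1 mult_cancel_right)
    qed
    also have "\<dots> \<longleftrightarrow> m dvd a + (m - 1)" using assms(1) by (simp add: primitive_root_of_unity_def)
    also have "\<dots> \<longleftrightarrow> [a + (m - 1) = 1 + (m - 1)] (mod m)" using assms(2) by (simp add: cong_def dvd_eq_mod_eq_0)
    also have "\<dots> \<longleftrightarrow> [a = 1] (mod m)" by (rule cong_add_rcancel_nat)
    finally show ?thesis .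
  qed
  have e: "w ^ j * (inverse w ^ j) ^ a = z ^ j" for j
    by (simp add: z_def power_mult_distrib power_mult[symmetric] mult.commute)
  show ?thesis
  proof (cases "z = 1")
    case True
    then show ?thesis using z1 by (simp add: e)
  next
    case False
    then have "(\<Sum>j<m. z ^ j) = 0" using zm by (simp add: sum_gp_strict)
    then show ?thesis using z1 False by (simp add: e)
  qed
qed

lemma sum_words_maj_cong_1:
  assumes "primitive_root_of_unity m w" "0 < m"
  shows "(\<Sum>v | v \<in> words N m \<and> [word_maj v = 1] (mod m). prod_list (map x v)) =
    1 / of_nat m * (\<Sum>j<m. w ^ j * (\<Sum>v | v \<in> words N m \<and> rotate j v = v. prod_list (map x v)))"
proof -
  have "(\<Sum>j<m. w ^ j * (\<Sum>v | v \<in> words N m \<and> rotate j v = v. prod_list (map x v))) =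
    (\<Sum>j<m. \<Sum>v\<in>words N m. w ^ j * (inverse w ^ j) ^ word_maj v * prod_list (map x v))"
    unfolding sum_maj_root_of_unity[OF primitive_root_inverse[OF assms(1)] assms(2), symmetric]
    by (simp add: sum_distrib_left mult.assoc)
  also have "\<dots> = (\<Sum>v\<in>words N m. (\<Sum>j<m. w ^ j * (inverse w ^ j) ^ word_maj v) * prod_list (map x v))"
    unfolding sum_distrib_right by (rule sum.swap)
  also have "\<dots> = of_nat m * (\<Sum>v | v \<in> words N m \<and> [word_maj v = 1] (mod m). prod_list (map x v))"
    unfolding root_of_unity_filter[OF assms] sum_distrib_left
    by (rule sum.mono_neutral_cong_right) auto
  finally show ?thesis using assms(2) by simp
qed

lemma primitive_root_of_unity_cis:
  assumes "0 < m"
  shows "primitive_root_of_unity m (cis (2 * pi / of_nat m))"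
  unfolding primitive_root_of_unity_def
proof
  fix a
  have "cis (2 * pi / of_nat m) ^ a = 1 \<longleftrightarrow> (\<exists>k::int. of_nat a * (2 * pi / of_nat m) = 2 * pi * of_int k)"
  proof -
    have "cis t = 1 \<longleftrightarrow> (\<exists>k::int. t = 2 * pi * of_int k)" for t
      using sin_int_2pin by (auto simp: complex_eq_iff cos_one_2pi_int mult_ac)
    then show ?thesis unfolding DeMoivre .
  qed
  also have "\<dots> \<longleftrightarrow> (\<exists>k::int. int a = int m * k)"
  proof (intro ex_cong1)
    fix k :: int
    have "of_nat a * (2 * pi / of_nat m) = 2 * pi * of_int k \<longleftrightarrow> real_of_int (int a) = of_int (int m * k)"
      using assms by (simp add: field_simps)
    also have "\<dots> \<longleftrightarrow> int a = int m * k" by (rule of_int_eq_iff)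
    finally show "of_nat a * (2 * pi / of_nat m) = 2 * pi * of_int k \<longleftrightarrow> int a = int m * k" .
  qed
  also have "\<dots> \<longleftrightarrow> m dvd a" by (metis dvd_def int_dvd_int_iff)
  finally show "cis (2 * pi / of_nat m) ^ a = 1 \<longleftrightarrow> m dvd a" .
qed

section \<open>Projecting onto the free Lie algebra\<close>

lemma pm_induct [case_names zero single add]:
  fixes p :: "'a \<Rightarrow>\<^sub>0 'b::comm_monoid_add"
  assumes "P 0" "\<And>k c. P (single k c)" "\<And>p q. P p \<Longrightarrow> P q \<Longrightarrow> P (p + q)"
  shows "P p"
proof -
  have "p = (\<Sum>k\<in>keys p. single k (lookup p k))"
    by (rule poly_mapping_eqI)
      (auto simp: Poly_Mapping.lookup_sum lookup_single when_def not_in_keys_iff_lookup_eq_zero sum.delta' in_keys_iff)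
  moreover have "P (sum f S)" if "finite S" "\<And>k. k \<in> S \<Longrightarrow> P (f k)" for f and S :: "'a set"
    using that by (induction S rule: finite_induct) (auto intro: assms)
  ultimately show ?thesis using assms(2) by (metis finite_keys)
qed

lemma scal_single: "scal c (single k d) = single k (c * d)"
  by (rule poly_mapping_eqI) (auto simp: lookup_scal lookup_single when_def)

lemma scal_mult_left: "scal c p * q = scal c (p * q)"
  for p q :: "'a::monoid_add \<Rightarrow>\<^sub>0 complex"
  by (simp add: scal_def mult_map_scale_conv_mult mult.assoc)

lemma scal_mult_right: "p * scal c q = scal c (p * q)"
  for p q :: "'a::monoid_add \<Rightarrow>\<^sub>0 complex"
proof (induction p rule: pm_induct)
  case (single k d)
  show ?case
    by (induction q rule: pm_induct)
      (simp_all add: scal_single mult_single mult_ac free_vs.scale_right_distrib distrib_left)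
qed (simp_all add: distrib_right free_vs.scale_right_distrib)

lemma lin_ext_superset:
  assumes "finite S" "keys p \<subseteq> S"
  shows "lin_ext f p = (\<Sum>k\<in>S. scal (lookup p k) (f k))"
  unfolding lin_ext_def by (rule sum.mono_neutral_left) (use assms in \<open>auto simp: in_keys_iff\<close>)

lemma lin_ext_zero [simp]: "lin_ext f 0 = 0"
  by (simp add: lin_ext_def)

lemma lin_ext_add: "lin_ext f (p + q) = lin_ext f p + lin_ext f q"
proof -
  let ?S = "keys p \<union> keys q"
  have "keys (p + q) \<subseteq> ?S" by (rule Poly_Mapping.keys_add)
  then show ?thesis
    by (simp add: lin_ext_superset[of ?S] Poly_Mapping.lookup_add free_vs.scale_left_distrib sum.distrib)
qed

lemma lin_ext_scal: "lin_ext f (scal c p) = scal c (lin_ext f p)"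
proof -
  have "keys (scal c p) \<subseteq> keys p" by (auto simp: in_keys_iff lookup_scal)
  then show ?thesis
    by (simp add: lin_ext_superset[of "keys p"] lookup_scal free_vs.scale_sum_right)
qed

lemma lin_ext_minus: "lin_ext f (- p) = - lin_ext f p"
  using lin_ext_scal[of f "-1" p] by simp

lemma lin_ext_diff: "lin_ext f (p - q) = lin_ext f p - lin_ext f q"
  using lin_ext_add[of f p "- q"] by (simp add: lin_ext_minus)

lemma lin_ext_sum: "lin_ext f (sum g S) = (\<Sum>i\<in>S. lin_ext f (g i))"
  by (induction S rule: infinite_finite_induct) (auto simp: lin_ext_add)

lemma lin_ext_single [simp]: "lin_ext f (single k c) = scal c (f k)"
  by (simp add: lin_ext_def)

lemma lin_ext_cong: "(\<And>k. k \<in> keys p \<Longrightarrow> f k = g k) \<Longrightarrow> lin_ext f p = lin_ext g p"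
  by (simp add: lin_ext_def)

lemma lin_ext_id: "lin_ext (\<lambda>k. single k 1) p = p"
  by (induction p rule: pm_induct) (auto simp: lin_ext_add scal_single)

lemma lin_ext_eq_id: "(\<And>k. k \<in> keys p \<Longrightarrow> f k = single k 1) \<Longrightarrow> lin_ext f p = p"
  using lin_ext_cong[of p f "\<lambda>k. single k 1"] lin_ext_id by metis

definition linop :: "(('a \<Rightarrow>\<^sub>0 complex) \<Rightarrow> ('b \<Rightarrow>\<^sub>0 complex)) \<Rightarrow> bool" where
  "linop F \<longleftrightarrow> (\<forall>p q. F (p + q) = F p + F q) \<and> (\<forall>c p. F (scal c p) = scal c (F p))"

lemma linop_lin_ext: "linop (lin_ext f)"
  by (simp add: linop_def lin_ext_add lin_ext_scal)

lemma linop_zero: "linop F \<Longrightarrow> F 0 = 0"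
  unfolding linop_def by (metis free_vs.scale_zero_left)

lemma linop_sum: "linop F \<Longrightarrow> F (sum g S) = (\<Sum>i\<in>S. F (g i))"
  by (induction S rule: infinite_finite_induct) (auto simp: linop_zero linop_def)

lemma linop_lin_ext_commute: "linop F \<Longrightarrow> F (lin_ext f p) = lin_ext (\<lambda>k. F (f k)) p"
  by (simp add: lin_ext_def linop_sum) (simp add: linop_def)

lemma lin_ext_lin_ext: "lin_ext f (lin_ext g p) = lin_ext (\<lambda>k. lin_ext f (g k)) p"
  by (rule linop_lin_ext_commute[OF linop_lin_ext])

lemma linop_mult_left: "linop (\<lambda>p. q * p)" for q :: "'a::monoid_add \<Rightarrow>\<^sub>0 complex"
  by (simp add: linop_def distrib_left scal_mult_right)

lemma linop_mult_right: "linop (\<lambda>p. p * q)" for q :: "'a::monoid_add \<Rightarrow>\<^sub>0 complex"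
  by (simp add: linop_def distrib_right scal_mult_left)

lemma linop_comp: "linop F \<Longrightarrow> linop G \<Longrightarrow> linop (\<lambda>p. F (G p))"
  by (simp add: linop_def)

lemma linop_diff: "linop F \<Longrightarrow> linop G \<Longrightarrow> linop (\<lambda>p. F p - G p)"
  by (simp add: linop_def free_vs.scale_right_diff_distrib)

lemma linop_scal: "linop F \<Longrightarrow> linop (\<lambda>p. scal c (F p))"
  by (simp add: linop_def free_vs.scale_right_distrib mult.commute)

text \<open>The basis elements to be checked are only those occurring in \<open>p\<close>, so
  restrictions on length, letters or content of \<open>p\<close> become available there.\<close>

lemma linop_eqI:
  assumes "linop F" "linop G" "\<And>k. k \<in> keys p \<Longrightarrow> F (single k 1) = G (single k 1)"
  shows "F p = G p"
proof -
  have "F p = lin_ext (\<lambda>k. F (single k 1)) p"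
    using linop_lin_ext_commute[OF assms(1), of "\<lambda>k. single k 1" p] by (simp add: lin_ext_id)
  also have "\<dots> = lin_ext (\<lambda>k. G (single k 1)) p"
    by (rule lin_ext_cong) (rule assms(3))
  also have "\<dots> = G p"
    using linop_lin_ext_commute[OF assms(2), of "\<lambda>k. single k 1" p] by (simp add: lin_ext_id)
  finally show ?thesis .
qed

lemma keys_scal: "keys (scal c p) \<subseteq> keys p"
  by (auto simp: in_keys_iff lookup_scal)

lemma keys_minus_subset: "keys (p - q) \<subseteq> keys p \<union> keys q"
  for p q :: "'a \<Rightarrow>\<^sub>0 complex"
  by (auto simp: in_keys_iff lookup_minus)

lemma keys_lin_ext: "keys (lin_ext f p) \<subseteq> (\<Union>k\<in>keys p. keys (f k))"
  unfolding lin_ext_def using Poly_Mapping.keys_sum keys_scal by fastforce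

lemma lin_ext_mult_hom:
  assumes "\<And>a b. f (a + b) = f a * f b"
  shows "lin_ext f (p * q) = lin_ext f p * lin_ext f q"
proof (induction p rule: pm_induct)
  case (single k c)
  show ?case
    by (induction q rule: pm_induct)
      (simp_all add: assms mult_single distrib_left lin_ext_add scal_mult_left scal_mult_right)
qed (simp_all add: distrib_right lin_ext_add)

abbreviation tens :: "'a list \<Rightarrow> 'a list \<Rightarrow>\<^sub>0 complex" where
  "tens w \<equiv> single w 1"

lemma tens_mult: "tens u * tens v = tens (u @ v)"
  by (simp add: mult_single plus_list_def)

text \<open>Multihomogeneity of content \<open>A\<close>. It is finer than the degree: it also
  controls the alphabet and the multiplicity of each letter, which is what singling out a letter
  that occurs once requires.\<close>

definition msupp :: "nat multiset \<Rightarrow> tensor_alg \<Rightarrow> bool" where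
  "msupp A p \<longleftrightarrow> (\<forall>w\<in>keys p. mset w = A)"

lemma msupp_tens [simp]: "msupp A (tens w) \<longleftrightarrow> mset w = A"
  by (simp add: msupp_def)

lemma msupp_diff: "msupp A p \<Longrightarrow> msupp A q \<Longrightarrow> msupp A (p - q)"
  unfolding msupp_def using keys_minus_subset[of p q] by blast

lemma msupp_scal: "msupp A p \<Longrightarrow> msupp A (scal c p)"
  unfolding msupp_def using keys_scal[of c p] by blast

lemma msupp_sum: "(\<And>i. i \<in> S \<Longrightarrow> msupp A (f i)) \<Longrightarrow> msupp A (sum f S)"
  unfolding msupp_def using Poly_Mapping.keys_sum[of f S] by blast

lemma msupp_mult: "msupp A p \<Longrightarrow> msupp B q \<Longrightarrow> msupp (A + B) (p * q)"
  unfolding msupp_def using keys_mult[of p q] by (fastforce simp: plus_list_def)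

lemma msupp_lin_ext: "msupp A p \<Longrightarrow> (\<And>w. mset w = A \<Longrightarrow> msupp B (f w)) \<Longrightarrow> msupp B (lin_ext f p)"
  unfolding msupp_def using keys_lin_ext[of f p] by blast

lemma msupp_length: "msupp A p \<Longrightarrow> w \<in> keys p \<Longrightarrow> length w = size A"
  unfolding msupp_def by (metis size_mset)

section \<open>The adjoint action and left-normed brackets\<close>

text \<open>The letters of the word act in turn by commutators from the right, so
  \<open>lin_ext (adw p)\<close> is the orbit map of \<open>p\<close> under the right adjoint action
  of the tensor algebra.\<close>

fun adw :: "tensor_alg \<Rightarrow> nat list \<Rightarrow> tensor_alg" where
  "adw p [] = p"
| "adw p (x # v) = adw (p * tens [x] - tens [x] * p) v"

fun brk :: "nat list \<Rightarrow> tensor_alg" where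
  "brk [] = 0"
| "brk (x # v) = adw (tens [x]) v"

lemma linop_adw: "linop (\<lambda>p. adw p v)"
proof (induction v)
  case Nil
  then show ?case by (simp add: linop_def)
next
  case (Cons x v)
  have "linop (\<lambda>p. p * tens [x] - tens [x] * p)"
    by (intro linop_diff linop_mult_left linop_mult_right)
  from linop_comp[OF Cons this] show ?case by simp
qed

lemma adw_append: "adw p (u @ v) = adw (adw p u) v"
  by (induction u arbitrary: p) auto

lemma brk_append: "u \<noteq> [] \<Longrightarrow> brk (u @ v) = adw (brk u) v"
  by (cases u) (auto simp: adw_append)

lemma linop_ad: "linop (\<lambda>p. lin_ext (adw p) q)"
  unfolding linop_def lin_ext_def
  by (simp add: linop_adw[unfolded linop_def] free_vs.scale_right_distrib sum.distrib
      free_vs.scale_sum_right mult.commute)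

lemma ad_mult: "lin_ext (adw p) (q * r) = lin_ext (adw (lin_ext (adw p) q)) r"
proof -
  show ?thesis
  proof (rule linop_eqI[of "\<lambda>q. lin_ext (adw p) (q * r)"])
    show "linop (\<lambda>q. lin_ext (adw p) (q * r))" by (rule linop_comp[OF linop_lin_ext linop_mult_right])
    show "linop (\<lambda>q. lin_ext (adw (lin_ext (adw p) q)) r)" by (rule linop_comp[OF linop_ad linop_lin_ext])
    fix u
    show "lin_ext (adw p) (tens u * r) = lin_ext (adw (lin_ext (adw p) (tens u))) r"
    proof (rule linop_eqI[of "\<lambda>r. lin_ext (adw p) (tens u * r)"])
      show "linop (\<lambda>r. lin_ext (adw p) (tens u * r))" by (rule linop_comp[OF linop_lin_ext linop_mult_left])
    qed (simp_all add: linop_lin_ext tens_mult adw_append)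
  qed
qed

text \<open>The constant term is excluded because \<open>brk []\<close> is 0 whereas the empty word
  acts as the identity: for \<open>p = tens []\<close> the left-hand side would be
  \<open>lin_ext brk q\<close> and the right-hand side 0.\<close>

lemma lin_ext_brk_mult:
  assumes "[] \<notin> keys p"
  shows "lin_ext brk (p * q) = lin_ext (adw (lin_ext brk p)) q"
proof -
  show ?thesis
  proof (rule linop_eqI[of "\<lambda>p. lin_ext brk (p * q)"])
    show "linop (\<lambda>p. lin_ext brk (p * q))" by (rule linop_comp[OF linop_lin_ext linop_mult_right])
    show "linop (\<lambda>p. lin_ext (adw (lin_ext brk p)) q)" by (rule linop_comp[OF linop_ad linop_lin_ext])
    fix u assume "u \<in> keys p"
    then have "u \<noteq> []" using assms by auto
    show "lin_ext brk (tens u * q) = lin_ext (adw (lin_ext brk (tens u))) q"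
    proof (rule linop_eqI[of "\<lambda>q. lin_ext brk (tens u * q)"])
      show "linop (\<lambda>q. lin_ext brk (tens u * q))" by (rule linop_comp[OF linop_lin_ext linop_mult_left])
    qed (use \<open>u \<noteq> []\<close> in \<open>simp_all add: linop_lin_ext tens_mult brk_append\<close>)
  qed
qed

lemma free_lie_keys: "p \<in> free_lie N \<Longrightarrow> [] \<notin> keys p"
proof (induction rule: free_lie.induct)
  case (generator v)
  then show ?case by (auto simp: tensor_power_def)
next
  case (add p q)
  then show ?case using Poly_Mapping.keys_add[of p q] by blast
next
  case (scale p c)
  then show ?case using keys_scal[of c p] by blast
next
  case (bracket p q)
  then show ?case
    using keys_minus_subset[of "p * q" "q * p"] keys_mult[of p q] keys_mult[of q p]
    by (fastforce simp: plus_list_def)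
qed

text \<open>The Jacobi identity: commutators of Lie elements act as commutators of their actions, so
  acting by a Lie element is the same as taking the commutator with it.\<close>

lemma ad_free_lie: "q \<in> free_lie N \<Longrightarrow> lin_ext (adw p) q = p * q - q * p"
proof (induction arbitrary: p rule: free_lie.induct)
  case (generator v)
  show ?case
  proof (rule linop_eqI[of "lin_ext (adw p)"])
    show "linop (\<lambda>v. p * v - v * p)" by (intro linop_diff linop_mult_left linop_mult_right)
    fix w assume "w \<in> keys v"
    then obtain a where "w = [a]" using generator by (auto simp: tensor_power_def length_Suc_conv)
    then show "lin_ext (adw p) (tens w) = p * tens w - tens w * p" by simp
  qed (rule linop_lin_ext)
next
  case (bracket q r)
  then show ?case by (simp add: lin_ext_diff ad_mult left_diff_distrib right_diff_distrib mult.assoc)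
qed (simp_all add: lin_ext_add lin_ext_scal distrib_left distrib_right scal_mult_left scal_mult_right
    free_vs.scale_right_diff_distrib)

text \<open>The degree derivation. With it in place of a fixed degree, the induction over
  \<open>free_lie\<close> in the next theorem can pass through inhomogeneous elements.\<close>

definition euler :: "tensor_alg \<Rightarrow> tensor_alg" where
  "euler = lin_ext (\<lambda>w. scal (of_nat (length w)) (tens w))"

lemma euler_mult: "euler (p * q) = euler p * q + p * euler q"
  unfolding euler_def
proof (induction p rule: pm_induct)
  case (single k c)
  show ?case
    by (induction q rule: pm_induct)
      (simp_all add: mult_single plus_list_def distrib_left lin_ext_add scal_mult_left scal_mult_right
        scal_single single_add[symmetric] algebra_simps)
qed (simp_all add: distrib_right lin_ext_add algebra_simps)

text \<open>The Dynkin--Specht--Wever theorem.\<close>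

lemma lin_ext_brk_free_lie: "p \<in> free_lie N \<Longrightarrow> lin_ext brk p = euler p"
proof (induction rule: free_lie.induct)
  case (generator v)
  then show ?case unfolding euler_def
    by (intro lin_ext_cong) (auto simp: tensor_power_def length_Suc_conv)
next
  case (bracket p q)
  have "lin_ext brk (p * q - q * p) = lin_ext (adw (euler p)) q - lin_ext (adw (euler q)) p"
    using bracket free_lie_keys by (simp add: lin_ext_diff lin_ext_brk_mult)
  also have "\<dots> = euler p * q - q * euler p - (euler q * p - p * euler q)"
    using bracket by (simp add: ad_free_lie)
  also have "\<dots> = euler (p * q - q * p)"
    using euler_mult[of p q] euler_mult[of q p] by (simp add: euler_def lin_ext_diff)
  finally show ?case .
qed (simp_all add: lin_ext_add lin_ext_scal euler_def)

lemma tensor_power_msupp: "msupp A p \<Longrightarrow> size A = m \<Longrightarrow> set_mset A \<subseteq> {..<N} \<Longrightarrow> p \<in> tensor_power N m"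
  unfolding msupp_def tensor_power_def
proof (intro CollectI ballI conjI)
  fix w
  assume *: "\<forall>w\<in>keys p. mset w = A" "size A = m" "set_mset A \<subseteq> {..<N}" "w \<in> keys p"
  then have "mset w = A" by blast
  then show "length w = m" "set w \<subseteq> {..<N}" using * by (metis size_mset, metis set_mset_mset)
qed

lemma lie_part_brk:
  assumes "p \<in> lie_part N m"
  shows "lin_ext brk p = scal (of_nat m) p"
proof -
  have "euler p = lin_ext (\<lambda>w. scal (of_nat m) (tens w)) p"
    unfolding euler_def using assms by (intro lin_ext_cong) (auto simp: lie_part_def tensor_power_def)
  also have "\<dots> = scal (of_nat m) p"
  proof -
    have "linop (\<lambda>p :: tensor_alg. scal (of_nat m) p)"
      by (simp add: linop_def free_vs.scale_right_distrib mult.commute)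
    from linop_lin_ext_commute[OF this, of tens p] show ?thesis by (simp add: lin_ext_id)
  qed
  finally show ?thesis using assms lin_ext_brk_free_lie by (auto simp: lie_part_def)
qed

lemma msupp_adw: "msupp A p \<Longrightarrow> msupp (A + mset v) (adw p v)"
proof (induction v arbitrary: A p)
  case (Cons x v)
  have "msupp (A + {#x#}) (p * tens [x] - tens [x] * p)"
    using msupp_mult[OF Cons.prems, of "{#x#}" "tens [x]"] msupp_mult[OF _ Cons.prems, of "{#x#}" "tens [x]"]
    by (intro msupp_diff) (simp_all add: add.commute)
  from Cons.IH[OF this] show ?case by simp
qed simp

lemma msupp_brk: "msupp (mset w) (brk w)"
proof (cases w)
  case (Cons x v)
  then show ?thesis using msupp_adw[of "{#x#}" "tens [x]" v] by simp
qed (simp add: msupp_def)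

lemma adw_in_free_lie: "p \<in> free_lie N \<Longrightarrow> set v \<subseteq> {..<N} \<Longrightarrow> adw p v \<in> free_lie N"
proof (induction v arbitrary: p)
  case (Cons x v)
  have "tens [x] \<in> free_lie N" using Cons by (intro free_lie.generator) (simp add: tensor_power_def)
  then show ?case using Cons by (simp add: free_lie.bracket)
qed simp

lemma brk_in_free_lie: "w \<noteq> [] \<Longrightarrow> set w \<subseteq> {..<N} \<Longrightarrow> brk w \<in> free_lie N"
proof (cases w)
  case (Cons x v)
  assume "w \<noteq> []" "set w \<subseteq> {..<N}"
  then have "tens [x] \<in> free_lie N" "set v \<subseteq> {..<N}"
    using Cons by (auto intro: free_lie.generator simp: tensor_power_def)
  then show ?thesis using Cons adw_in_free_lie by simp
qed simp

lemma zero_in_free_lie: "0 \<in> free_lie N"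
  by (rule free_lie.generator) (simp add: tensor_power_def)

lemma free_lie_sum: "(\<And>i. i \<in> S \<Longrightarrow> f i \<in> free_lie N) \<Longrightarrow> sum f S \<in> free_lie N"
  by (induction S rule: infinite_finite_induct) (auto intro: free_lie.add zero_in_free_lie)

lemma free_lie_lin_ext: "(\<And>k. k \<in> keys p \<Longrightarrow> f k \<in> free_lie N) \<Longrightarrow> lin_ext f p \<in> free_lie N"
  unfolding lin_ext_def by (intro free_lie_sum free_lie.scale)

section \<open>Inverting the twisted cyclic multiplication\<close>

lemma mset_rotate: "mset (rotate j v) = mset (v :: 'a list)"
proof (induction j)
  case (Suc j)
  have "mset (rotate1 u) = mset u" for u :: "'a list" by (cases u) auto
  then show ?case using Suc by simp
qed simp

lemma rotate_eq_Cons: "w \<noteq> [] \<Longrightarrow> rotate j w = hd (rotate j w) # tl (rotate j w)"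
  by (metis list.collapse rotate_is_Nil_conv)

lemma rotate_Suc_eq: "w \<noteq> [] \<Longrightarrow> rotate (Suc j) w = tl (rotate j w) @ [hd (rotate j w)]"
  by (metis rotate1_hd_tl rotate_Suc rotate_is_Nil_conv)

lemma sum_telescope_scal:
  fixes f :: "nat \<Rightarrow> 'a \<Rightarrow>\<^sub>0 complex"
  shows "(\<Sum>j<n. scal (c * w ^ j) (f j - scal w (f (Suc j)))) = scal c (f 0) - scal (c * w ^ n) (f n)"
  by (induction n) (simp_all add: free_vs.scale_right_diff_distrib mult.assoc mult.commute)

text \<open>\<open>brk\<close> is the operator \<open>r\<close> of the introduction, \<open>cyc_mult\<close> and \<open>cyc_div\<close> are \<open>M\<close> and \<open>M\<^bsup>-1\<^esup>\<close>, and below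
  \<open>lift\<close> is \<open>X\<close> and \<open>proj\<close> is \<open>r X \<zeta>\<close>. The recursion for \<open>M\<^bsup>-1\<^esup>\<close> inverts \<open>1 - \<omega> c\<close>, for the cyclic
  shift \<open>c\<close> of order \<open>e\<close>, by a geometric sum, since \<open>(1 - \<omega> c) (\<Sum>\<^sub>j \<omega>\<^bsup>j\<^esup> c\<^bsup>j\<^esup>) = 1 - \<omega>\<^bsup>e\<^esup>\<close>.\<close>

fun cyc_mult :: "complex \<Rightarrow> nat list \<Rightarrow> tensor_alg" where
  "cyc_mult w [] = 1"
| "cyc_mult w (x # v) = tens [x] * cyc_mult w v - scal w (cyc_mult w v * tens [x])"

fun cyc_div :: "complex \<Rightarrow> nat \<Rightarrow> nat list \<Rightarrow> tensor_alg" where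
  "cyc_div w 0 v = 1"
| "cyc_div w (Suc n) v = (\<Sum>j<Suc n. scal (1 / (1 - w ^ Suc n) * w ^ j)
      (tens [hd (rotate j v)] * cyc_div w n (tl (rotate j v))))"

lemma one_eq_tens: "(1 :: tensor_alg) = tens []"
  by (metis single_one zero_list_def)

lemma msupp_cyc_mult: "msupp (mset v) (cyc_mult w v)"
proof (induction v)
  case (Cons x v)
  then show ?case
    using msupp_mult[of "{#x#}" "tens [x]", OF _ Cons] msupp_mult[OF Cons, of "{#x#}" "tens [x]"]
    by (auto intro!: msupp_diff msupp_scal)
qed (simp add: one_eq_tens)

lemma msupp_cyc_div: "length v = n \<Longrightarrow> msupp (mset v) (cyc_div w n v)"
proof (induction n arbitrary: v)
  case (Suc n)
  have "msupp (mset v) (tens [hd (rotate j v)] * cyc_div w n (tl (rotate j v)))" for j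
  proof -
    have r: "rotate j v = hd (rotate j v) # tl (rotate j v)" using Suc.prems by (intro rotate_eq_Cons) auto
    have "length (tl (rotate j v)) = n" using Suc.prems by simp
    from msupp_mult[of "{#hd (rotate j v)#}" "tens [hd (rotate j v)]", OF _ Suc.IH[OF this]]
    have "msupp (mset (rotate j v)) (tens [hd (rotate j v)] * cyc_div w n (tl (rotate j v)))"
      by (subst r) simp
    then show ?thesis unfolding mset_rotate .
  qed
  then show ?case unfolding cyc_div.simps by (intro msupp_sum msupp_scal)
qed (simp add: one_eq_tens)

lemma lin_ext_Cons: "lin_ext f (tens [x] * p) = lin_ext (\<lambda>v. f (x # v)) p"
proof (rule linop_eqI[of "\<lambda>p. lin_ext f (tens [x] * p)"])
  show "linop (\<lambda>p. lin_ext f (tens [x] * p))" by (rule linop_comp[OF linop_lin_ext linop_mult_left])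
qed (simp_all add: linop_lin_ext tens_mult)

lemma lin_ext_snoc: "lin_ext f (p * tens [x]) = lin_ext (\<lambda>v. f (v @ [x])) p"
proof (rule linop_eqI[of "\<lambda>p. lin_ext f (p * tens [x])"])
  show "linop (\<lambda>p. lin_ext f (p * tens [x]))" by (rule linop_comp[OF linop_lin_ext linop_mult_right])
qed (simp_all add: linop_lin_ext tens_mult)

lemma cyc_mult_Cons_lin:
  "lin_ext (cyc_mult w) (tens [x] * p) =
    tens [x] * lin_ext (cyc_mult w) p - scal w (lin_ext (cyc_mult w) p * tens [x])"
proof -
  have "linop (\<lambda>q. tens [x] * q - scal w (q * tens [x]))"
    by (intro linop_diff linop_scal linop_mult_left linop_mult_right)
  from linop_lin_ext_commute[OF this, of "cyc_mult w" p] show ?thesis by (simp add: lin_ext_Cons)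
qed

text \<open>By induction \<open>M\<close> turns the summand for \<open>j\<close> into the rotation
  by \<open>j\<close> minus \<open>w\<close> times the rotation by \<open>j + 1\<close>. The
  weighted sum telescopes, the last rotation is the word itself again, and the normalizing factor
  cancels \<open>1 - w ^ Suc n\<close>.\<close>

lemma cyc_mult_cyc_div:
  assumes "\<And>e. 0 < e \<Longrightarrow> e \<le> n \<Longrightarrow> w ^ e \<noteq> 1" "length v = n"
  shows "lin_ext (cyc_mult w) (cyc_div w n v) = tens v"
  using assms
proof (induction n arbitrary: v)
  case 0
  then show ?case by (simp add: one_eq_tens)
next
  case (Suc n)
  have v: "v \<noteq> []" using Suc.prems by auto
  have "lin_ext (cyc_mult w) (tens [hd (rotate j v)] * cyc_div w n (tl (rotate j v))) =
      tens (rotate j v) - scal w (tens (rotate (Suc j) v))" for j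
  proof -
    have "lin_ext (cyc_mult w) (cyc_div w n (tl (rotate j v))) = tens (tl (rotate j v))"
      using Suc.prems by (intro Suc.IH) auto
    then show ?thesis
      unfolding cyc_mult_Cons_lin using rotate_eq_Cons[OF v, of j] rotate_Suc_eq[OF v, of j]
      by (simp add: tens_mult)
  qed
  then have "lin_ext (cyc_mult w) (cyc_div w (Suc n) v) =
    (\<Sum>j<Suc n. scal (1 / (1 - w ^ Suc n) * w ^ j) (tens (rotate j v) - scal w (tens (rotate (Suc j) v))))"
    by (simp only: cyc_div.simps lin_ext_sum lin_ext_scal)
  also have "\<dots> = scal (1 / (1 - w ^ Suc n)) (tens (rotate 0 v)) -
      scal (1 / (1 - w ^ Suc n) * w ^ Suc n) (tens (rotate (Suc n) v))"
    by (rule sum_telescope_scal)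
  also have "\<dots> = scal (1 / (1 - w ^ Suc n)) (tens v) - scal (1 / (1 - w ^ Suc n) * w ^ Suc n) (tens v)"
    using Suc.prems(2) rotate_id[of "Suc n" v] by (simp del: rotate_Suc)
  also have "\<dots> = tens v"
    using Suc.prems(1)[of "Suc n"] by (simp add: free_vs.scale_left_diff_distrib[symmetric] diff_divide_distrib[symmetric])
  finally show ?case .
qed

text \<open>The other composite is proved directly, without a dimension count, from the intertwining
  relation D(x s) - w D(s x) = x D(s) for D = \<open>cyc_div\<close>. This composite provides the
  injectivity of \<open>M\<close>, the previous one its surjectivity.\<close>

lemma cyc_div_cyc_mult:
  assumes "\<And>e. 0 < e \<Longrightarrow> e \<le> n \<Longrightarrow> w ^ e \<noteq> 1" "length v = n"
  shows "lin_ext (cyc_div w n) (cyc_mult w v) = tens v"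
  using assms
proof (induction n arbitrary: v)
  case 0
  then show ?case by (simp add: one_eq_tens)
next
  case (Suc n)
  then obtain x u where v: "v = x # u" "length u = n" by (cases v) auto
  let ?T = "\<lambda>v. tens [hd v] * cyc_div w n (tl v)"
  have "cyc_div w (Suc n) (x # s) - scal w (cyc_div w (Suc n) (s @ [x])) = tens [x] * cyc_div w n s"
    if "length s = n" for s
  proof -
    have r: "rotate j (s @ [x]) = rotate (Suc j) (x # s)" for j by (simp add: rotate1_rotate_swap)
    have "cyc_div w (Suc n) (x # s) - scal w (cyc_div w (Suc n) (s @ [x])) =
      (\<Sum>j<Suc n. scal (1 / (1 - w ^ Suc n) * w ^ j) (?T (rotate j (x # s)) - scal w (?T (rotate (Suc j) (x # s)))))"
      unfolding cyc_div.simps r free_vs.scale_sum_right sum_subtractf[symmetric] free_vs.scale_right_diff_distrib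
      by (intro sum.cong refl) (simp add: mult_ac del: rotate_Suc)
    also have "\<dots> = scal (1 / (1 - w ^ Suc n)) (?T (rotate 0 (x # s))) -
        scal (1 / (1 - w ^ Suc n) * w ^ Suc n) (?T (rotate (Suc n) (x # s)))"
      by (rule sum_telescope_scal)
    also have "\<dots> = scal (1 / (1 - w ^ Suc n)) (?T (x # s)) - scal (1 / (1 - w ^ Suc n) * w ^ Suc n) (?T (x # s))"
      using that rotate_id[of "Suc n" "x # s"] by (simp del: rotate_Suc)
    also have "\<dots> = ?T (x # s)"
      using Suc.prems(1)[of "Suc n"] by (simp add: free_vs.scale_left_diff_distrib[symmetric] diff_divide_distrib[symmetric])
    finally show ?thesis by simp
  qed
  moreover have "length s = n" if "s \<in> keys (cyc_mult w u)" for s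
    using msupp_length[OF msupp_cyc_mult that] v by simp
  ultimately have "lin_ext (\<lambda>s. cyc_div w (Suc n) (x # s)) (cyc_mult w u) -
      scal w (lin_ext (\<lambda>s. cyc_div w (Suc n) (s @ [x])) (cyc_mult w u)) =
      lin_ext (\<lambda>s. tens [x] * cyc_div w n s) (cyc_mult w u)"
    unfolding lin_ext_def free_vs.scale_sum_right sum_subtractf[symmetric]
  proof (intro sum.cong refl, goal_cases)
    case (1 s)
    let ?c = "lookup (cyc_mult w u) s"
    have "scal ?c (cyc_div w (Suc n) (x # s) - scal w (cyc_div w (Suc n) (s @ [x]))) =
        scal ?c (tens [x] * cyc_div w n s)"
      using 1 by simp
    then show ?case by (simp add: free_vs.scale_right_diff_distrib mult.commute del: cyc_div.simps)
  qed
  also have "\<dots> = tens [x] * lin_ext (cyc_div w n) (cyc_mult w u)"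
    by (rule linop_lin_ext_commute[OF linop_mult_left, symmetric])
  also have "\<dots> = tens v" using Suc v by (simp add: tens_mult)
  finally show ?case unfolding v(1) cyc_mult.simps lin_ext_diff lin_ext_scal lin_ext_Cons lin_ext_snoc .
qed

lemma hd_tl_rotate_map:
  "v \<noteq> [] \<Longrightarrow> hd (rotate j (map f v)) = f (hd (rotate j v))"
  "v \<noteq> [] \<Longrightarrow> tl (rotate j (map f v)) = map f (tl (rotate j v))"
  by (simp_all add: rotate_map hd_map map_tl)

text \<open>The algebra endomorphism induced by a map of letters, not necessarily injective; it
  specializes words with distinct letters to arbitrary ones.\<close>

abbreviation subst_letters :: "(nat \<Rightarrow> nat) \<Rightarrow> tensor_alg \<Rightarrow> tensor_alg" where
  "subst_letters f \<equiv> lin_ext (\<lambda>w. tens (map f w))"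

lemma subst_letters_mult: "subst_letters f (p * q) = subst_letters f p * subst_letters f q"
  by (rule lin_ext_mult_hom) (simp add: tens_mult, simp add: plus_list_def)

lemma subst_letters_adw: "subst_letters f (adw p v) = adw (subst_letters f p) (map f v)"
  by (induction v arbitrary: p) (simp_all add: lin_ext_diff subst_letters_mult)

lemma subst_letters_brk: "subst_letters f (brk w) = brk (map f w)"
  by (cases w) (simp_all add: subst_letters_adw)

lemma subst_letters_cyc_div: "length v = n \<Longrightarrow> subst_letters f (cyc_div w n v) = cyc_div w n (map f v)"
proof (induction n arbitrary: v)
  case (Suc n)
  then have "v \<noteq> []" by auto
  then show ?case unfolding cyc_div.simps
    using Suc by (simp only: lin_ext_sum lin_ext_scal subst_letters_mult hd_tl_rotate_map Suc.IH length_tl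
        length_rotate diff_Suc_1 lin_ext_single list.map free_vs.scale_one
        not_False_eq_True)
qed (simp add: one_eq_tens)

section \<open>The idempotent of the cyclic group\<close>

locale cyclic_root =
  fixes m :: nat and w :: complex
  assumes m2: "2 \<le> m" and root: "primitive_root_of_unity m w"
begin

lemma w_pow_m: "w ^ m = 1"
  using root by (simp add: primitive_root_of_unity_def)

lemma w_pow_neq: "0 < e \<Longrightarrow> e \<le> m - 1 \<Longrightarrow> w ^ e \<noteq> 1"
  using root m2 by (auto simp: primitive_root_of_unity_def dest: dvd_imp_le)

definition zeta :: "nat list \<Rightarrow> tensor_alg" where
  "zeta v = scal (1 / of_nat m) (\<Sum>j<m. scal (w ^ j) (tens (rotate j v)))"

definition lift :: "nat list \<Rightarrow> tensor_alg" where
  "lift v = tens [hd v] * cyc_div w (m - 1) (tl v)"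

definition proj :: "nat list \<Rightarrow> tensor_alg" where
  "proj v = lin_ext brk (lin_ext lift (zeta v))"

text \<open>A shift of the summation index by one; the term that wraps around fits because
  \<open>w ^ m = 1\<close> and the rotation by \<open>m\<close> is the identity.\<close>

lemma zeta_Cons: "length (y # v) = m \<Longrightarrow> zeta (y # v) = scal w (zeta (v @ [y]))"
proof -
  assume l: "length (y # v) = m"
  let ?f = "\<lambda>j. scal (w ^ j) (tens (rotate j (y # v)))"
  have r: "rotate j (v @ [y]) = rotate (Suc j) (y # v)" for j by (simp add: rotate1_rotate_swap)
  have "scal w (zeta (v @ [y])) = scal (1 / of_nat m) (\<Sum>j<m. ?f (Suc j))"
    unfolding zeta_def r by (simp add: free_vs.scale_sum_right mult_ac del: rotate_Suc)
  also have "(\<Sum>j<m. ?f (Suc j)) = (\<Sum>j<m. ?f j)"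
  proof -
    have "?f m = ?f 0" using w_pow_m l rotate_id[of m "y # v"] by simp
    then show ?thesis using sum.lessThan_Suc[of ?f m] sum.lessThan_Suc_shift[of ?f m] by simp
  qed
  finally show ?thesis by (simp add: zeta_def)
qed

lemma zeta_rotate: "length v = m \<Longrightarrow> scal (w ^ j) (zeta (rotate j v)) = zeta v"
proof (induction j)
  case (Suc j)
  have ne: "v \<noteq> []" using Suc m2 by auto
  have l: "length (hd (rotate j v) # tl (rotate j v)) = m"
    using Suc rotate_eq_Cons[OF ne, of j] by (metis length_rotate)
  have "scal (w ^ Suc j) (zeta (rotate (Suc j) v)) = scal (w ^ j) (scal w (zeta (tl (rotate j v) @ [hd (rotate j v)])))"
    unfolding rotate_Suc_eq[OF ne] by (simp add: mult.commute)
  also have "\<dots> = scal (w ^ j) (zeta (rotate j v))"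
    using zeta_Cons[OF l] rotate_eq_Cons[OF ne, of j] by simp
  finally show ?case using Suc by simp
qed simp

lemma zeta_zeta: "length v = m \<Longrightarrow> lin_ext zeta (zeta v) = zeta v"
proof -
  assume "length v = m"
  then have "lin_ext zeta (zeta v) = scal (1 / of_nat m) (\<Sum>j<m. zeta v)"
    by (simp add: zeta_def[of v] lin_ext_scal lin_ext_sum zeta_rotate)
  also have "(\<Sum>j<m. zeta v) = scal (of_nat m) (zeta v)"
    by (rule poly_mapping_eqI) (simp add: Poly_Mapping.lookup_sum lookup_scal del: sum_constant, simp)
  finally show ?thesis using m2 by simp
qed

lemma msupp_zeta: "msupp (mset v) (zeta v)"
  unfolding zeta_def by (intro msupp_scal msupp_sum) (simp add: mset_rotate)

lemma zeta_comm:
  assumes "msupp A p" "size A = m - 1"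
  shows "lin_ext zeta (tens [y] * p) = scal w (lin_ext zeta (p * tens [y]))"
proof -
  have "lin_ext zeta (tens [y] * p) = lin_ext (\<lambda>v. scal w (zeta (v @ [y]))) p"
    unfolding lin_ext_Cons using msupp_length[OF assms(1)] assms(2) m2
    by (intro lin_ext_cong zeta_Cons) auto
  also have "\<dots> = scal w (lin_ext (\<lambda>v. zeta (v @ [y])) p)"
    using linop_lin_ext_commute[OF linop_scal[of "\<lambda>p. p" w], of "\<lambda>v. zeta (v @ [y])" p] by (simp add: linop_def)
  finally show ?thesis by (simp add: lin_ext_snoc)
qed

text \<open>In total degree \<open>m\<close>, modulo the kernel of \<open>zeta\<close>, a letter in
  front may be moved to the end at the cost of a factor \<open>w\<close>. Applied to the second half
  of the commutator this turns [p, x] M(v) into p M(x v), which is where the recursion of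
  \<open>cyc_mult\<close> comes from.\<close>

lemma zeta_adw:
  "msupp A p \<Longrightarrow> size A + length v = m \<Longrightarrow> lin_ext zeta (adw p v) = lin_ext zeta (p * cyc_mult w v)"
proof (induction v arbitrary: p A)
  case Nil
  then show ?case by simp
next
  case (Cons x v)
  let ?M = "cyc_mult w v"
  have s: "msupp (A + {#x#}) (p * tens [x] - tens [x] * p)"
    using msupp_adw[OF Cons.prems(1), of "[x]"] by simp
  have "lin_ext zeta (adw p (x # v)) = lin_ext zeta ((p * tens [x] - tens [x] * p) * ?M)"
    using Cons.IH[OF s] Cons.prems(2) by simp
  also have "\<dots> = lin_ext zeta (p * tens [x] * ?M) - lin_ext zeta (tens [x] * (p * ?M))"
    by (simp add: left_diff_distrib lin_ext_diff mult.assoc)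
  also have "lin_ext zeta (tens [x] * (p * ?M)) = scal w (lin_ext zeta ((p * ?M) * tens [x]))"
    using Cons.prems by (intro zeta_comm[OF msupp_mult[OF Cons.prems(1) msupp_cyc_mult]]) simp
  finally show ?case
    by (simp add: right_diff_distrib lin_ext_diff lin_ext_scal scal_mult_right mult.assoc)
qed

lemma zeta_brk_Cons:
  assumes "msupp A p" "size A = m - 1"
  shows "lin_ext zeta (lin_ext brk (tens [x] * p)) = lin_ext zeta (tens [x] * lin_ext (cyc_mult w) p)"
proof -
  have "lin_ext zeta (lin_ext brk (tens [x] * p)) = lin_ext (\<lambda>v. lin_ext zeta (adw (tens [x]) v)) p"
    by (simp add: lin_ext_Cons lin_ext_lin_ext)
  also have "\<dots> = lin_ext (\<lambda>v. lin_ext zeta (tens [x] * cyc_mult w v)) p"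
    using msupp_length[OF assms(1)] assms(2) m2
    by (intro lin_ext_cong zeta_adw[of "{#x#}"]) auto
  also have "\<dots> = lin_ext zeta (tens [x] * lin_ext (cyc_mult w) p)"
    using linop_lin_ext_commute[OF linop_comp[OF linop_lin_ext linop_mult_left], of zeta "tens [x]" "cyc_mult w" p]
    by simp
  finally show ?thesis .
qed

lemma msupp_lift: "length v = m \<Longrightarrow> msupp (mset v) (lift v)"
proof -
  assume "length v = m"
  then have "v \<noteq> []" "length (tl v) = m - 1" using m2 by auto
  then show ?thesis
    using msupp_mult[of "{#hd v#}" "tens [hd v]", OF _ msupp_cyc_div[of "tl v" "m - 1" w]]
    by (cases v) (auto simp: lift_def)
qed

lemma zeta_brk_lift:
  assumes "length v = m"
  shows "lin_ext zeta (lin_ext brk (lift v)) = zeta v"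
proof -
  have v: "v = hd v # tl v" "length (tl v) = m - 1" using assms m2 by (cases v; auto)+
  have "lin_ext zeta (lin_ext brk (lift v)) =
      lin_ext zeta (tens [hd v] * lin_ext (cyc_mult w) (cyc_div w (m - 1) (tl v)))"
    unfolding lift_def using v(2) by (intro zeta_brk_Cons[OF msupp_cyc_div]) auto
  also have "\<dots> = zeta v"
    using w_pow_neq v by (subst cyc_mult_cyc_div) (auto simp: tens_mult)
  finally show ?thesis .
qed

lemma zeta_proj:
  assumes "length v = m"
  shows "lin_ext zeta (proj v) = zeta v"
proof -
  have "lin_ext zeta (proj v) = lin_ext (\<lambda>u. lin_ext zeta (lin_ext brk (lift u))) (zeta v)"
    by (simp add: proj_def lin_ext_lin_ext)
  also have "\<dots> = lin_ext zeta (zeta v)"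
    using msupp_length[OF msupp_zeta] assms by (intro lin_ext_cong zeta_brk_lift) auto
  finally show ?thesis using zeta_zeta assms by simp
qed

end

section \<open>Brackets starting with a prescribed letter\<close>

lemma linop_minus: "linop F \<Longrightarrow> F (- p) = - F p"
proof -
  assume "linop F"
  then have "F (scal (-1) p) = scal (-1) (F p)" unfolding linop_def by blast
  then show ?thesis by simp
qed

text \<open>For nonempty \<open>p\<close>, the bracket of \<open>p x s\<close> is minus the result
  of letting \<open>s\<close> act on [x, r(p)]. Since r(p) is a Lie element, [x, r(p)] is
  \<open>x\<close> acted on by r(p), so the whole equals - r(x r(p) s), with the marked letter in
  front.\<close>

lemma brk_marked:
  assumes "mset v = add_mset x A"
  shows "\<exists>q. msupp A q \<and> brk v = lin_ext brk (tens [x] * q)"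
proof -
  have "x \<in> set v" using assms by (metis set_mset_mset union_single_eq_member)
  then obtain p s where v: "v = p @ x # s" by (metis split_list)
  then have A: "A = mset p + mset s" using assms by simp
  show ?thesis
  proof (cases p)
    case Nil
    then show ?thesis using v A by (intro exI[of _ "tens s"]) (simp add: tens_mult)
  next
    case (Cons a p')
    let ?b = "brk p"
    \<comment> \<open>Any alphabet containing the letters of \<open>p\<close> will do; its size is
      read off from the largest letter.\<close>
    have free: "?b \<in> free_lie (Suc (Max (set p)))" using Cons by (intro brk_in_free_lie) (auto simp: less_Suc_eq_le)
    have "brk v = lin_ext (adw (?b * tens [x] - tens [x] * ?b)) (tens s)"
      using v Cons by (simp add: adw_append)
    also have "\<dots> = - lin_ext (adw (tens [x] * ?b - ?b * tens [x])) (tens s)"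
      using linop_minus[OF linop_ad[of "tens s"], of "tens [x] * ?b - ?b * tens [x]"] by simp
    also have "tens [x] * ?b - ?b * tens [x] = lin_ext (adw (tens [x])) ?b"
      using ad_free_lie[OF free] by simp
    also have "lin_ext (adw (lin_ext (adw (tens [x])) ?b)) (tens s) = lin_ext brk (tens [x] * (?b * tens s))"
      by (subst lin_ext_brk_mult) (simp_all add: ad_mult)
    also have "- \<dots> = lin_ext brk (tens [x] * scal (-1) (?b * tens s))"
      by (simp add: scal_mult_right lin_ext_minus)
    finally show ?thesis
      using A msupp_mult[OF msupp_brk[of p], of "mset s" "tens s"] msupp_scal by (metis msupp_tens)
  qed
qed

lemma lin_ext_brk_marked:
  assumes "msupp (add_mset x A) p"
  shows "\<exists>q. msupp A q \<and> lin_ext brk p = lin_ext brk (tens [x] * q)"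
proof -
  define Q where "Q v = (SOME q. msupp A q \<and> brk v = lin_ext brk (tens [x] * q))" for v
  have Q: "msupp A (Q v)" "brk v = lin_ext brk (tens [x] * Q v)" if "v \<in> keys p" for v
    using someI_ex[OF brk_marked[of v x A]] assms that by (auto simp: Q_def msupp_def)
  have "lin_ext brk p = lin_ext (\<lambda>v. lin_ext brk (tens [x] * Q v)) p"
    by (rule lin_ext_cong) (rule Q)
  also have "\<dots> = lin_ext brk (tens [x] * lin_ext Q p)"
    using linop_lin_ext_commute[OF linop_comp[OF linop_lin_ext linop_mult_left], of brk "tens [x]" Q p] by simp
  finally show ?thesis
    using Q(1) keys_lin_ext[of Q p] by (intro exI[of _ "lin_ext Q p"]) (auto simp: msupp_def)
qed

context cyclic_root
begin

lemma hd_rotate_neq: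
  assumes "x \<notin> set u" "length (x # u) = m" "0 < j" "j < m"
  shows "rotate j (x # u) \<noteq> x # s"
proof
  assume "rotate j (x # u) = x # s"
  then have "rotate j (x # u) ! 0 = x" by simp
  then have "(x # u) ! j = x" using assms nth_rotate[of 0 "x # u" j] by simp
  then have "u ! (j - 1) = x" using assms by (simp add: nth_Cons')
  then show False using assms by (metis Suc_diff_1 Suc_less_eq length_Cons nth_mem)
qed

text \<open>As \<open>x\<close> occurs only once, the trivial rotation is the only one that begins
  with \<open>x\<close>, so a single summand of \<open>zeta\<close> contributes.\<close>

lemma lookup_zeta_Cons:
  assumes "x \<notin> set u" "length (x # u) = m"
  shows "lookup (zeta (x # u)) (x # s) = (1 / of_nat m when u = s)"
proof -
  have "(\<Sum>j<m. lookup (scal (w ^ j) (tens (rotate j (x # u)))) (x # s)) =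
      (\<Sum>j\<in>{0}. lookup (scal (w ^ j) (tens (rotate j (x # u)))) (x # s))"
    using m2 hd_rotate_neq[OF assms] by (intro sum.mono_neutral_right) (auto simp: lookup_scal lookup_single)
  then show ?thesis
    by (simp add: zeta_def lookup_scal Poly_Mapping.lookup_sum lookup_single when_def)
qed

lemma zeta_Cons_eq_0D:
  assumes "msupp A p" "size A = m - 1" "x \<notin># A" "lin_ext zeta (tens [x] * p) = 0"
  shows "p = 0"
proof (rule poly_mapping_eqI)
  fix s
  have u: "x \<notin> set u" "length (x # u) = m" if "u \<in> keys p" for u
    using that assms(1-3) msupp_length[OF assms(1) that] m2 unfolding msupp_def
    by (metis set_mset_mset, simp)
  have "0 = lookup (lin_ext (\<lambda>u. zeta (x # u)) p) (x # s)"
    using assms(4) by (simp add: lin_ext_Cons)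
  also have "\<dots> = (\<Sum>u\<in>keys p. lookup p u * (1 / of_nat m when u = s))"
    unfolding lin_ext_def Poly_Mapping.lookup_sum lookup_scal
    using u by (intro sum.cong refl) (simp add: lookup_zeta_Cons)
  also have "\<dots> = lookup p s / of_nat m"
    by (simp add: when_def if_distrib[of "\<lambda>c. _ * c"] sum.delta in_keys_iff cong: if_cong)
  finally show "lookup p s = lookup 0 s" using m2 by simp
qed

lemma lin_ext_proj: "lin_ext proj p = lin_ext brk (lin_ext lift (lin_ext zeta p))"
  unfolding lin_ext_lin_ext by (rule lin_ext_cong) (simp add: proj_def lin_ext_lin_ext)

text \<open>Both sides have the form r(x q) with \<open>x\<close> absent from q, and
  \<open>zeta\<close> takes the same value on them. But \<open>zeta\<close> sees r(x q) only as x
  M(q), it is injective on such elements because \<open>x\<close> occurs once, and \<open>M\<close>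
  is injective; hence the two q agree.\<close>

lemma proj_brk_marked:
  assumes "mset v = add_mset x A" "x \<notin># A" "length v = m"
  shows "lin_ext proj (brk v) = brk v"
proof -
  have A: "size A = m - 1" using assms by (metis add_diff_cancel_left' plus_1_eq_Suc size_add_mset size_mset)
  let ?y = "lin_ext proj (brk v)"
  have len: "length u = m" if "u \<in> keys (brk v)" for u
    using msupp_length[OF msupp_brk that] assms(3) by simp
  have "msupp (mset v) (lin_ext lift (lin_ext zeta (brk v)))"
  proof (rule msupp_lin_ext[OF msupp_lin_ext[OF msupp_brk]])
    show "msupp (mset v) (zeta u)" if "mset u = mset v" for u using msupp_zeta[of u] that by simp
    show "msupp (mset v) (lift u)" if "mset u = mset v" for u
      using msupp_lift[of u] that assms(3) by (metis size_mset)
  qed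
  then obtain q' where q': "msupp A q'" "?y = lin_ext brk (tens [x] * q')"
    using lin_ext_brk_marked[of x A] assms(1) lin_ext_proj by metis
  obtain q where q: "msupp A q" "brk v = lin_ext brk (tens [x] * q)"
    using brk_marked[OF assms(1)] by blast
  have "lin_ext zeta ?y = lin_ext zeta (brk v)"
    unfolding lin_ext_lin_ext by (intro lin_ext_cong zeta_proj len)
  then have "lin_ext zeta (tens [x] * lin_ext (cyc_mult w) q') = lin_ext zeta (tens [x] * lin_ext (cyc_mult w) q)"
    using zeta_brk_Cons[OF q'(1) A, of x] zeta_brk_Cons[OF q(1) A, of x] q'(2) q(2) by metis
  then have "lin_ext zeta (tens [x] * lin_ext (cyc_mult w) (q' - q)) = 0"
    by (simp add: lin_ext_diff right_diff_distrib)
  moreover have "msupp A (lin_ext (cyc_mult w) (q' - q))"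
  proof (rule msupp_lin_ext[OF msupp_diff[OF q'(1) q(1)]])
    show "msupp A (cyc_mult w u)" if "mset u = A" for u using msupp_cyc_mult[of u w] that by simp
  qed
  ultimately have 0: "lin_ext (cyc_mult w) (q' - q) = 0"
    using zeta_Cons_eq_0D A assms(2) by blast
  have "q' - q = lin_ext (\<lambda>u. lin_ext (cyc_div w (m - 1)) (cyc_mult w u)) (q' - q)"
    using msupp_length[OF msupp_diff[OF q'(1) q(1)]] A w_pow_neq
    by (intro lin_ext_eq_id[symmetric] cyc_div_cyc_mult) auto
  also have "\<dots> = lin_ext (cyc_div w (m - 1)) (lin_ext (cyc_mult w) (q' - q))"
    by (simp add: lin_ext_lin_ext)
  also have "\<dots> = 0" unfolding 0 by simp
  finally show ?thesis using q q' by simp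
qed

text \<open>All ingredients of \<open>proj\<close> are combinations of permutations of positions
  with coefficients that do not depend on the letters, so they commute even with substitutions that
  identify letters.\<close>

lemma subst_letters_proj:
  assumes "length v = m"
  shows "subst_letters f (proj v) = proj (map f v)"
proof -
  have lift: "subst_letters f (lift u) = lift (map f u)" if "length u = m" for u
  proof -
    have "u \<noteq> []" using that m2 by auto
    then show ?thesis using that
      by (simp add: lift_def subst_letters_mult subst_letters_cyc_div hd_map map_tl)
  qed
  have "subst_letters f (proj v) = lin_ext brk (subst_letters f (lin_ext lift (zeta v)))"
    by (simp add: proj_def lin_ext_lin_ext subst_letters_brk)
  also have "subst_letters f (lin_ext lift (zeta v)) = lin_ext (\<lambda>u. lift (map f u)) (zeta v)"
    unfolding lin_ext_lin_ext using msupp_length[OF msupp_zeta] assms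
    by (intro lin_ext_cong lift) auto
  also have "\<dots> = lin_ext lift (subst_letters f (zeta v))"
    by (simp add: lin_ext_lin_ext)
  also have "subst_letters f (zeta v) = zeta (map f v)"
    by (simp add: zeta_def lin_ext_scal lin_ext_sum scal_single[symmetric] rotate_map)
  finally show ?thesis by (simp add: proj_def)
qed

text \<open>On words with a letter that occurs exactly once, \<open>proj\<close> fixes brackets because \<open>zeta\<close> is
  injective there; all other words are specializations of such words.\<close>

lemma proj_brk:
  assumes "length v = m"
  shows "lin_ext proj (brk v) = brk v"
proof -
  have upt: "mset [0..<m] = add_mset 0 (mset [1..<m])"
    using m2 by (simp add: upt_conv_Cons)
  have v: "map ((!) v) [0..<m] = v" using assms map_nth by blast
  have "subst_letters ((!) v) (lin_ext proj (brk [0..<m])) = lin_ext proj (brk v)"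
  proof -
    have "subst_letters ((!) v) (lin_ext proj (brk [0..<m])) = lin_ext (\<lambda>u. proj (map ((!) v) u)) (brk [0..<m])"
      unfolding lin_ext_lin_ext using msupp_length[OF msupp_brk[of "[0..<m]"]]
      by (intro lin_ext_cong subst_letters_proj) simp
    also have "\<dots> = lin_ext proj (subst_letters ((!) v) (brk [0..<m]))"
      by (simp add: lin_ext_lin_ext)
    finally show ?thesis by (simp add: subst_letters_brk v)
  qed
  moreover have "lin_ext proj (brk [0..<m]) = brk [0..<m]"
    by (rule proj_brk_marked[OF upt]) auto
  ultimately show ?thesis by (simp add: subst_letters_brk v)
qed

text \<open>By the Dynkin-Specht-Wever theorem a Lie element of degree \<open>m\<close> is
  \<open>1 / m\<close> times a combination of brackets, and those are fixed.\<close>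

lemma proj_lie_part:
  assumes "l \<in> lie_part N m"
  shows "lin_ext proj l = l"
proof -
  have l: "length v = m" if "v \<in> keys l" for v
    using assms that by (auto simp: lie_part_def tensor_power_def)
  have "scal (of_nat m) (lin_ext proj l) = lin_ext proj (lin_ext brk l)"
    by (simp add: lie_part_brk[OF assms] lin_ext_scal)
  also have "\<dots> = lin_ext brk l"
    unfolding lin_ext_lin_ext using l by (intro lin_ext_cong proj_brk)
  also have "\<dots> = scal (of_nat m) l" by (rule lie_part_brk[OF assms])
  finally show ?thesis using m2 by simp
qed

lemma proj_in_lie_part:
  assumes "v \<in> words N m"
  shows "proj v \<in> lie_part N m"
proof -
  have v: "length v = m" "set v \<subseteq> {..<N}" using assms by (auto simp: words_def)
  have s: "msupp (mset v) (lin_ext lift (zeta v))"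
  proof (rule msupp_lin_ext[OF msupp_zeta])
    show "msupp (mset v) (lift u)" if "mset u = mset v" for u
      using msupp_lift[of u] that v(1) by (metis size_mset)
  qed
  have k: "mset u = mset v" if "u \<in> keys (lin_ext lift (zeta v))" for u
    using s that by (simp add: msupp_def)
  have "proj v \<in> free_lie N"
    unfolding proj_def
  proof (intro free_lie_lin_ext brk_in_free_lie)
    fix u assume "u \<in> keys (lin_ext lift (zeta v))"
    from k[OF this] show "u \<noteq> []" "set u \<subseteq> {..<N}" using v m2 by (auto dest: mset_eq_setD)
  qed
  moreover have "msupp (mset v) (proj v)"
    unfolding proj_def
  proof (rule msupp_lin_ext[OF s])
    show "msupp (mset v) (brk u)" if "mset u = mset v" for u using msupp_brk[of u] that by simp
  qed
  then have "proj v \<in> tensor_power N m" using v by (intro tensor_power_msupp[of "mset v"]) auto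
  ultimately show ?thesis by (simp add: lie_part_def)
qed

end

section \<open>Traces\<close>

text \<open>The family \<open>P\<close> need not be independent. The coordinates at \<open>e\<close>
  and the family \<open>P\<close> factor the identity of \<open>W\<close> through the space with
  basis \<open>I\<close>, and the trace of \<phi> equals the trace of the induced operator on that
  space; the proof is the exchange of two sums in an auxiliary basis \<open>B\<close>.\<close>

lemma trace_on_eq:
  assumes I: "finite I" "\<And>p. p \<in> W \<Longrightarrow> p = (\<Sum>i\<in>I. scal (lookup p (e i)) (P i))"
    and P: "\<And>i. i \<in> I \<Longrightarrow> P i \<in> W" and W: "free_vs.subspace W"
    and \<phi>: "linop \<phi>" "\<And>p. p \<in> W \<Longrightarrow> \<phi> p \<in> W"
  shows "trace_on W \<phi> = (\<Sum>i\<in>I. lookup (\<phi> (P i)) (e i))"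
proof -
  have "\<exists>B. free_vs.independent B \<and> free_vs.span B = W"
    using free_vs.basis_exists[of W] free_vs.span_subspace[OF _ _ W] by metis
  define B where "B = (SOME B. free_vs.independent B \<and> free_vs.span B = W)"
  have B: "free_vs.independent B" "free_vs.span B = W"
    using someI_ex[OF \<open>\<exists>B. free_vs.independent B \<and> free_vs.span B = W\<close>] by (auto simp: B_def)
  have BW: "b \<in> W" if "b \<in> B" for b using that B(2) free_vs.span_base by blast
  have "B \<subseteq> free_vs.span (P ` I)"
  proof
    fix b assume "b \<in> B"
    then have "b = (\<Sum>i\<in>I. scal (lookup b (e i)) (P i))" using I(2) BW by blast
    then show "b \<in> free_vs.span (P ` I)"
      by (metis (no_types, lifting) free_vs.span_base free_vs.span_scale free_vs.span_sum imageI)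
  qed
  then have finB: "finite B" using free_vs.independent_span_bound[OF _ B(1), of "P ` I"] I(1) by simp
  let ?r = "free_vs.representation B"
  have rep: "p = (\<Sum>b\<in>B. scal (?r p b) b)" if "p \<in> W" for p
    using free_vs.sum_representation_eq[OF B(1) _ finB order_refl] that B(2) by simp
  have "(\<Sum>i\<in>I. lookup (\<phi> (P i)) (e i)) =
      (\<Sum>i\<in>I. \<Sum>b\<in>B. lookup (\<phi> b) (e i) * ?r (P i) b)"
  proof (intro sum.cong refl)
    fix i assume "i \<in> I"
    have "\<phi> (P i) = \<phi> (\<Sum>b\<in>B. scal (?r (P i) b) b)" using rep[OF P[OF \<open>i \<in> I\<close>]] by simp
    also have "\<dots> = (\<Sum>b\<in>B. scal (?r (P i) b) (\<phi> b))"
      using \<phi>(1) by (simp add: linop_sum) (simp add: linop_def)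
    finally show "lookup (\<phi> (P i)) (e i) = (\<Sum>b\<in>B. lookup (\<phi> b) (e i) * ?r (P i) b)"
      by (simp add: Poly_Mapping.lookup_sum lookup_scal mult.commute)
  qed
  also have "\<dots> = (\<Sum>b\<in>B. \<Sum>i\<in>I. lookup (\<phi> b) (e i) * ?r (P i) b)"
    by (rule sum.swap)
  also have "\<dots> = (\<Sum>b\<in>B. ?r (\<phi> b) b)"
  proof (intro sum.cong refl)
    fix b assume "b \<in> B"
    have "?r (\<phi> b) = ?r (\<Sum>i\<in>I. scal (lookup (\<phi> b) (e i)) (P i))"
      using I(2)[OF \<phi>(2)[OF BW[OF \<open>b \<in> B\<close>]]] by simp
    also have "\<dots> = (\<lambda>v. \<Sum>i\<in>I. ?r (scal (lookup (\<phi> b) (e i)) (P i)) v)"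
      using P B free_vs.subspace_scale[OF W] by (intro free_vs.representation_sum) auto
    also have "\<dots> = (\<lambda>v. \<Sum>i\<in>I. lookup (\<phi> b) (e i) * ?r (P i) v)"
      using P B by (intro ext sum.cong refl) (simp add: free_vs.representation_scale)
    finally show "(\<Sum>i\<in>I. lookup (\<phi> b) (e i) * ?r (P i) b) = ?r (\<phi> b) b" by simp
  qed
  finally show ?thesis by (simp add: trace_on_def B_def Let_def)
qed

lemma trace_commute:
  assumes "finite K" "\<And>u. u \<in> K \<Longrightarrow> keys (A u) \<subseteq> K" "\<And>u. u \<in> K \<Longrightarrow> keys (B u) \<subseteq> K"
  shows "(\<Sum>u\<in>K. lookup (lin_ext A (B u)) u) = (\<Sum>u\<in>K. lookup (lin_ext B (A u)) u)"
proof -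
  have 1: "lookup (lin_ext A (B u)) u = (\<Sum>v\<in>K. lookup (B u) v * lookup (A v) u)"
    if "u \<in> K" for u
    using lin_ext_superset[OF assms(1) assms(3)[OF that], of A] by (simp add: Poly_Mapping.lookup_sum lookup_scal)
  have 2: "lookup (lin_ext B (A v)) v = (\<Sum>u\<in>K. lookup (B u) v * lookup (A v) u)"
    if "v \<in> K" for v
    using lin_ext_superset[OF assms(1) assms(2)[OF that], of B] by (simp add: Poly_Mapping.lookup_sum lookup_scal mult.commute)
  have "(\<Sum>u\<in>K. lookup (lin_ext A (B u)) u) =
      (\<Sum>u\<in>K. \<Sum>v\<in>K. lookup (B u) v * lookup (A v) u)"
    by (intro sum.cong refl 1)
  also have "\<dots> = (\<Sum>v\<in>K. \<Sum>u\<in>K. lookup (B u) v * lookup (A v) u)"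
    by (rule sum.swap)
  also have "\<dots> = (\<Sum>u\<in>K. lookup (lin_ext B (A u)) u)"
    by (intro sum.cong refl 2[symmetric])
  finally show ?thesis .
qed

section \<open>The matrix action on tensors\<close>

lemma act_tensor_mult: "act_tensor g (p * q) = act_tensor g p * act_tensor g q"
  unfolding act_tensor_def by (rule lin_ext_mult_hom) (simp add: plus_list_def)

lemma linop_act_tensor: "linop (act_tensor g)"
  unfolding act_tensor_def by (rule linop_lin_ext)

lemma act_tensor_Nil: "act_tensor g (tens []) = tens []"
  by (simp add: act_tensor_def one_eq_tens)

lemma act_tensor_Cons: "act_tensor g (tens (x # v)) = act_vec g x * act_tensor g (tens v)"
  by (simp add: act_tensor_def)

lemma act_tensor_letter: "act_tensor g (tens [x]) = act_vec g x"
  by (simp add: act_tensor_def)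

lemma act_vec_eq: "act_vec g j = (\<Sum>i<dim_row g. scal (g $$ (i, j)) (tens [i]))"
  by (simp add: act_vec_def scal_single)

lemma keys_act_vec: "u \<in> keys (act_vec g j) \<Longrightarrow> \<exists>i<dim_row g. u = [i]"
  unfolding act_vec_def using Poly_Mapping.keys_sum[of "\<lambda>i. single [i] (g $$ (i, j))" "{..<dim_row g}"]
  by (fastforce split: if_splits)

lemma keys_act_tensor_tens:
  "u \<in> keys (act_tensor g (tens v)) \<Longrightarrow> length u = length v \<and> set u \<subseteq> {..<dim_row g}"
proof (induction v arbitrary: u)
  case Nil
  then show ?case by (simp add: act_tensor_Nil)
next
  case (Cons x v)
  then obtain a b where ab: "u = a @ b" "a \<in> keys (act_vec g x)" "b \<in> keys (act_tensor g (tens v))"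
    unfolding act_tensor_Cons using keys_mult[of "act_vec g x" "act_tensor g (tens v)"]
    by (auto simp: plus_list_def)
  obtain i where "a = [i]" "i < dim_row g" using keys_act_vec[OF ab(2)] by auto
  then show ?case using Cons.IH[OF ab(3)] ab(1) by auto
qed

lemma act_tensor_expand: "act_tensor g p = lin_ext (\<lambda>v. act_tensor g (tens v)) p"
  by (simp add: act_tensor_def)

lemma act_tensor_tensor_power: "p \<in> tensor_power N m \<Longrightarrow> act_tensor g p \<in> tensor_power (dim_row g) m"
  unfolding act_tensor_expand[of g p] tensor_power_def
  using keys_lin_ext[of "\<lambda>v. act_tensor g (tens v)" p] keys_act_tensor_tens by fastforce

lemma act_vec_mult:
  assumes "A \<in> carrier_mat N N" "B \<in> carrier_mat N N" "j < N"
  shows "act_tensor A (act_vec B j) = act_vec (A * B) j"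
proof -
  have "act_tensor A (act_vec B j) = (\<Sum>i<N. scal (B $$ (i, j)) (act_vec A i))"
    using assms(2) linop_act_tensor[of A]
    by (simp add: act_vec_eq[of B] linop_sum[OF linop_act_tensor]) (simp add: linop_def act_tensor_letter)
  also have "\<dots> = (\<Sum>i<N. \<Sum>l<N. scal (A $$ (l, i) * B $$ (i, j)) (tens [l]))"
    using assms(1) by (simp add: act_vec_eq[of A] free_vs.scale_sum_right mult.commute)
  also have "\<dots> = (\<Sum>l<N. \<Sum>i<N. scal (A $$ (l, i) * B $$ (i, j)) (tens [l]))"
    by (rule sum.swap)
  also have "\<dots> = act_vec (A * B) j"
    using assms by (simp add: act_vec_eq[of "A * B"] free_vs.scale_sum_left[symmetric] scalar_prod_def atLeast0LessThan)
  finally show ?thesis .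
qed

text \<open>Letters stay below \<open>N\<close> because \<open>act_vec\<close> reads the column with
  that index, and entries outside the matrix are unspecified.\<close>

lemma act_tensor_comp_tens:
  assumes "A \<in> carrier_mat N N" "B \<in> carrier_mat N N"
  shows "set v \<subseteq> {..<N} \<Longrightarrow> act_tensor A (act_tensor B (tens v)) = act_tensor (A * B) (tens v)"
  by (induction v) (simp_all add: act_tensor_Nil act_tensor_Cons act_tensor_mult act_vec_mult[OF assms])

lemma act_tensor_comp:
  assumes "A \<in> carrier_mat N N" "B \<in> carrier_mat N N" "p \<in> tensor_power N m"
  shows "act_tensor A (act_tensor B p) = act_tensor (A * B) p"
proof (rule linop_eqI[of "\<lambda>p. act_tensor A (act_tensor B p)"])
  show "linop (\<lambda>p. act_tensor A (act_tensor B p))" by (rule linop_comp[OF linop_act_tensor linop_act_tensor])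
  show "linop (act_tensor (A * B))" by (rule linop_act_tensor)
  show "act_tensor A (act_tensor B (tens v)) = act_tensor (A * B) (tens v)"
    if "v \<in> keys p" for v
    using that assms(3) by (intro act_tensor_comp_tens[OF assms(1,2)]) (auto simp: tensor_power_def)
qed

lemma act_tensor_one:
  assumes "p \<in> tensor_power N m"
  shows "act_tensor (1\<^sub>m N) p = p"
proof -
  have "act_vec (1\<^sub>m N) j = tens [j]" if "j < N" for j
  proof -
    have "act_vec (1\<^sub>m N) j = (\<Sum>i<N. if i = j then tens [i] else 0)"
      unfolding act_vec_def using that by (intro sum.cong) auto
    then show ?thesis using that by simp
  qed
  then have "act_tensor (1\<^sub>m N) (tens v) = tens v" if "set v \<subseteq> {..<N}" for v
    using that by (induction v) (simp_all add: act_tensor_Nil act_tensor_Cons tens_mult)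
  then show ?thesis
    unfolding act_tensor_expand[of _ p] using assms by (intro lin_ext_eq_id) (auto simp: tensor_power_def)
qed

lemma act_tensor_free_lie: "p \<in> free_lie N \<Longrightarrow> dim_row g = N \<Longrightarrow> act_tensor g p \<in> free_lie N"
proof (induction rule: free_lie.induct)
  case (generator v)
  then show ?case using act_tensor_tensor_power free_lie.generator by blast
next
  case (add p q)
  then show ?case using linop_act_tensor[of g] by (simp add: linop_def free_lie.add)
next
  case (scale p c)
  then show ?case using linop_act_tensor[of g] by (simp add: linop_def free_lie.scale)
next
  case (bracket p q)
  have "act_tensor g (p * q - q * p) = act_tensor g p * act_tensor g q - act_tensor g q * act_tensor g p"
    by (simp add: act_tensor_mult[symmetric]) (simp add: act_tensor_def lin_ext_diff)
  then show ?case using bracket by (simp add: free_lie.bracket)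
qed

lemma act_tensor_lie_part: "p \<in> lie_part N m \<Longrightarrow> dim_row g = N \<Longrightarrow> act_tensor g p \<in> lie_part N m"
  using act_tensor_free_lie act_tensor_tensor_power by (auto simp: lie_part_def)

lemma rotate1_act_vec: "lin_ext (\<lambda>u. tens (rotate1 u)) (act_vec g x * p) = p * act_vec g x"
proof (rule linop_eqI[of "\<lambda>p. lin_ext (\<lambda>u. tens (rotate1 u)) (act_vec g x * p)"])
  show "linop (\<lambda>p. lin_ext (\<lambda>u. tens (rotate1 u)) (act_vec g x * p))"
    by (rule linop_comp[OF linop_lin_ext linop_mult_left])
  show "linop (\<lambda>p. p * act_vec g x)" by (rule linop_mult_right)
  fix v
  show "lin_ext (\<lambda>u. tens (rotate1 u)) (act_vec g x * tens v) = tens v * act_vec g x"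
    by (simp add: act_vec_eq sum_distrib_left sum_distrib_right lin_ext_sum scal_mult_left scal_mult_right
        lin_ext_scal tens_mult)
qed

lemma act_tensor_rotate:
  "act_tensor g (tens (rotate j v)) = lin_ext (\<lambda>u. tens (rotate j u)) (act_tensor g (tens v))"
proof (induction j)
  case 0
  then show ?case by (simp add: lin_ext_id)
next
  case (Suc j)
  have 1: "act_tensor g (tens (rotate1 v)) = lin_ext (\<lambda>u. tens (rotate1 u)) (act_tensor g (tens v))" for v
  proof (cases v)
    case (Cons x v')
    have "act_tensor g (tens (v' @ [x])) = act_tensor g (tens v') * act_vec g x"
      by (simp add: tens_mult[symmetric] act_tensor_mult act_tensor_letter)
    then show ?thesis using Cons by (simp add: act_tensor_Cons rotate1_act_vec)
  qed (simp add: act_tensor_Nil)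
  show ?case by (simp add: 1 Suc lin_ext_lin_ext)
qed

lemma (in cyclic_root) act_tensor_zeta: "act_tensor g (lin_ext zeta p) = lin_ext zeta (act_tensor g p)"
proof (rule linop_eqI[of "\<lambda>p. act_tensor g (lin_ext zeta p)"])
  show "linop (\<lambda>p. act_tensor g (lin_ext zeta p))" by (rule linop_comp[OF linop_act_tensor linop_lin_ext])
  show "linop (\<lambda>p. lin_ext zeta (act_tensor g p))" by (rule linop_comp[OF linop_lin_ext linop_act_tensor])
  fix v
  have z: "lin_ext zeta q = scal (1 / of_nat m) (\<Sum>j<m. scal (w ^ j) (lin_ext (\<lambda>u. tens (rotate j u)) q))" for q
    unfolding zeta_def[abs_def] lin_ext_def
    by (simp add: free_vs.scale_sum_right free_vs.scale_left_commute[of "lookup q _"])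
      (simp add: sum.swap[of _ "keys q"] mult_ac)
  show "act_tensor g (lin_ext zeta (tens v)) = lin_ext zeta (act_tensor g (tens v))"
    unfolding z[of "act_tensor g (tens v)"] act_tensor_rotate[symmetric] using linop_act_tensor[of g]
    by (simp add: zeta_def linop_sum) (simp add: linop_def linop_sum[OF linop_act_tensor])
qed

section \<open>Traces on tensors by triangularization\<close>

text \<open>A triangular matrix replaces letters by smaller ones, apart from the diagonal term.
  Words are measured by their letter sum because all rotations of a word share it: matrix entries
  between different rotations then vanish, and these are the entries that enter the trace with
  \<open>zeta\<close>.\<close>

lemma act_tensor_triangular:
  assumes "upper_triangular B" "B \<in> carrier_mat N N"
  shows "set v \<subseteq> {..<N} \<Longrightarrow> \<exists>q. act_tensor B (tens v) = scal (\<Prod>a\<leftarrow>v. B $$ (a, a)) (tens v) + q \<and>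
    (\<forall>u\<in>keys q. sum_list u < sum_list v)"
proof (induction v)
  case Nil
  then show ?case by (intro exI[of _ 0]) (simp add: act_tensor_Nil)
next
  case (Cons x v)
  then obtain q where q: "act_tensor B (tens v) = scal (\<Prod>a\<leftarrow>v. B $$ (a, a)) (tens v) + q"
    "\<forall>u\<in>keys q. sum_list u < sum_list v" by auto
  let ?c = "\<Prod>a\<leftarrow>v. B $$ (a, a)"
  define r where "r = (\<Sum>i<x. scal (B $$ (i, x)) (tens [i]))"
  have x: "x < N" using Cons by simp
  have "act_vec B x = (\<Sum>i<N. scal (B $$ (i, x)) (tens [i]))"
    using assms(2) by (simp add: act_vec_eq)
  also have "\<dots> = r + scal (B $$ (x, x)) (tens [x]) + (\<Sum>i\<in>{x<..<N}. scal (B $$ (i, x)) (tens [i]))"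
    unfolding r_def by (rule sum_split_lt[OF x])
  also have "(\<Sum>i\<in>{x<..<N}. scal (B $$ (i, x)) (tens [i])) = 0"
    using assms by (intro sum.neutral) (auto simp: upper_triangular_def)
  finally have a: "act_vec B x = scal (B $$ (x, x)) (tens [x]) + r" by simp
  have r: "sum_list u < x" if "u \<in> keys r" for u
  proof -
    from that obtain i where "i < x" "u \<in> keys (scal (B $$ (i, x)) (tens [i]))"
      unfolding r_def using Poly_Mapping.keys_sum[of "\<lambda>i. scal (B $$ (i, x)) (tens [i])" "{..<x}"] by auto
    then have "u = [i]" using keys_scal[of "B $$ (i, x)" "tens [i]"] by auto
    then show ?thesis using \<open>i < x\<close> by simp
  qed
  define q' where "q' = scal (B $$ (x, x)) (tens [x] * q) + r * act_tensor B (tens v)"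
  have "act_tensor B (tens (x # v)) = scal (\<Prod>a\<leftarrow>x # v. B $$ (a, a)) (tens (x # v)) + q'"
    unfolding act_tensor_Cons a q'_def distrib_right
    by (subst q(1)) (simp add: distrib_left scal_mult_left scal_mult_right free_vs.scale_right_distrib tens_mult)
  moreover have "sum_list u < x + sum_list v" if "u \<in> keys q'" for u
  proof -
    have "u \<in> keys (tens [x] * q) \<or> u \<in> keys (r * act_tensor B (tens v))"
      using that keys_scal[of "B $$ (x, x)" "tens [x] * q"]
        Poly_Mapping.keys_add[of "scal (B $$ (x, x)) (tens [x] * q)" "r * act_tensor B (tens v)"]
      unfolding q'_def by auto
    then show ?thesis
    proof
      assume "u \<in> keys (tens [x] * q)"
      then obtain b where "u = x # b" "b \<in> keys q"
        using keys_mult[of "tens [x]" q] by (auto simp: plus_list_def)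
      then show ?thesis using q(2) by simp
    next
      assume "u \<in> keys (r * act_tensor B (tens v))"
      then obtain b b' where b: "u = b @ b'" "b \<in> keys r" "b' \<in> keys (act_tensor B (tens v))"
        using keys_mult[of r "act_tensor B (tens v)"] by (auto simp: plus_list_def)
      have "b' \<in> keys (scal ?c (tens v)) \<or> b' \<in> keys q"
        using b(3) Poly_Mapping.keys_add[of "scal ?c (tens v)" q] unfolding q(1) by auto
      then have "sum_list b' \<le> sum_list v"
        using keys_scal[of ?c "tens v"] q(2) by (auto intro: less_imp_le)
      then show ?thesis using b(1) r[OF b(2)] by simp
    qed
  qed
  ultimately show ?case by (intro exI[of _ q']) simp
qed

lemma lookup_act_tensor_triangular:
  assumes "upper_triangular B" "B \<in> carrier_mat N N" "set v \<subseteq> {..<N}" "sum_list u = sum_list v"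
  shows "lookup (act_tensor B (tens v)) u = (if u = v then \<Prod>a\<leftarrow>v. B $$ (a, a) else 0)"
proof -
  obtain q where q: "act_tensor B (tens v) = scal (\<Prod>a\<leftarrow>v. B $$ (a, a)) (tens v) + q"
    "\<forall>u\<in>keys q. sum_list u < sum_list v"
    using act_tensor_triangular[OF assms(1-3)] by auto
  have "lookup q u = 0" using q(2) assms(4) by (metis in_keys_iff less_irrefl)
  then show ?thesis using q(1) by (auto simp: Poly_Mapping.lookup_add lookup_scal lookup_single when_def)
qed

context cyclic_root
begin

text \<open>By \<open>sum_rotation_fixed_words\<close> the inner sum is a power of a power sum, so
  this is the classical necklace formula for the character of the free Lie algebra, before equal
  orders of \<open>w ^ j\<close> are collected into Moebius values.\<close>

definition lie_char :: "nat \<Rightarrow> (nat \<Rightarrow> complex) \<Rightarrow> complex" where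
  "lie_char N x = 1 / of_nat m * (\<Sum>j<m. w ^ j * (\<Sum>v | v \<in> words N m \<and> rotate j v = v. prod_list (map x v)))"

lemma trace_zeta_triangular:
  assumes "upper_triangular B" "B \<in> carrier_mat N N"
  shows "(\<Sum>u\<in>words N m. lookup (act_tensor B (zeta u)) u) = lie_char N (\<lambda>a. B $$ (a, a))"
proof -
  have "lookup (act_tensor B (zeta u)) u =
      1 / of_nat m * (\<Sum>j<m. w ^ j * (if rotate j u = u then prod_list (map (\<lambda>a. B $$ (a, a)) u) else 0))"
    if "u \<in> words N m" for u
  proof -
    have "act_tensor B (zeta u) = scal (1 / of_nat m) (\<Sum>j<m. scal (w ^ j) (act_tensor B (tens (rotate j u))))"
      unfolding zeta_def act_tensor_def by (simp only: lin_ext_scal lin_ext_sum)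
    moreover have "lookup (act_tensor B (tens (rotate j u))) u =
       (if rotate j u = u then prod_list (map (\<lambda>a. B $$ (a, a)) u) else 0)" for j
    proof -
      have "sum_list u = sum_list (rotate j u)" by (metis mset_rotate sum_mset_sum_list)
      then show ?thesis
        using lookup_act_tensor_triangular[OF assms, of "rotate j u" u] that by (auto simp: words_def)
    qed
    ultimately show ?thesis by (simp add: lookup_scal Poly_Mapping.lookup_sum)
  qed
  then have "(\<Sum>u\<in>words N m. lookup (act_tensor B (zeta u)) u) =
    1 / of_nat m * (\<Sum>u\<in>words N m. \<Sum>j<m. w ^ j * (if rotate j u = u then prod_list (map (\<lambda>a. B $$ (a, a)) u) else 0))"
    by (simp add: sum_distrib_left)
  also have "(\<Sum>u\<in>words N m. \<Sum>j<m. w ^ j * (if rotate j u = u then prod_list (map (\<lambda>a. B $$ (a, a)) u) else 0)) =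
    (\<Sum>j<m. \<Sum>u\<in>words N m. w ^ j * (if rotate j u = u then prod_list (map (\<lambda>a. B $$ (a, a)) u) else 0))"
    by (rule sum.swap)
  also have "\<dots> = (\<Sum>j<m. w ^ j * (\<Sum>v | v \<in> words N m \<and> rotate j v = v. prod_list (map (\<lambda>a. B $$ (a, a)) v)))"
    unfolding sum_distrib_left
    by (intro sum.cong refl sum.mono_neutral_cong_right) auto
  finally show ?thesis by (simp add: lie_char_def)
qed

lemma tens_tensor_power: "u \<in> words N m \<Longrightarrow> tens u \<in> tensor_power N m"
  by (simp add: tensor_power_def words_def)

lemma keys_tensor_power: "p \<in> tensor_power N m \<Longrightarrow> keys p \<subseteq> words N m"
  by (auto simp: tensor_power_def words_def)

lemma zeta_tensor_power: "u \<in> words N m \<Longrightarrow> zeta u \<in> tensor_power N m"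
  by (rule tensor_power_msupp[OF msupp_zeta]) (auto simp: words_def)

text \<open>Schur decomposition \<open>g = P * B * Q\<close>: cyclicity brings \<open>P\<close> to
  the other end, where it meets \<open>Q\<close> and cancels, since matrices commute with
  \<open>zeta\<close>. Only the diagonal of \<open>B\<close>, the list of eigenvalues,
  remains.\<close>

lemma trace_zeta:
  assumes g: "g \<in> carrier_mat N N" and xs: "char_poly g = (\<Prod>x\<leftarrow>xs. [:- x, 1:])"
  shows "(\<Sum>u\<in>words N m. lookup (act_tensor g (zeta u)) u) = lie_char N ((!) xs)"
proof -
  obtain B P Q where "schur_decomposition g xs = (B, P, Q)" by (cases "schur_decomposition g xs")
  from schur_decomposition[OF g xs this]
  have s: "similar_mat_wit g B P Q" "upper_triangular B" "diag_mat B = xs" by auto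
  from similar_mat_witD2[OF g s(1)]
  have c: "B \<in> carrier_mat N N" "P \<in> carrier_mat N N" "Q \<in> carrier_mat N N" "Q * P = 1\<^sub>m N" "g = P * B * Q"
    by auto
  have tp: "act_tensor A p \<in> tensor_power N m" if "p \<in> tensor_power N m" "A \<in> carrier_mat N N" for A p
    using act_tensor_tensor_power[OF that(1), of A] that(2) by auto
  have "act_tensor g (zeta u) = lin_ext (\<lambda>u. act_tensor P (tens u)) (act_tensor B (act_tensor Q (zeta u)))"
    if "u \<in> words N m" for u
  proof -
    have z: "zeta u \<in> tensor_power N m" by (rule zeta_tensor_power[OF that])
    have "act_tensor g (zeta u) = act_tensor (P * B) (act_tensor Q (zeta u))"
      unfolding c(5) using c by (intro act_tensor_comp[OF _ _ z, symmetric]) auto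
    also have "\<dots> = act_tensor P (act_tensor B (act_tensor Q (zeta u)))"
      using c by (intro act_tensor_comp[OF _ _ tp[OF z], symmetric]) auto
    finally show ?thesis by (simp add: act_tensor_expand[symmetric])
  qed
  then have "(\<Sum>u\<in>words N m. lookup (act_tensor g (zeta u)) u) =
    (\<Sum>u\<in>words N m. lookup (lin_ext (\<lambda>u. act_tensor P (tens u)) (act_tensor B (act_tensor Q (zeta u)))) u)"
    by simp
  also have "\<dots> = (\<Sum>u\<in>words N m. lookup (lin_ext (\<lambda>u. act_tensor B (act_tensor Q (zeta u))) (act_tensor P (tens u))) u)"
    using c tp tens_tensor_power zeta_tensor_power by (intro trace_commute keys_tensor_power) auto
  also have "\<dots> = (\<Sum>u\<in>words N m. lookup (act_tensor B (zeta u)) u)"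
  proof (intro sum.cong refl)
    fix u assume u: "u \<in> words N m"
    have "lin_ext (\<lambda>u. act_tensor B (act_tensor Q (zeta u))) (act_tensor P (tens u)) =
        act_tensor B (act_tensor Q (lin_ext zeta (act_tensor P (tens u))))"
      using linop_lin_ext_commute[OF linop_comp[OF linop_act_tensor linop_act_tensor]] by metis
    also have "\<dots> = act_tensor B (act_tensor Q (act_tensor P (zeta u)))"
      by (simp add: act_tensor_zeta[symmetric])
    also have "act_tensor Q (act_tensor P (zeta u)) = zeta u"
      using act_tensor_comp[OF c(3,2) zeta_tensor_power[OF u]] act_tensor_one[OF zeta_tensor_power[OF u]] c(4) by simp
    finally show "lookup (lin_ext (\<lambda>u. act_tensor B (act_tensor Q (zeta u))) (act_tensor P (tens u))) u =
      lookup (act_tensor B (zeta u)) u" by simp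
  qed
  also have "\<dots> = lie_char N (\<lambda>a. B $$ (a, a))" by (rule trace_zeta_triangular[OF s(2) c(1)])
  also have "\<dots> = lie_char N ((!) xs)"
  proof -
    have "B $$ (a, a) = xs ! a" if "a < N" for a
      using s(3) that c(1) by (auto simp: diag_mat_def)
    then have "prod_list (map (\<lambda>a. B $$ (a, a)) v) = prod_list (map ((!) xs) v)" if "v \<in> words N m" for v
      using that by (intro arg_cong[of _ _ prod_list] map_cong) (auto simp: words_def)
    then show ?thesis by (simp add: lie_char_def)
  qed
  finally show ?thesis .
qed

lemma trace_proj:
  assumes g: "g \<in> carrier_mat N N" and xs: "char_poly g = (\<Prod>x\<leftarrow>xs. [:- x, 1:])"
  shows "(\<Sum>u\<in>words N m. lookup (act_tensor g (proj u)) u) = lie_char N ((!) xs)"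
proof -
  let ?A = "\<lambda>u. act_tensor g (lin_ext brk (lift u))"
  have A: "keys (?A u) \<subseteq> words N m" if "u \<in> words N m" for u
  proof -
    have "msupp (mset u) (lin_ext brk (lift u))"
    proof (rule msupp_lin_ext[OF msupp_lift])
      show "length u = m" using that by (simp add: words_def)
      show "msupp (mset u) (brk v)" if "mset v = mset u" for v using msupp_brk[of v] that by simp
    qed
    then have "lin_ext brk (lift u) \<in> tensor_power N m"
      using that by (intro tensor_power_msupp[of "mset u"]) (auto simp: words_def)
    then show ?thesis using keys_tensor_power act_tensor_tensor_power[of _ N m g] g by auto
  qed
  have "act_tensor g (proj u) = lin_ext ?A (zeta u)" for u
    using linop_lin_ext_commute[OF linop_comp[OF linop_act_tensor linop_lin_ext], of g brk lift "zeta u"]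
    by (simp add: proj_def)
  then have "(\<Sum>u\<in>words N m. lookup (act_tensor g (proj u)) u) =
      (\<Sum>u\<in>words N m. lookup (lin_ext ?A (zeta u)) u)" by simp
  \<comment> \<open>Once in front, \<open>zeta\<close> can be moved past \<open>g\<close> to the
    bracketing, where \<open>zeta_brk_lift\<close> applies.\<close>
  also have "\<dots> = (\<Sum>u\<in>words N m. lookup (lin_ext zeta (?A u)) u)"
    using A zeta_tensor_power keys_tensor_power by (intro trace_commute) auto
  also have "\<dots> = (\<Sum>u\<in>words N m. lookup (act_tensor g (zeta u)) u)"
    by (intro sum.cong refl) (simp add: act_tensor_zeta[symmetric] zeta_brk_lift words_def)
  also have "\<dots> = lie_char N ((!) xs)" by (rule trace_zeta[OF assms])
  finally show ?thesis .
qed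

end

section \<open>Symmetric powers of V\<close>

text \<open>Generators of the symmetric algebra are words, so a monomial in the basis vectors of V
  is a multiset of one-letter words.\<close>

abbreviation letters :: "nat multiset \<Rightarrow> nat list multiset" where
  "letters M \<equiv> image_mset (\<lambda>a. [a]) M"

abbreviation sym_monom :: "nat multiset \<Rightarrow> sym_tensor_alg" where
  "sym_monom M \<equiv> single (letters M) 1"

definition msets :: "nat \<Rightarrow> nat \<Rightarrow> nat multiset set" where
  "msets N k = {M. size M = k \<and> set_mset M \<subseteq> {..<N}}"

lemma finite_msets [simp]: "finite (msets N k)"
proof (rule finite_subset)
  show "msets N k \<subseteq> mset ` words N k"
  proof
    fix M assume M: "M \<in> msets N k"
    obtain v where "mset v = M" using ex_mset by blast
    then show "M \<in> mset ` words N k" using M by (auto simp: msets_def words_def)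
  qed
qed simp

lemma letters_inj: "letters M = letters M' \<Longrightarrow> M = M'"
proof -
  have "image_mset hd (letters X) = X" for X by (induction X) auto
  then show "letters M = letters M' \<Longrightarrow> M = M'" by metis
qed

lemma sym_monom_add: "sym_monom (A + B) = sym_monom A * sym_monom B"
  by (simp add: mult_single)

lemma sym_incl_mult_monom:
  "sym_incl p * q = lin_ext (\<lambda>u. lin_ext (\<lambda>\<kappa>. single (add_mset u \<kappa>) 1) q) p"
proof (rule linop_eqI[of "\<lambda>p. sym_incl p * q"])
  show "linop (\<lambda>p. sym_incl p * q)"
    unfolding sym_incl_def by (rule linop_comp[OF linop_mult_right linop_lin_ext])
  show "linop (lin_ext (\<lambda>u. lin_ext (\<lambda>\<kappa>. single (add_mset u \<kappa>) (1 :: complex)) q))"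
    by (rule linop_lin_ext)
  fix u
  have "single {#u#} 1 * q = lin_ext (\<lambda>\<kappa>. single (add_mset u \<kappa>) 1) q"
  proof (rule linop_eqI[of "\<lambda>q. single {#u#} 1 * q"])
    show "linop (\<lambda>q. single {#u#} (1 :: complex) * q)" by (rule linop_mult_left)
  qed (simp_all add: linop_lin_ext mult_single)
  then show "sym_incl (tens u) * q =
      lin_ext (\<lambda>u. lin_ext (\<lambda>\<kappa>. single (add_mset u \<kappa>) 1) q) (tens u)"
    by (simp add: sym_incl_def)
qed

lemma add_mset_letters_eq_iff:
  assumes "length u \<noteq> 1" "length u' \<noteq> 1"
  shows "add_mset u (letters M) = add_mset u' (letters M') \<longleftrightarrow> u = u' \<and> M = M'"
proof
  assume e: "add_mset u (letters M) = add_mset u' (letters M')"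
  have f: "filter_mset (\<lambda>v. length v \<noteq> 1) (add_mset v (letters X)) = {#v#}" if "length v \<noteq> 1" for v X
    using that by (induction X) auto
  then have "{#u#} = {#u'#}" using e assms by metis
  then have "u = u'" by simp
  then show "u = u' \<and> M = M'" using e letters_inj by simp
qed simp

text \<open>Because \<open>m \<noteq> 1\<close>, the factor coming from \<open>p\<close> can be told
  apart from the letters by its length. Each monomial of the product arises from one pair of
  monomials only, and coefficients multiply.\<close>

lemma lookup_sym_incl_mult:
  assumes p: "p \<in> tensor_power N m" and q: "keys q \<subseteq> letters ` S"
    and u: "length u = m" and m: "m \<noteq> 1"
  shows "lookup (sym_incl p * q) (add_mset u (letters M)) =
    lookup p u * lookup q (letters M)"
proof -
  have iff: "add_mset u' \<kappa> = add_mset u (letters M) \<longleftrightarrow> u' = u \<and> \<kappa> = letters M"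
    if k: "u' \<in> keys p" "\<kappa> \<in> keys q" for u' \<kappa>
  proof -
    obtain M' where M': "\<kappa> = letters M'" using q k(2) by blast
    have "length u' = m" using p k(1) by (simp add: tensor_power_def)
    then show ?thesis unfolding M' using add_mset_letters_eq_iff[of u' u M' M] u m letters_inj by auto
  qed
  have "lookup (sym_incl p * q) (add_mset u (letters M)) =
    (\<Sum>u'\<in>keys p. \<Sum>\<kappa>\<in>keys q.
      lookup p u' * (lookup q \<kappa> * (1 when add_mset u' \<kappa> = add_mset u (letters M))))"
    unfolding sym_incl_mult_monom lin_ext_def
    by (simp add: Poly_Mapping.lookup_sum lookup_scal lookup_single sum_distrib_left)
  also have "\<dots> = (\<Sum>u'\<in>keys p. \<Sum>\<kappa>\<in>keys q.
      (lookup p u' when u' = u) * (lookup q \<kappa> when \<kappa> = letters M))"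
    by (intro sum.cong refl) (auto simp: iff when_def)
  also have "\<dots> = (\<Sum>u'\<in>keys p. lookup p u' when u' = u) *
      (\<Sum>\<kappa>\<in>keys q. lookup q \<kappa> when \<kappa> = letters M)"
    by (simp add: sum_product)
  also have "\<dots> = lookup p u * lookup q (letters M)"
    by (simp add: when_def in_keys_iff)
  finally show ?thesis .
qed

lemma act_sym_mult: "act_sym g (p * q) = act_sym g p * act_sym g q"
  unfolding act_sym_def by (rule lin_ext_mult_hom) simp

lemma linop_act_sym: "linop (act_sym g)"
  unfolding act_sym_def by (rule linop_lin_ext)

lemma linop_sym_incl: "linop sym_incl"
  unfolding sym_incl_def by (rule linop_lin_ext)

lemma act_sym_incl: "act_sym g (sym_incl p) = sym_incl (act_tensor g p)"
proof (rule linop_eqI[of "\<lambda>p. act_sym g (sym_incl p)"])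
  show "linop (\<lambda>p. act_sym g (sym_incl p))" by (rule linop_comp[OF linop_act_sym linop_sym_incl])
  show "linop (\<lambda>p. sym_incl (act_tensor g p))" by (rule linop_comp[OF linop_sym_incl linop_act_tensor])
  fix u
  show "act_sym g (sym_incl (tens u)) = sym_incl (act_tensor g (tens u))"
    by (simp add: act_sym_def sym_incl_def)
qed

lemma sym_incl_letter: "sym_incl (tens [a]) = sym_monom {#a#}"
  by (simp add: sym_incl_def)

lemma act_sym_empty: "act_sym g (sym_monom {#}) = sym_monom {#}"
  by (simp add: act_sym_def single_one[symmetric] del: single_one)

lemma sym_monom_add_mset: "sym_monom (add_mset a M) = sym_incl (tens [a]) * sym_monom M"
  by (simp add: sym_incl_letter mult_single)

lemma act_sym_add_mset: "act_sym g (sym_monom (add_mset a M)) = sym_incl (act_vec g a) * act_sym g (sym_monom M)"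
  by (simp only: sym_monom_add_mset act_sym_mult act_sym_incl act_tensor_letter)

lemma sym_incl_act_vec: "sym_incl (act_vec g a) = (\<Sum>i<dim_row g. scal (g $$ (i, a)) (sym_monom {#i#}))"
  unfolding act_vec_eq linop_sum[OF linop_sym_incl] using linop_sym_incl
  by (intro sum.cong refl) (simp add: linop_def sym_incl_letter)

lemma keys_act_sym_monom:
  "keys (act_sym g (sym_monom M)) \<subseteq> letters ` msets (dim_row g) (size M)"
proof (induction M)
  case empty
  then show ?case by (simp only: act_sym_empty) (auto simp: msets_def)
next
  case (add a M)
  have 1: "keys (sym_incl (act_vec g a)) \<subseteq> letters ` {{#i#} | i. i < dim_row g}"
  proof
    fix \<kappa> assume "\<kappa> \<in> keys (sym_incl (act_vec g a))"
    then obtain i where "i < dim_row g" "\<kappa> \<in> keys (scal (g $$ (i, a)) (sym_monom {#i#}))"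
      unfolding sym_incl_act_vec
      using Poly_Mapping.keys_sum[of "\<lambda>i. scal (g $$ (i, a)) (sym_monom {#i#})" "{..<dim_row g}"] by auto
    then have "\<kappa> = letters {#i#}" using keys_scal[of "g $$ (i, a)" "sym_monom {#i#}"] by auto
    then show "\<kappa> \<in> letters ` {{#i#} | i. i < dim_row g}" using \<open>i < dim_row g\<close> by blast
  qed
  show ?case
  proof
    fix \<kappa> assume "\<kappa> \<in> keys (act_sym g (sym_monom (add_mset a M)))"
    then obtain \<kappa>1 \<kappa>2 where k: "\<kappa> = \<kappa>1 + \<kappa>2" "\<kappa>1 \<in> keys (sym_incl (act_vec g a))"
        "\<kappa>2 \<in> keys (act_sym g (sym_monom M))"
      unfolding act_sym_add_mset using keys_mult[of "sym_incl (act_vec g a)" "act_sym g (sym_monom M)"] by blast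
    obtain i where i: "\<kappa>1 = letters {#i#}" "i < dim_row g" using 1 k(2) by auto
    obtain M' where M': "\<kappa>2 = letters M'" "M' \<in> msets (dim_row g) (size M)" using add k(3) by auto
    have "\<kappa> = letters (add_mset i M')" using k(1) i(1) M'(1) by simp
    moreover have "add_mset i M' \<in> msets (dim_row g) (size (add_mset a M))"
      using i(2) M'(2) by (simp add: msets_def)
    ultimately show "\<kappa> \<in> letters ` msets (dim_row g) (size (add_mset a M))" by blast
  qed
qed

lemma act_sym_monom_comp:
  assumes "A \<in> carrier_mat N N" "B \<in> carrier_mat N N"
  shows "set_mset M \<subseteq> {..<N} \<Longrightarrow> act_sym A (act_sym B (sym_monom M)) = act_sym (A * B) (sym_monom M)"
proof (induction M)
  case empty
  then show ?case by (simp only: act_sym_empty)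
next
  case (add a M)
  then show ?case
    using act_vec_mult[OF assms, of a] by (simp only: act_sym_add_mset act_sym_mult act_sym_incl) simp
qed

lemma act_sym_comp:
  assumes "A \<in> carrier_mat N N" "B \<in> carrier_mat N N" "keys q \<subseteq> letters ` msets N k"
  shows "act_sym A (act_sym B q) = act_sym (A * B) q"
proof (rule linop_eqI[of "\<lambda>p. act_sym A (act_sym B p)"])
  show "linop (\<lambda>p. act_sym A (act_sym B p))" by (rule linop_comp[OF linop_act_sym linop_act_sym])
  show "linop (act_sym (A * B))" by (rule linop_act_sym)
  fix \<kappa> assume "\<kappa> \<in> keys q"
  then obtain M where "\<kappa> = letters M" "M \<in> msets N k" using assms(3) by auto
  then show "act_sym A (act_sym B (single \<kappa> 1)) = act_sym (A * B) (single \<kappa> 1)"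
    using act_sym_monom_comp[OF assms(1,2), of M] by (simp add: msets_def)
qed

lemma act_sym_one: "set_mset M \<subseteq> {..<N} \<Longrightarrow> act_sym (1\<^sub>m N) (sym_monom M) = sym_monom M"
proof (induction M)
  case empty
  then show ?case by (simp only: act_sym_empty)
next
  case (add a M)
  have "act_vec (1\<^sub>m N) a = tens [a]"
    using act_tensor_one[of "tens [a]" N 1] add.prems by (simp add: tensor_power_def act_tensor_letter)
  moreover have "act_sym (1\<^sub>m N) (sym_monom M) = sym_monom M" using add by simp
  ultimately show ?case unfolding act_sym_add_mset by (simp only: sym_monom_add_mset)
qed

lemma act_sym_triangular:
  assumes "upper_triangular B" "B \<in> carrier_mat N N"
  shows "set_mset M \<subseteq> {..<N} \<Longrightarrow> \<exists>q. act_sym B (sym_monom M) = scal (\<Prod>a\<in>#M. B $$ (a, a)) (sym_monom M) + q \<and>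
    (\<forall>\<kappa>\<in>keys q. \<exists>M'. \<kappa> = letters M' \<and> \<Sum>\<^sub># M' < \<Sum>\<^sub># M)"
proof (induction M)
  case empty
  then show ?case by (intro exI[of _ 0]) (simp only: act_sym_empty, simp)
next
  case (add x M)
  let ?c = "\<Prod>a\<in>#M. B $$ (a, a)" and ?d = "B $$ (x, x)"
  from add obtain q where q: "act_sym B (sym_monom M) = scal ?c (sym_monom M) + q"
    "\<forall>\<kappa>\<in>keys q. \<exists>M'. \<kappa> = letters M' \<and> \<Sum>\<^sub># M' < \<Sum>\<^sub># M" by auto
  define r where "r = (\<Sum>i<x. scal (B $$ (i, x)) (sym_monom {#i#}))"
  have x: "x < N" using add.prems by simp
  have "sym_incl (act_vec B x) = (\<Sum>i<N. scal (B $$ (i, x)) (sym_monom {#i#}))"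
    using assms(2) by (simp only: sym_incl_act_vec) simp
  also have "\<dots> = r + scal ?d (sym_monom {#x#}) + (\<Sum>i\<in>{x<..<N}. scal (B $$ (i, x)) (sym_monom {#i#}))"
    unfolding r_def by (rule sum_split_lt[OF x])
  also have "(\<Sum>i\<in>{x<..<N}. scal (B $$ (i, x)) (sym_monom {#i#})) = 0"
    using assms by (intro sum.neutral) (auto simp: upper_triangular_def)
  finally have a: "sym_incl (act_vec B x) = scal ?d (sym_monom {#x#}) + r" by simp
  have r: "\<exists>i<x. \<kappa> = {#[i]#}" if "\<kappa> \<in> keys r" for \<kappa>
  proof -
    from that obtain i where "i < x" "\<kappa> \<in> keys (scal (B $$ (i, x)) (sym_monom {#i#}))"
      unfolding r_def using Poly_Mapping.keys_sum[of "\<lambda>i. scal (B $$ (i, x)) (sym_monom {#i#})" "{..<x}"] by auto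
    then show ?thesis using keys_scal[of "B $$ (i, x)" "sym_monom {#i#}"] by auto
  qed
  let ?t = "scal ?d (sym_monom {#x#} * q)" and ?s = "r * act_sym B (sym_monom M)"
  have "act_sym B (sym_monom (add_mset x M)) = scal (\<Prod>a\<in>#add_mset x M. B $$ (a, a)) (sym_monom (add_mset x M)) + (?t + ?s)"
    unfolding act_sym_add_mset a distrib_right
    by (subst q(1)) (simp add: distrib_left scal_mult_left scal_mult_right free_vs.scale_right_distrib mult_single)
  moreover have "\<exists>M'. \<kappa> = letters M' \<and> \<Sum>\<^sub># M' < \<Sum>\<^sub># (add_mset x M)" if "\<kappa> \<in> keys (?t + ?s)" for \<kappa>
  proof -
    have "\<kappa> \<in> keys (sym_monom {#x#} * q) \<or> \<kappa> \<in> keys ?s"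
      using that keys_scal[of ?d "sym_monom {#x#} * q"] Poly_Mapping.keys_add[of ?t ?s] by blast
    then show ?thesis
    proof
      assume "\<kappa> \<in> keys (sym_monom {#x#} * q)"
      then obtain b where b: "\<kappa> = {#[x]#} + b" "b \<in> keys q"
        using keys_mult[of "sym_monom {#x#}" q] by auto
      then obtain M' where "b = letters M'" "\<Sum>\<^sub># M' < \<Sum>\<^sub># M" using q(2) by blast
      then show ?thesis using b by (intro exI[of _ "add_mset x M'"]) simp
    next
      assume "\<kappa> \<in> keys ?s"
      then obtain b b' where b: "\<kappa> = b + b'" "b \<in> keys r" "b' \<in> keys (act_sym B (sym_monom M))"
        using keys_mult[of r "act_sym B (sym_monom M)"] by blast
      obtain i where i: "b = {#[i]#}" "i < x" using r[OF b(2)] by auto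
      have "b' \<in> keys (scal ?c (sym_monom M)) \<or> b' \<in> keys q"
        using b(3) Poly_Mapping.keys_add[of "scal ?c (sym_monom M)" q] unfolding q(1) by auto
      then have "\<exists>M'. b' = letters M' \<and> \<Sum>\<^sub># M' \<le> \<Sum>\<^sub># M"
      proof
        assume "b' \<in> keys (scal ?c (sym_monom M))"
        then have "b' = letters M" using keys_scal[of ?c "sym_monom M"] by auto
        then show ?thesis by blast
      next
        assume "b' \<in> keys q"
        then show ?thesis using q(2) less_imp_le by blast
      qed
      then obtain M' where "b' = letters M'" "\<Sum>\<^sub># M' \<le> \<Sum>\<^sub># M" by blast
      then show ?thesis using b(1) i by (intro exI[of _ "add_mset i M'"]) simp
    qed
  qed
  ultimately show ?case by (intro exI[of _ "?t + ?s"]) blast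
qed

lemma lookup_act_sym_triangular:
  assumes "upper_triangular B" "B \<in> carrier_mat N N" "set_mset M \<subseteq> {..<N}"
  shows "lookup (act_sym B (sym_monom M)) (letters M) = (\<Prod>a\<in>#M. B $$ (a, a))"
proof -
  obtain q where q: "act_sym B (sym_monom M) = scal (\<Prod>a\<in>#M. B $$ (a, a)) (sym_monom M) + q"
    "\<forall>\<kappa>\<in>keys q. \<exists>M'. \<kappa> = letters M' \<and> \<Sum>\<^sub># M' < \<Sum>\<^sub># M"
    using act_sym_triangular[OF assms] by auto
  have "lookup q (letters M) = 0" using q(2) letters_inj by (metis in_keys_iff less_irrefl)
  then show ?thesis using q(1) by (simp add: Poly_Mapping.lookup_add lookup_scal lookup_single)
qed

text \<open>The same triangularization argument on monomials instead of words. The value is the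
  complete homogeneous symmetric polynomial of degree \<open>k\<close> in the eigenvalues.\<close>

lemma trace_sym_power:
  assumes g: "g \<in> carrier_mat N N" and xs: "char_poly g = (\<Prod>x\<leftarrow>xs. [:- x, 1:])"
  shows "(\<Sum>M\<in>msets N k. lookup (act_sym g (sym_monom M)) (letters M)) =
    (\<Sum>M\<in>msets N k. \<Prod>a\<in>#M. xs ! a)"
proof -
  obtain B P Q where "schur_decomposition g xs = (B, P, Q)" by (cases "schur_decomposition g xs")
  from schur_decomposition[OF g xs this]
  have s: "similar_mat_wit g B P Q" "upper_triangular B" "diag_mat B = xs" by auto
  from similar_mat_witD2[OF g s(1)]
  have c: "B \<in> carrier_mat N N" "P \<in> carrier_mat N N" "Q \<in> carrier_mat N N" "Q * P = 1\<^sub>m N" "g = P * B * Q"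
    by auto
  let ?K = "letters ` msets N k" and ?e = "\<lambda>\<kappa>. single \<kappa> (1 :: complex)"
  have inj: "inj_on letters (msets N k)" using letters_inj by (auto simp: inj_on_def)
  have re: "(\<Sum>M\<in>msets N k. f (letters M)) = (\<Sum>\<kappa>\<in>?K. f \<kappa>)" for f :: "nat list multiset \<Rightarrow> complex"
    using inj by (simp add: sum.reindex)
  have ky: "keys (act_sym A q) \<subseteq> ?K"
    if "A \<in> carrier_mat N N" "keys q \<subseteq> ?K" for A q
  proof -
    have "act_sym A q = lin_ext (\<lambda>\<kappa>. act_sym A (?e \<kappa>)) q" by (simp add: act_sym_def)
    moreover have "keys (act_sym A (?e \<kappa>)) \<subseteq> ?K" if \<kappa>: "\<kappa> \<in> keys q" for \<kappa>
    proof -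
      obtain M where M: "\<kappa> = letters M" "M \<in> msets N k" using \<kappa> \<open>keys q \<subseteq> ?K\<close> by auto
      then show ?thesis using keys_act_sym_monom[of A M] \<open>A \<in> carrier_mat N N\<close> by (auto simp: msets_def)
    qed
    ultimately show ?thesis using keys_lin_ext[of "\<lambda>\<kappa>. act_sym A (?e \<kappa>)" q] by (metis (no_types, lifting) UN_least order_trans)
  qed
  have k1: "keys (?e \<kappa>) \<subseteq> ?K" if "\<kappa> \<in> ?K" for \<kappa> using that by auto
  have "act_sym g (?e \<kappa>) = lin_ext (\<lambda>\<kappa>. act_sym P (?e \<kappa>)) (act_sym B (act_sym Q (?e \<kappa>)))" if "\<kappa> \<in> ?K" for \<kappa>
  proof -
    have "act_sym g (?e \<kappa>) = act_sym (P * B) (act_sym Q (?e \<kappa>))"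
      unfolding c(5) using c by (intro act_sym_comp[OF _ _ k1[OF that], symmetric]) auto
    also have "\<dots> = act_sym P (act_sym B (act_sym Q (?e \<kappa>)))"
      using c by (intro act_sym_comp[OF _ _ ky[OF _ k1[OF that]], symmetric]) auto
    finally show ?thesis by (simp add: act_sym_def)
  qed
  then have "(\<Sum>\<kappa>\<in>?K. lookup (act_sym g (?e \<kappa>)) \<kappa>) =
    (\<Sum>\<kappa>\<in>?K. lookup (lin_ext (\<lambda>\<kappa>. act_sym P (?e \<kappa>)) (act_sym B (act_sym Q (?e \<kappa>)))) \<kappa>)"
    by simp
  also have "\<dots> = (\<Sum>\<kappa>\<in>?K. lookup (lin_ext (\<lambda>\<kappa>. act_sym B (act_sym Q (?e \<kappa>))) (act_sym P (?e \<kappa>))) \<kappa>)"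
    using ky[OF c(2) k1] ky[OF c(1) ky[OF c(3) k1]] by (intro trace_commute) auto
  also have "\<dots> = (\<Sum>\<kappa>\<in>?K. lookup (act_sym B (?e \<kappa>)) \<kappa>)"
  proof (intro sum.cong refl)
    fix \<kappa> assume \<kappa>: "\<kappa> \<in> ?K"
    have "lin_ext (\<lambda>\<kappa>. act_sym B (act_sym Q (?e \<kappa>))) (act_sym P (?e \<kappa>)) = act_sym B (act_sym Q (act_sym P (?e \<kappa>)))"
      using linop_lin_ext_commute[OF linop_comp[OF linop_act_sym linop_act_sym], of B Q ?e "act_sym P (?e \<kappa>)"]
      by (simp add: lin_ext_id)
    also have "act_sym Q (act_sym P (?e \<kappa>)) = ?e \<kappa>"
      using act_sym_comp[OF c(3,2) k1[OF \<kappa>]] c(4) \<kappa> act_sym_one[of _ N] by (auto simp: msets_def)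
    finally show "lookup (lin_ext (\<lambda>\<kappa>. act_sym B (act_sym Q (?e \<kappa>))) (act_sym P (?e \<kappa>))) \<kappa> =
      lookup (act_sym B (?e \<kappa>)) \<kappa>" by simp
  qed
  finally have "(\<Sum>M\<in>msets N k. lookup (act_sym g (sym_monom M)) (letters M)) =
      (\<Sum>M\<in>msets N k. lookup (act_sym B (sym_monom M)) (letters M))"
    using re[of "\<lambda>\<kappa>. lookup (act_sym g (?e \<kappa>)) \<kappa>"]
      re[of "\<lambda>\<kappa>. lookup (act_sym B (?e \<kappa>)) \<kappa>"] by metis
  also have "\<dots> = (\<Sum>M\<in>msets N k. \<Prod>a\<in>#M. xs ! a)"
  proof (intro sum.cong refl)
    fix M assume M: "M \<in> msets N k"
    have "B $$ (a, a) = xs ! a" if "a < N" for a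
      using s(3) that c(1) by (auto simp: diag_mat_def)
    then have "(\<Prod>a\<in>#M. B $$ (a, a)) = (\<Prod>a\<in>#M. xs ! a)"
      using M by (intro arg_cong[of _ _ prod_mset] image_mset_cong) (auto simp: msets_def)
    then show "lookup (act_sym B (sym_monom M)) (letters M) = (\<Prod>a\<in>#M. xs ! a)"
      using lookup_act_sym_triangular[OF s(2) c(1), of M] M by (simp add: msets_def)
  qed
  finally show ?thesis .
qed

section \<open>The higher Lie module of a hook\<close>

lemma lie_part_subset: "lie_part N m \<subseteq> tensor_power N m"
  by (simp add: lie_part_def)

lemma lie_part_1: "lie_part N 1 = tensor_power N 1"
  unfolding lie_part_def using free_lie.generator by auto

lemma prod_sym_incl_letters:
  assumes "\<forall>j<k. v j \<in> tensor_power N 1"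
  shows "(\<Prod>j<k. sym_incl (v j)) \<in> free_vs.span (sym_monom ` msets N k)"
  using assms
proof (induction k)
  case 0
  have "1 = sym_monom {#}" by (simp add: single_one[symmetric] del: single_one)
  moreover have "{#} \<in> msets N 0" by (simp add: msets_def)
  ultimately have "1 \<in> sym_monom ` msets N 0" by (metis imageI)
  then show ?case by (simp add: free_vs.span_base)
next
  case (Suc k)
  let ?S = "free_vs.span (sym_monom ` msets N (Suc k))"
  have v: "sym_incl (v k) = (\<Sum>u\<in>keys (v k). scal (lookup (v k) u) (single {#u#} 1))"
    by (simp add: sym_incl_def lin_ext_def)
  have "p * sym_incl (v k) \<in> ?S" if "p \<in> free_vs.span (sym_monom ` msets N k)" for p
    using that
  proof (induction rule: free_vs.span_induct_alt)
    case (step c x y)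
    then obtain M where M: "x = sym_monom M" "M \<in> msets N k" by auto
    have "sym_monom M * sym_incl (v k) \<in> ?S"
      unfolding v sum_distrib_left scal_mult_right
    proof (intro free_vs.span_sum free_vs.span_scale free_vs.span_base)
      fix u assume "u \<in> keys (v k)"
      moreover have "v k \<in> tensor_power N 1" using Suc.prems by simp
      ultimately obtain a where "u = [a]" "a < N" by (auto simp: tensor_power_def length_Suc_conv)
      then have "sym_monom M * single {#u#} 1 = sym_monom (add_mset a M)" "add_mset a M \<in> msets N (Suc k)"
        using M by (auto simp: mult_single msets_def)
      then show "sym_monom M * single {#u#} 1 \<in> sym_monom ` msets N (Suc k)" by blast
    qed
    then show ?case using step M by (simp add: distrib_right scal_mult_left free_vs.span_add free_vs.span_scale)
  qed (simp add: free_vs.span_zero)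
  then show ?case using Suc by simp
qed

lemma sym_monom_prod:
  assumes "M \<in> msets N k"
  shows "\<exists>v. (\<forall>j<k. v j \<in> tensor_power N 1) \<and> sym_monom M = (\<Prod>j<k. sym_incl (v j))"
proof -
  obtain xs where xs: "mset xs = M" using ex_mset by blast
  have "sym_monom (mset ys) = (\<Prod>j<length ys. sym_incl (tens [ys ! j]))" for ys
  proof (induction ys rule: rev_induct)
    case Nil
    then show ?case by (simp add: single_one[symmetric] del: single_one)
  next
    case (snoc y ys)
    have "(\<Prod>j<length ys. sym_incl (tens [(ys @ [y]) ! j])) = (\<Prod>j<length ys. sym_incl (tens [ys ! j]))"
      by (intro prod.cong) (auto simp: nth_append)
    then show ?case using snoc sym_monom_add[of "mset ys" "{#y#}"] by (simp add: sym_incl_letter)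
  qed
  from this[of xs] have "sym_monom M = (\<Prod>j<k. sym_incl (tens [xs ! j]))"
    using xs assms by (auto simp: msets_def)
  moreover have "tens [xs ! j] \<in> tensor_power N 1" if "j < k" for j
  proof -
    have "j < length xs" "set xs \<subseteq> {..<N}" using xs assms that by (auto simp: msets_def)
    then show ?thesis by (auto simp: tensor_power_def dest: nth_mem)
  qed
  ultimately show ?thesis by (intro exI[of _ "\<lambda>j. tens [xs ! j]"]) auto
qed

text \<open>As \<open>m\<close> differs from 1, the factors are the first symmetric power of
  \<open>lie_part N m\<close> and the \<open>k\<close>-th one of \<open>lie_part N 1\<close>, which
  is V. For \<open>k = 0\<close> the product runs over \<open>m\<close> alone, so that case is
  treated separately.\<close>

lemma higher_lie_hook:
  assumes "2 \<le> m"
  shows "higher_lie N (m # replicate k 1) =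
    free_vs.span {sym_incl l * sym_monom M | l M. l \<in> lie_part N m \<and> M \<in> msets N k}" (is "?L = free_vs.span ?G")
proof -
  have spow1: "sym_power 1 (lie_part N m) = free_vs.span (sym_incl ` lie_part N m)"
  proof -
    have "{\<Prod>j<(1::nat). sym_incl (w j) | w. \<forall>j<1. w j \<in> lie_part N m} = sym_incl ` lie_part N m"
    proof (intro equalityI subsetI)
      fix p assume "p \<in> sym_incl ` lie_part N m"
      then obtain l where "l \<in> lie_part N m" "p = sym_incl l" by blast
      then show "p \<in> {\<Prod>j<(1::nat). sym_incl (w j) | w. \<forall>j<1. w j \<in> lie_part N m}"
        by (intro CollectI exI[of _ "\<lambda>_. l"]) auto
    qed auto
    then show ?thesis by (simp add: sym_power_def)
  qed
  have cm: "count_list (m # replicate k 1) m = 1"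
    using assms by (induction k) auto
  have mem_m: "p * q \<in> free_vs.span ?G"
    if "p \<in> free_vs.span (sym_incl ` lie_part N m)" "q \<in> free_vs.span (sym_monom ` msets N k)" for p q
    using that(1)
  proof (induction rule: free_vs.span_induct_alt)
    case (step c x y)
    then obtain l where l: "x = sym_incl l" "l \<in> lie_part N m" by auto
    have "sym_incl l * q \<in> free_vs.span ?G"
      using that(2)
    proof (induction rule: free_vs.span_induct_alt)
      case (step c x y)
      then obtain M where "x = sym_monom M" "M \<in> msets N k" by auto
      then have "sym_incl l * x \<in> free_vs.span ?G" using l(2) by (intro free_vs.span_base) auto
      then show ?case using step by (simp add: distrib_left scal_mult_right free_vs.span_add free_vs.span_scale)
    qed (simp add: free_vs.span_zero)
    then show ?case using step l by (simp add: distrib_right scal_mult_left free_vs.span_add free_vs.span_scale)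
  qed (simp add: free_vs.span_zero)
  show ?thesis
  proof (cases "k = 0")
    case True
    have "{\<Prod>i\<in>set [m]. s i | s. \<forall>i\<in>set [m]. s i \<in> sym_power (count_list [m] i) (lie_part N i)} =
        free_vs.span (sym_incl ` lie_part N m)"
    proof (intro equalityI subsetI)
      fix p assume "p \<in> free_vs.span (sym_incl ` lie_part N m)"
      then show "p \<in> {\<Prod>i\<in>set [m]. s i | s. \<forall>i\<in>set [m]. s i \<in> sym_power (count_list [m] i) (lie_part N i)}"
        using spow1 by (intro CollectI exI[of _ "\<lambda>_. p"]) auto
    qed (use spow1 in auto)
    moreover have "?G = sym_incl ` lie_part N m"
    proof -
      have "msets N 0 = {{#}}" by (auto simp: msets_def)
      moreover have "sym_monom {#} = 1" by (simp add: single_one[symmetric] del: single_one)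
      ultimately show ?thesis using True by auto
    qed
    ultimately show ?thesis using True by (simp add: higher_lie_def free_vs.span_span)
  next
    case False
    let ?lam = "m # replicate k 1"
    have st: "set ?lam = {m, 1}" "m \<noteq> 1" using False assms by auto
    have c1: "count_list ?lam 1 = k" using st(2) by (induction k) auto
    have P: "{\<Prod>i\<in>set ?lam. s i | s. \<forall>i\<in>set ?lam. s i \<in> sym_power (count_list ?lam i) (lie_part N i)} =
      {p * q | p q. p \<in> sym_power 1 (lie_part N m) \<and> q \<in> sym_power k (lie_part N 1)}" (is "?A = ?B")
    proof (intro equalityI subsetI)
      fix z assume "z \<in> ?A"
      then obtain s where s: "z = (\<Prod>i\<in>{m, 1}. s i)" "\<forall>i\<in>{m, 1}. s i \<in> sym_power (count_list ?lam i) (lie_part N i)"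
        unfolding st(1) by blast
      then show "z \<in> ?B" using st(2) cm c1 by auto
    next
      fix z assume "z \<in> ?B"
      then obtain p q where pq: "z = p * q" "p \<in> sym_power 1 (lie_part N m)" "q \<in> sym_power k (lie_part N 1)" by blast
      then show "z \<in> ?A" unfolding st(1) using st(2) cm c1
        by (intro CollectI exI[of _ "\<lambda>i. if i = m then p else q"]) auto
    qed
    have G2: "sym_power k (lie_part N 1) \<subseteq> free_vs.span (sym_monom ` msets N k)"
      unfolding sym_power_def lie_part_1
      using prod_sym_incl_letters by (intro free_vs.span_minimal free_vs.subspace_span) auto
    have "?L = free_vs.span ?B" unfolding higher_lie_def P ..
    also have "\<dots> = free_vs.span ?G"
    proof (intro equalityI free_vs.span_minimal free_vs.subspace_span subsetI)
      fix z assume "z \<in> ?B"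
      then show "z \<in> free_vs.span ?G" using mem_m G2 spow1 by auto
    next
      fix z assume "z \<in> ?G"
      then obtain l M where z: "z = sym_incl l * sym_monom M" "l \<in> lie_part N m" "M \<in> msets N k" by blast
      obtain v where "\<forall>j<k. v j \<in> tensor_power N 1" "sym_monom M = (\<Prod>j<k. sym_incl (v j))"
        using sym_monom_prod[OF z(3)] by blast
      then have "sym_monom M \<in> sym_power k (lie_part N 1)"
        unfolding sym_power_def lie_part_1 by (intro free_vs.span_base) auto
      moreover have "sym_incl l \<in> sym_power 1 (lie_part N m)"
        unfolding spow1 using z(2) by (intro free_vs.span_base) auto
      ultimately show "z \<in> free_vs.span ?B" using z(1) by (intro free_vs.span_base) blast
    qed
    finally show ?thesis .
  qed
qed

context cyclic_root
begin

text \<open>The spanning family consists of the products of \<open>proj u\<close> with monomials,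
  and the coordinates are the coefficients at \<open>u\<close> and \<open>M\<close>. This is a
  legitimate choice because \<open>proj\<close> fixes Lie elements: a Lie element \<open>l\<close>
  is the combination of the \<open>proj u\<close> with the coefficients of \<open>l\<close>.
  Coefficients multiply, so the trace factors.\<close>

theorem trace_higher_lie_hook:
  assumes g: "g \<in> carrier_mat N N" and xs: "char_poly g = (\<Prod>x\<leftarrow>xs. [:- x, 1:])"
  shows "trace_on (higher_lie N (m # replicate k 1)) (act_sym g) =
    lie_char N ((!) xs) * (\<Sum>M\<in>msets N k. \<Prod>a\<in>#M. xs ! a)"
proof -
  define G where "G = {sym_incl l * sym_monom M | l M. l \<in> lie_part N m \<and> M \<in> msets N k}"
  have W: "higher_lie N (m # replicate k 1) = free_vs.span G"
    unfolding G_def by (rule higher_lie_hook[OF m2])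
  define e where "e = (\<lambda>(u :: nat list, M). add_mset u (letters M))"
  define P where "P = (\<lambda>(u, M). sym_incl (proj u) * sym_monom M)"
  let ?I = "words N m \<times> msets N k"
  have PG: "P i \<in> G" if "i \<in> ?I" for i
    using that proj_in_lie_part by (auto simp: P_def G_def)
  have m1: "m \<noteq> 1" using m2 by simp
  have lin: "linop (\<lambda>p. \<Sum>i\<in>?I. scal (lookup p (e i)) (P i))"
    by (simp add: linop_def Poly_Mapping.lookup_add lookup_scal free_vs.scale_left_distrib sum.distrib
        free_vs.scale_sum_right)
  define F where "F = (\<lambda>p. \<Sum>i\<in>?I. scal (lookup p (e i)) (P i))"
  have rep: "p = F p" if "p \<in> free_vs.span G" for p
    using that
  proof (induction rule: free_vs.span_induct_alt)
    case (step c x y)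
    then obtain l M where x: "x = sym_incl l * sym_monom M" "l \<in> lie_part N m" "M \<in> msets N k"
      unfolding G_def by auto
    have l: "l \<in> tensor_power N m" using x(2) lie_part_subset by blast
    have "(\<Sum>i\<in>?I. scal (lookup x (e i)) (P i)) =
      (\<Sum>u\<in>words N m. \<Sum>M'\<in>msets N k. scal (lookup x (e (u, M'))) (P (u, M')))"
      by (simp add: sum.cartesian_product case_prod_unfold)
    also have "\<dots> = (\<Sum>u\<in>words N m. \<Sum>M'\<in>msets N k.
        if M' = M then scal (lookup l u) (sym_incl (proj u) * sym_monom M) else 0)"
    proof (intro sum.cong refl)
      fix u M' assume "u \<in> words N m"
      then have "lookup x (e (u, M')) = lookup l u * lookup (sym_monom M) (letters M')"
        unfolding x(1) e_def prod.case using m1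
        by (intro lookup_sym_incl_mult[OF l, where S = "{M}"]) (auto simp: words_def)
      then show "scal (lookup x (e (u, M'))) (P (u, M')) =
          (if M' = M then scal (lookup l u) (sym_incl (proj u) * sym_monom M) else 0)"
        using letters_inj[of M M'] by (auto simp: P_def lookup_single when_def)
    qed
    also have "\<dots> = (\<Sum>u\<in>words N m. scal (lookup l u) (sym_incl (proj u) * sym_monom M))"
      using x(3) by simp
    also have "\<dots> = lin_ext (\<lambda>u. sym_incl (proj u) * sym_monom M) l"
      using lin_ext_superset[OF finite_words keys_tensor_power[OF l], of "\<lambda>u. sym_incl (proj u) * sym_monom M"] by simp
    also have "\<dots> = sym_incl (lin_ext proj l) * sym_monom M"
      using linop_lin_ext_commute[OF linop_comp[OF linop_mult_right[of "sym_monom M"] linop_sym_incl], where f = proj and p = l]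
      by simp
    also have "\<dots> = x" using x proj_lie_part by simp
    finally have "x = (\<Sum>i\<in>?I. scal (lookup x (e i)) (P i))" by simp
    then have "x = F x" by (simp add: F_def)
    moreover have "y = F y" using step.IH .
    moreover have "F (scal c x + y) = scal c (F x) + F y"
      using lin unfolding F_def[symmetric] linop_def by simp
    ultimately show ?case by metis
  qed (use linop_zero[OF lin] in \<open>simp add: F_def\<close>)
  have inv: "act_sym g p \<in> free_vs.span G" if "p \<in> free_vs.span G" for p
    using that
  proof (induction rule: free_vs.span_induct_alt)
    case base
    then show ?case by (simp add: linop_zero[OF linop_act_sym] free_vs.span_zero)
  next
    case (step c x y)
    then obtain l M where x: "x = sym_incl l * sym_monom M" "l \<in> lie_part N m" "M \<in> msets N k"
      unfolding G_def by auto
    let ?q = "act_sym g (sym_monom M)"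
    have ky: "keys ?q \<subseteq> letters ` msets N k"
      using keys_act_sym_monom[of g M] g x(3) by (auto simp: msets_def)
    have l: "act_tensor g l \<in> lie_part N m" using act_tensor_lie_part[OF x(2)] g by auto
    let ?p = "sym_incl (act_tensor g l)"
    have "act_sym g x = ?p * lin_ext (\<lambda>\<kappa>. single \<kappa> 1) ?q"
      unfolding x(1) act_sym_mult act_sym_incl lin_ext_id ..
    also have "\<dots> = lin_ext (\<lambda>\<kappa>. ?p * single \<kappa> 1) ?q"
      by (rule linop_lin_ext_commute[OF linop_mult_left])
    also have "\<dots> = (\<Sum>\<kappa>\<in>keys ?q. scal (lookup ?q \<kappa>) (?p * single \<kappa> 1))"
      by (rule lin_ext_def)
    also have "\<dots> \<in> free_vs.span G"
    proof (intro free_vs.span_sum free_vs.span_scale free_vs.span_base)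
      fix \<kappa> assume "\<kappa> \<in> keys ?q"
      then obtain M' where "\<kappa> = letters M'" "M' \<in> msets N k" using ky by blast
      then show "sym_incl (act_tensor g l) * single \<kappa> 1 \<in> G" unfolding G_def using l by blast
    qed
    finally have "act_sym g x \<in> free_vs.span G" .
    moreover have "act_sym g (scal c x + y) = scal c (act_sym g x) + act_sym g y"
      using linop_act_sym[of g] unfolding linop_def by simp
    ultimately show ?case using step.IH by (simp add: free_vs.span_add free_vs.span_scale)
  qed
  have "trace_on (free_vs.span G) (act_sym g) = (\<Sum>i\<in>?I. lookup (act_sym g (P i)) (e i))"
  proof (rule trace_on_eq)
    show "finite ?I" by simp
    show "p = (\<Sum>i\<in>?I. scal (lookup p (e i)) (P i))" if "p \<in> free_vs.span G" for p
      using rep[OF that] by (simp add: F_def)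
    show "P i \<in> free_vs.span G" if "i \<in> ?I" for i using PG[OF that] by (rule free_vs.span_base)
    show "free_vs.subspace (free_vs.span G)" by (rule free_vs.subspace_span)
  qed (use inv linop_act_sym in auto)
  also have "\<dots> = (\<Sum>(u, M)\<in>?I. lookup (act_tensor g (proj u)) u *
      lookup (act_sym g (sym_monom M)) (letters M))"
  proof (intro sum.cong refl)
    fix i assume "i \<in> ?I"
    then obtain u M where i: "i = (u, M)" "u \<in> words N m" "M \<in> msets N k" by auto
    have pl: "act_tensor g (proj u) \<in> tensor_power N m"
      using act_tensor_lie_part[OF proj_in_lie_part[OF i(2)], of g] g lie_part_subset by auto
    have ky: "keys (act_sym g (sym_monom M)) \<subseteq> letters ` msets N k"
      using keys_act_sym_monom[of g M] g i(3) by (auto simp: msets_def)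
    have "length u = m" using i(2) by (simp add: words_def)
    from lookup_sym_incl_mult[OF pl ky this m1, of M]
    show "lookup (act_sym g (P i)) (e i) = (case i of (u, M) \<Rightarrow>
      lookup (act_tensor g (proj u)) u * lookup (act_sym g (sym_monom M)) (letters M))"
      unfolding i(1) P_def e_def prod.case act_sym_mult act_sym_incl .
  qed
  also have "\<dots> = (\<Sum>u\<in>words N m. lookup (act_tensor g (proj u)) u) *
      (\<Sum>M\<in>msets N k. lookup (act_sym g (sym_monom M)) (letters M))"
    by (simp add: sum_product sum.cartesian_product)
  finally show ?thesis unfolding W trace_proj[OF assms] trace_sym_power[OF assms] .
qed

end

section \<open>Symmetric functions\<close>

text \<open>The multiset represents the weakly increasing tail of a word. In this form a permutation
  of the letters acts on it directly, without sorting again.\<close>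

abbreviation pairs :: "nat \<Rightarrow> nat \<Rightarrow> (nat list \<times> nat multiset) set" where
  "pairs m k \<equiv> {v. length v = m} \<times> {M. size M = k}"

definition weight :: "nat list \<times> nat multiset \<Rightarrow> nat \<Rightarrow>\<^sub>0 nat" where
  "weight p = (\<Sum>a\<in>#mset (fst p) + snd p. single a 1)"

lemma lookup_weight: "lookup (weight p) i = count (mset (fst p) + snd p) i"
proof -
  have "lookup (\<Sum>a\<in>#A. single a 1) i = count A i" for A :: "nat multiset"
    by (induction A) (auto simp: Poly_Mapping.lookup_add lookup_single when_def)
  then show ?thesis unfolding weight_def .
qed

lemma weight_eq_iff: "weight p = \<alpha> \<longleftrightarrow> (\<forall>i. count (mset (fst p) + snd p) i = lookup \<alpha> i)"
  by (metis lookup_weight poly_mapping_eqI)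

lemma keys_weight: "keys (weight p) = set_mset (mset (fst p) + snd p)"
  by (auto simp: in_keys_iff lookup_weight simp flip: count_greater_zero_iff)

lemma degree_weight:
  "(\<Sum>i\<in>keys (weight p). lookup (weight p) i) = length (fst p) + size (snd p)"
  unfolding keys_weight lookup_weight size_multiset_overloaded_eq[symmetric] by simp

lemma pairs_weight_words:
  assumes "keys \<alpha> \<subseteq> {..<N}" "p \<in> pairs m k" "weight p = \<alpha>"
  shows "p \<in> words N m \<times> msets N k"
  using assms keys_weight[of p] by (auto simp: words_def msets_def)

lemma bounded_keys: "\<exists>N. keys \<alpha> \<subseteq> {..<N}" for \<alpha> :: "nat \<Rightarrow>\<^sub>0 nat"
  by (rule exI[of _ "Suc (Max (insert 0 (keys \<alpha>)))"]) (auto simp: less_Suc_eq_le)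

definition monomial :: "nat \<Rightarrow> complex list \<Rightarrow> (nat \<Rightarrow>\<^sub>0 nat) \<Rightarrow> complex" where
  "monomial N xs \<alpha> = (\<Prod>i<N. xs ! i ^ lookup \<alpha> i)"

lemma monomial_weight:
  assumes "p \<in> words N m \<times> msets N k"
  shows "monomial N xs (weight p) = prod_list (map ((!) xs) (fst p)) * (\<Prod>a\<in>#snd p. xs ! a)"
proof -
  have "(\<Prod>i<N. xs ! i ^ count A i) = (\<Prod>a\<in>#A. xs ! a)" if "set_mset A \<subseteq> {..<N}" for A
  proof -
    have "(\<Prod>a\<in>#A. xs ! a) = (\<Prod>i\<in>set_mset A. xs ! i ^ count A i)" by (rule image_prod_mset_multiplicity)
    also have "\<dots> = (\<Prod>i<N. xs ! i ^ count A i)"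
      using that by (intro prod.mono_neutral_left) (auto simp: not_in_iff)
    finally show ?thesis ..
  qed
  from this[of "mset (fst p) + snd p"] assms show ?thesis
    by (auto simp: monomial_def lookup_weight words_def msets_def prod_mset_prod_list simp flip: mset_map)
qed

lemma digits_unique:
  fixes c d :: "nat \<Rightarrow> nat"
  assumes "\<And>i. i < N \<Longrightarrow> c i < B" "\<And>i. i < N \<Longrightarrow> d i < B"
    "(\<Sum>i<N. c i * B ^ i) = (\<Sum>i<N. d i * B ^ i)" "i < N"
  shows "c i = d i"
  using assms
proof (induction N arbitrary: c d i)
  case (Suc N)
  have s: "(\<Sum>i<Suc N. f i * B ^ i) = f 0 + B * (\<Sum>i<N. f (Suc i) * B ^ i)" for f :: "nat \<Rightarrow> nat"
    unfolding sum.lessThan_Suc_shift by (simp add: sum_distrib_left algebra_simps)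
  have e: "c 0 + B * (\<Sum>i<N. c (Suc i) * B ^ i) = d 0 + B * (\<Sum>i<N. d (Suc i) * B ^ i)"
    using Suc.prems(3) unfolding s .
  have lt: "c 0 < B" "d 0 < B" using Suc.prems by auto
  have 0: "c 0 = d 0" using arg_cong[OF e, of "\<lambda>x. x mod B"] lt by simp
  then have "(\<Sum>i<N. c (Suc i) * B ^ i) = (\<Sum>i<N. d (Suc i) * B ^ i)" using e lt by simp
  then have "c (Suc j) = d (Suc j)" if "j < N" for j
    using Suc.IH[of "\<lambda>i. c (Suc i)" "\<lambda>i. d (Suc i)" j] Suc.prems(1,2) that by simp
  then show ?case using 0 Suc.prems(4) by (cases i) auto
qed simp

text \<open>Kronecker substitution \<open>x\<^sub>i = t\<^bsup>B^i\<^esup>\<close> separates the monomials of bounded degree.\<close>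

lemma monomials_independent:
  assumes A: "finite A" "\<And>\<alpha>. \<alpha> \<in> A \<Longrightarrow> keys \<alpha> \<subseteq> {..<N}"
    and zero: "\<And>xs. length xs = N \<Longrightarrow> 0 \<notin> set xs \<Longrightarrow> (\<Sum>\<alpha>\<in>A. F \<alpha> * monomial N xs \<alpha>) = 0"
    and "\<alpha> \<in> A"
  shows "F \<alpha> = 0"
proof -
  \<comment> \<open>The base exceeds all exponents that occur, so they are the digits of
    \<open>e \<alpha>\<close> and \<open>e\<close> is injective on \<open>A\<close>.\<close>
  define B where "B = Suc (\<Sum>\<alpha>\<in>A. \<Sum>i<N. lookup \<alpha> i)"
  have B: "lookup \<alpha> i < B" if "\<alpha> \<in> A" "i < N" for \<alpha> i
  proof -
    have "lookup \<alpha> i \<le> (\<Sum>i<N. lookup \<alpha> i)"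
      using that by (intro member_le_sum) auto
    also have "\<dots> \<le> (\<Sum>\<alpha>\<in>A. \<Sum>i<N. lookup \<alpha> i)"
      using that A(1) by (intro member_le_sum[where f = "\<lambda>\<alpha>. \<Sum>i<N. lookup \<alpha> i"]) auto
    finally show ?thesis by (simp add: B_def)
  qed
  define e where "e \<alpha> = (\<Sum>i<N. lookup \<alpha> i * B ^ i)" for \<alpha> :: "nat \<Rightarrow>\<^sub>0 nat"
  have inj: "\<alpha> = \<beta>" if "\<alpha> \<in> A" "\<beta> \<in> A" "e \<alpha> = e \<beta>" for \<alpha> \<beta>
  proof (rule poly_mapping_eqI)
    fix i
    show "lookup \<alpha> i = lookup \<beta> i"
    proof (cases "i < N")
      case True
      then show ?thesis
        using digits_unique[of N "lookup \<alpha>" B "lookup \<beta>" i] B that by (simp add: e_def)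
    next
      case False
      then show ?thesis using A(2)[OF that(1)] A(2)[OF that(2)]
        by (metis in_keys_iff lessThan_iff subsetD)
    qed
  qed
  define p where "p = (\<Sum>\<alpha>\<in>A. Polynomial.monom (F \<alpha>) (e \<alpha>))"
  \<comment> \<open>Only nonzero \<open>t\<close> may be substituted, since the hypothesis speaks of
    nonzero values; infinitely many roots remain.\<close>
  have "poly p t = 0" if "t \<noteq> 0" for t
  proof -
    let ?xs = "map (\<lambda>i. t ^ (B ^ i)) [0..<N]"
    have "monomial N ?xs \<alpha> = t ^ e \<alpha>" for \<alpha>
    proof -
      have "monomial N ?xs \<alpha> = (\<Prod>i<N. t ^ (lookup \<alpha> i * B ^ i))"
        unfolding monomial_def by (intro prod.cong) (auto simp: power_mult[symmetric] mult.commute)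
      then show ?thesis by (simp add: e_def power_sum)
    qed
    moreover have "(\<Sum>\<alpha>\<in>A. F \<alpha> * monomial N ?xs \<alpha>) = 0" using that by (intro zero) auto
    ultimately show ?thesis by (simp add: p_def poly_sum poly_monom)
  qed
  then have "UNIV - {0} \<subseteq> {t. poly p t = 0}" by auto
  then have "infinite {t. poly p t = 0}"
    using infinite_UNIV_char_0[where 'a = complex] by (metis finite_Diff2 finite_subset finite.emptyI finite_insert)
  then have "p = 0" using poly_roots_finite by blast
  then have "0 = coeff p (e \<alpha>)" by simp
  also have "\<dots> = (\<Sum>\<beta>\<in>A. if \<beta> = \<alpha> then F \<beta> else 0)"
    unfolding p_def coeff_sum using inj \<open>\<alpha> \<in> A\<close> by (intro sum.cong) auto
  also have "\<dots> = F \<alpha>" using A(1) \<open>\<alpha> \<in> A\<close> by simp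
  finally show ?thesis by simp
qed

section \<open>The coefficients of the characteristic and their symmetry\<close>

text \<open>The coefficients of \<open>h_k\<close> times the generating function of the words of
  length \<open>m\<close> with major index 1 modulo \<open>m\<close>. As a cardinality it is
  integral and can be compared with tableaux directly.\<close>

definition hook_coeff :: "nat \<Rightarrow> nat \<Rightarrow> power_series" where
  "hook_coeff m k \<alpha> = int (card {p \<in> pairs m k. weight p = \<alpha> \<and> [word_maj (fst p) = 1] (mod m)})"

lemma hook_coeff_nonzeroD:
  assumes "hook_coeff m k \<alpha> \<noteq> 0"
  shows "\<exists>p\<in>pairs m k. weight p = \<alpha>"
proof (rule ccontr)
  assume "\<not> ?thesis"
  then have *: "{p \<in> pairs m k. weight p = \<alpha> \<and> [word_maj (fst p) = 1] (mod m)} = {}" by blast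
  have "hook_coeff m k \<alpha> = 0" unfolding hook_coeff_def * by simp
  then show False using assms by simp
qed

lemma sum_pairs_by_weight:
  fixes c :: "nat list \<times> nat multiset \<Rightarrow> complex"
  shows "(\<Sum>p\<in>words N m \<times> msets N k. c p * monomial N xs (weight p)) =
    (\<Sum>\<alpha>\<in>weight ` (words N m \<times> msets N k).
      (\<Sum>p | p \<in> words N m \<times> msets N k \<and> weight p = \<alpha>. c p) * monomial N xs \<alpha>)"
  by (subst sum.image_gen[where g = weight]) (auto simp: sum_distrib_right intro!: sum.cong)

lemma pairs_weight_Collect:
  assumes "keys \<alpha> \<subseteq> {..<N}"
  shows "{p \<in> pairs m k. weight p = \<alpha> \<and> Q p} = {p \<in> words N m \<times> msets N k. weight p = \<alpha> \<and> Q p}"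
proof (intro equalityI subsetI)
  fix p assume "p \<in> {p \<in> pairs m k. weight p = \<alpha> \<and> Q p}"
  then show "p \<in> {p \<in> words N m \<times> msets N k. weight p = \<alpha> \<and> Q p}"
    using pairs_weight_words[OF assms, of p m k] by simp
next
  fix p assume "p \<in> {p \<in> words N m \<times> msets N k. weight p = \<alpha> \<and> Q p}"
  then show "p \<in> {p \<in> pairs m k. weight p = \<alpha> \<and> Q p}" by (auto simp: words_def msets_def)
qed

lemma sum_indicator_card:
  assumes "keys \<alpha> \<subseteq> {..<N}"
  shows "(\<Sum>p | p \<in> words N m \<times> msets N k \<and> weight p = \<alpha>. if Q p then 1 else (0 :: complex)) =
    of_nat (card {p \<in> pairs m k. weight p = \<alpha> \<and> Q p})"
proof -
  have "(\<Sum>p | p \<in> words N m \<times> msets N k \<and> weight p = \<alpha>. if Q p then 1 else (0 :: complex)) =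
      (\<Sum>p | p \<in> words N m \<times> msets N k \<and> weight p = \<alpha> \<and> Q p. 1)"
    by (rule sum.mono_neutral_cong_right) auto
  then show ?thesis unfolding pairs_weight_Collect[OF assms] by simp
qed

lemma keys_weight_words: "p \<in> words N m \<times> msets N k \<Longrightarrow> keys (weight p) \<subseteq> {..<N}"
  unfolding keys_weight by (auto simp: words_def msets_def)

lemma sum_pairs_product:
  "(\<Sum>p\<in>words N m \<times> msets N k. (if Q (fst p) then 1 else 0) * monomial N xs (weight p)) =
    (\<Sum>v | v \<in> words N m \<and> Q v. prod_list (map ((!) xs) v)) * (\<Sum>M\<in>msets N k. \<Prod>a\<in>#M. xs ! a)"
proof -
  have "(\<Sum>p\<in>words N m \<times> msets N k. (if Q (fst p) then 1 else 0) * monomial N xs (weight p)) =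
    (\<Sum>(v, M)\<in>words N m \<times> msets N k. (if Q v then prod_list (map ((!) xs) v) else 0) * (\<Prod>a\<in>#M. xs ! a))"
    by (intro sum.cong refl) (auto simp: monomial_weight[of _ N m k])
  also have "\<dots> = (\<Sum>v\<in>words N m. if Q v then prod_list (map ((!) xs) v) else 0) * (\<Sum>M\<in>msets N k. \<Prod>a\<in>#M. xs ! a)"
    by (simp add: sum_product sum.cartesian_product)
  also have "(\<Sum>v\<in>words N m. if Q v then prod_list (map ((!) xs) v) else 0) =
      (\<Sum>v | v \<in> words N m \<and> Q v. prod_list (map ((!) xs) v))"
    by (rule sum.mono_neutral_cong_right) auto
  finally show ?thesis .
qed

text \<open>Every pair contributes the monomial of its weight, so the sum over exponents is a sum
  over pairs, and this one factors into words and multisets.\<close>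

lemma eval_sym_hook_coeff:
  assumes "length xs = N"
  shows "eval_sym (hook_coeff m k) xs =
    (\<Sum>v | v \<in> words N m \<and> [word_maj v = 1] (mod m). prod_list (map ((!) xs) v)) *
      (\<Sum>M\<in>msets N k. \<Prod>a\<in>#M. xs ! a)"
proof -
  let ?A = "weight ` (words N m \<times> msets N k)"
  have co: "(\<Sum>p | p \<in> words N m \<times> msets N k \<and> weight p = \<alpha>. if [word_maj (fst p) = 1] (mod m) then 1 else (0 :: complex)) =
      of_int (hook_coeff m k \<alpha>)" if "keys \<alpha> \<subseteq> {..<N}" for \<alpha>
    unfolding hook_coeff_def sum_indicator_card[OF that] by simp
  have "eval_sym (hook_coeff m k) xs = (\<Sum>\<alpha>\<in>?A. of_int (hook_coeff m k \<alpha>) * monomial N xs \<alpha>)"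
    unfolding eval_sym_def monomial_def assms
  proof (rule sum.mono_neutral_left)
    show "finite ?A" by simp
    show "{\<alpha>. keys \<alpha> \<subseteq> {..<N} \<and> hook_coeff m k \<alpha> \<noteq> 0} \<subseteq> ?A"
    proof (intro subsetI)
      fix \<alpha> assume "\<alpha> \<in> {\<alpha>. keys \<alpha> \<subseteq> {..<N} \<and> hook_coeff m k \<alpha> \<noteq> 0}"
      then have \<alpha>: "keys \<alpha> \<subseteq> {..<N}" "hook_coeff m k \<alpha> \<noteq> 0" by auto
      then obtain p where "p \<in> pairs m k" "weight p = \<alpha>" using hook_coeff_nonzeroD by blast
      then show "\<alpha> \<in> ?A" using pairs_weight_words[OF \<alpha>(1)] by blast
    qed
    show "\<forall>\<alpha>\<in>?A - {\<alpha>. keys \<alpha> \<subseteq> {..<N} \<and> hook_coeff m k \<alpha> \<noteq> 0}.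
        of_int (hook_coeff m k \<alpha>) * (\<Prod>i<N. xs ! i ^ lookup \<alpha> i) = 0"
    proof
      fix \<alpha> assume \<alpha>: "\<alpha> \<in> ?A - {\<alpha>. keys \<alpha> \<subseteq> {..<N} \<and> hook_coeff m k \<alpha> \<noteq> 0}"
      then have "keys \<alpha> \<subseteq> {..<N}" using keys_weight_words by blast
      then show "of_int (hook_coeff m k \<alpha>) * (\<Prod>i<N. xs ! i ^ lookup \<alpha> i) = 0" using \<alpha> by simp
    qed
  qed
  also have "\<dots> = (\<Sum>\<alpha>\<in>?A. (\<Sum>p | p \<in> words N m \<times> msets N k \<and> weight p = \<alpha>.
      if [word_maj (fst p) = 1] (mod m) then 1 else 0) * monomial N xs \<alpha>)"
    using co keys_weight_words by (intro sum.cong refl) auto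
  also have "\<dots> = (\<Sum>p\<in>words N m \<times> msets N k. (if [word_maj (fst p) = 1] (mod m) then 1 else 0) * monomial N xs (weight p))"
    by (rule sum_pairs_by_weight[symmetric])
  finally show ?thesis unfolding sum_pairs_product[where Q = "\<lambda>v. [word_maj v = 1] (mod m)"] .
qed

text \<open>The identity \<open>sum_words_maj_cong_1\<close>, multiplied by the sum over multisets,
  is an identity of polynomials and can be read coefficient by coefficient. The counts on the right
  are invariant under relabelling letters, which \<open>word_maj\<close> is not.\<close>

lemma (in cyclic_root) hook_coeff_rotations:
  "of_int (hook_coeff m k \<alpha>) =
    1 / of_nat m * (\<Sum>j<m. w ^ j * of_nat (card {p \<in> pairs m k. weight p = \<alpha> \<and> rotate j (fst p) = fst p}))"
proof -
  obtain N where N: "keys \<alpha> \<subseteq> {..<N}" using bounded_keys by blast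
  let ?S = "words N m \<times> msets N k"
  define c where "c = (\<lambda>p :: nat list \<times> nat multiset. if [word_maj (fst p) = 1] (mod m) then 1 else (0 :: complex))"
  define d where "d = (\<lambda>p :: nat list \<times> nat multiset.
      1 / of_nat m * (\<Sum>j<m. w ^ j * (if rotate j (fst p) = fst p then 1 else 0)))"
  \<comment> \<open>The difference of the two coefficients at \<open>\<alpha>\<close>. Its
    generating polynomial vanishes at all arguments, so independence of monomials forces it to be
    zero.\<close>
  define F where "F = (\<lambda>\<alpha>. \<Sum>p | p \<in> ?S \<and> weight p = \<alpha>. c p - d p)"
  have zero: "(\<Sum>\<alpha>\<in>weight ` ?S. F \<alpha> * monomial N xs \<alpha>) = 0" for xs
  proof -
    have "(\<Sum>p\<in>?S. d p * monomial N xs (weight p)) =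
      (\<Sum>p\<in>?S. \<Sum>j<m. 1 / of_nat m * (w ^ j * ((if rotate j (fst p) = fst p then 1 else 0) * monomial N xs (weight p))))"
      by (simp add: d_def sum_distrib_right sum_distrib_left mult.assoc)
    also have "\<dots> = (\<Sum>j<m. \<Sum>p\<in>?S. 1 / of_nat m * (w ^ j * ((if rotate j (fst p) = fst p then 1 else 0) * monomial N xs (weight p))))"
      by (rule sum.swap)
    also have "\<dots> = (\<Sum>j<m. 1 / of_nat m * (w ^ j *
        (\<Sum>p\<in>?S. (if rotate j (fst p) = fst p then 1 else 0) * monomial N xs (weight p))))"
      by (simp only: sum_distrib_left)
    also have "\<dots> = (\<Sum>j<m. 1 / of_nat m * (w ^ j *
        ((\<Sum>v | v \<in> words N m \<and> rotate j v = v. prod_list (map ((!) xs) v)) * (\<Sum>M\<in>msets N k. \<Prod>a\<in>#M. xs ! a))))"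
      by (intro sum.cong refl arg_cong2[of _ _ _ _ "(*)"] sum_pairs_product)
    also have "\<dots> = lie_char N ((!) xs) * (\<Sum>M\<in>msets N k. \<Prod>a\<in>#M. xs ! a)"
    proof -
      define H where "H = (\<Sum>M\<in>msets N k. \<Prod>a\<in>#M. xs ! a)"
      define S where "S j = (\<Sum>v | v \<in> words N m \<and> rotate j v = v. prod_list (map ((!) xs) v))" for j
      show ?thesis unfolding lie_char_def H_def[symmetric] S_def[symmetric]
        by (simp only: sum_distrib_left sum_distrib_right mult.assoc)
    qed
    also have "lie_char N ((!) xs) = (\<Sum>v | v \<in> words N m \<and> [word_maj v = 1] (mod m). prod_list (map ((!) xs) v))"
      unfolding lie_char_def using sum_words_maj_cong_1[OF root, where N = N and x = "(!) xs"] m2 by simp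
    also have "\<dots> * (\<Sum>M\<in>msets N k. \<Prod>a\<in>#M. xs ! a) = (\<Sum>p\<in>?S. c p * monomial N xs (weight p))"
      unfolding c_def by (rule sum_pairs_product[symmetric])
    finally have "(\<Sum>p\<in>?S. (c p - d p) * monomial N xs (weight p)) = 0"
      by (simp add: left_diff_distrib sum_subtractf)
    then show ?thesis unfolding sum_pairs_by_weight F_def .
  qed
  have "F \<alpha> = 0" if "\<alpha> \<in> weight ` ?S"
  proof (rule monomials_independent[of "weight ` ?S" N F, OF _ _ _ that])
    show "keys \<beta> \<subseteq> {..<N}" if "\<beta> \<in> weight ` ?S" for \<beta>
      using that keys_weight_words by blast
  qed (use zero in auto)
  moreover have "F \<alpha> = 0" if "\<alpha> \<notin> weight ` ?S"
  proof -
    have "{p. p \<in> ?S \<and> weight p = \<alpha>} = {}" using that by auto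
    then show ?thesis unfolding F_def by (simp only: sum.empty)
  qed
  ultimately have "F \<alpha> = 0" by blast
  then have "(\<Sum>p | p \<in> ?S \<and> weight p = \<alpha>. c p) = (\<Sum>p | p \<in> ?S \<and> weight p = \<alpha>. d p)"
    by (simp add: F_def sum_subtractf)
  moreover have "(\<Sum>p | p \<in> ?S \<and> weight p = \<alpha>. c p) = of_int (hook_coeff m k \<alpha>)"
    unfolding c_def hook_coeff_def sum_indicator_card[OF N] by simp
  moreover have "(\<Sum>p | p \<in> ?S \<and> weight p = \<alpha>. d p) =
      1 / of_nat m * (\<Sum>j<m. w ^ j * (\<Sum>p | p \<in> ?S \<and> weight p = \<alpha>. if rotate j (fst p) = fst p then 1 else 0))"
    unfolding d_def sum_distrib_left[symmetric] sum.swap[of _ "{..<m}"] ..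
  ultimately show ?thesis unfolding sum_indicator_card[OF N] by simp
qed

text \<open>Relabelling letters commutes with rotating positions. Applying \<open>\<pi>\<close> to
  all letters is thus a bijection, and it changes the exponent vector from its composition with
  \<open>\<pi>\<close>, which is \<open>map_key\<close>, back to \<open>\<alpha>\<close>.\<close>

lemma card_rotation_fixed_relabel:
  assumes "bij \<pi>"
  shows "card {p \<in> pairs m k. weight p = Poly_Mapping.map_key \<pi> \<alpha> \<and> rotate j (fst p) = fst p} =
    card {p \<in> pairs m k. weight p = \<alpha> \<and> rotate j (fst p) = fst p}"
proof -
  have inj: "inj \<pi>" using assms by (rule bij_is_inj)
  let ?f = "\<lambda>p. (map \<pi> (fst p), image_mset \<pi> (snd p))"
  have cnt: "count (image_mset \<pi> A) (\<pi> i) = count A i" for A i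
    by (induction A) (auto dest: injD[OF inj])
  have ct: "weight (?f p) = \<alpha> \<longleftrightarrow> weight p = Poly_Mapping.map_key \<pi> \<alpha>" for p
  proof -
    have "weight (?f p) = \<alpha> \<longleftrightarrow> (\<forall>i. count (image_mset \<pi> (mset (fst p) + snd p)) i = lookup \<alpha> i)"
      by (simp add: weight_eq_iff)
    also have "\<dots> \<longleftrightarrow> (\<forall>i. count (image_mset \<pi> (mset (fst p) + snd p)) (\<pi> i) = lookup \<alpha> (\<pi> i))"
      using bij_is_surj[OF assms] by (metis surjD)
    also have "\<dots> \<longleftrightarrow> weight p = Poly_Mapping.map_key \<pi> \<alpha>"
      unfolding cnt weight_eq_iff by (simp add: map_key.rep_eq[OF inj])
    finally show ?thesis .
  qed
  have "bij_betw ?f {p \<in> pairs m k. weight p = Poly_Mapping.map_key \<pi> \<alpha> \<and> rotate j (fst p) = fst p}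
      {p \<in> pairs m k. weight p = \<alpha> \<and> rotate j (fst p) = fst p}" (is "bij_betw _ ?A ?B")
  proof (rule bij_betw_imageI)
    show "inj_on ?f ?A"
    proof (rule inj_onI)
      fix p q assume "?f p = ?f q"
      then have "map \<pi> (fst p) = map \<pi> (fst q)" "image_mset \<pi> (snd p) = image_mset \<pi> (snd q)" by auto
      moreover have "image_mset (inv_into UNIV \<pi>) (image_mset \<pi> M) = M" for M
        using inj by (simp add: multiset.map_comp)
      ultimately have "snd p = snd q" by metis
      moreover have "fst p = fst q" using \<open>map \<pi> (fst p) = map \<pi> (fst q)\<close> inj by simp
      ultimately show "p = q" by (simp add: prod_eq_iff)
    qed
    show "?f ` ?A = ?B"
    proof (intro equalityI subsetI)
      fix q assume "q \<in> ?f ` ?A"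
      then show "q \<in> ?B" using ct by (auto simp: rotate_map)
    next
      fix q assume q: "q \<in> ?B"
      define p where "p = (map (inv_into UNIV \<pi>) (fst q), image_mset (inv_into UNIV \<pi>) (snd q))"
      have "\<pi> \<circ> inv_into UNIV \<pi> = id" using bij_is_surj[OF assms] by (simp add: surj_iff)
      then have fp: "?f p = q" by (simp add: p_def multiset.map_comp)
      have "weight p = Poly_Mapping.map_key \<pi> \<alpha>" using ct[of p] q unfolding fp by simp
      moreover have "rotate j (fst p) = fst p" using q by (auto simp: p_def rotate_map)
      ultimately have "p \<in> ?A" using q by (auto simp: p_def)
      then show "q \<in> ?f ` ?A" by (rule image_eqI[where f = ?f, OF fp[symmetric]])
    qed
  qed
  then show ?thesis by (rule bij_betw_same_card)
qed

lemma symmetric_hook_coeff: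
  assumes "2 \<le> m"
  shows "symmetric_function (hook_coeff m k)"
proof -
  interpret cyclic_root m "cis (2 * pi / of_nat m)"
    using assms primitive_root_of_unity_cis by unfold_locales auto
  have "hook_coeff m k (Poly_Mapping.map_key \<pi> \<alpha>) = hook_coeff m k \<alpha>" if "bij \<pi>" for \<pi> \<alpha>
  proof -
    have "(of_int (hook_coeff m k (Poly_Mapping.map_key \<pi> \<alpha>)) :: complex) = of_int (hook_coeff m k \<alpha>)"
      unfolding hook_coeff_rotations card_rotation_fixed_relabel[OF that] ..
    then show ?thesis by simp
  qed
  moreover have "(\<Sum>i\<in>keys \<alpha>. lookup \<alpha> i) \<le> m + k" if nz: "hook_coeff m k \<alpha> \<noteq> 0" for \<alpha>
  proof -
    obtain p where "p \<in> pairs m k" "weight p = \<alpha>" using hook_coeff_nonzeroD[OF nz] by blast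
    then show ?thesis using degree_weight[of p] by auto
  qed
  ultimately show ?thesis unfolding symmetric_function_def by blast
qed

section \<open>Symmetric functions are determined by nonzero arguments\<close>

lemma eval_sym_superset:
  assumes "finite A" "{\<alpha>. keys \<alpha> \<subseteq> {..<length xs} \<and> f \<alpha> \<noteq> 0} \<subseteq> A"
    "\<And>\<alpha>. \<alpha> \<in> A \<Longrightarrow> keys \<alpha> \<subseteq> {..<length xs}"
  shows "eval_sym f xs = (\<Sum>\<alpha>\<in>A. of_int (f \<alpha>) * monomial (length xs) xs \<alpha>)"
  unfolding eval_sym_def monomial_def by (rule sum.mono_neutral_left) (use assms in auto)

lemma finite_bounded_exponents:
  "finite {\<alpha> :: nat \<Rightarrow>\<^sub>0 nat. keys \<alpha> \<subseteq> {..<N} \<and> (\<Sum>i\<in>keys \<alpha>. lookup \<alpha> i) \<le> d}"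
  (is "finite ?A")
proof (rule finite_imageD)
  let ?f = "\<lambda>\<alpha> :: nat \<Rightarrow>\<^sub>0 nat. map (lookup \<alpha>) [0..<N]"
  show "inj_on ?f ?A"
  proof (rule inj_onI)
    fix \<alpha> \<beta> :: "nat \<Rightarrow>\<^sub>0 nat" assume *: "\<alpha> \<in> ?A" "\<beta> \<in> ?A" "?f \<alpha> = ?f \<beta>"
    show "\<alpha> = \<beta>"
    proof (rule poly_mapping_eqI)
      fix i
      show "lookup \<alpha> i = lookup \<beta> i"
      proof (cases "i < N")
        case False
        then have "i \<notin> keys \<alpha>" "i \<notin> keys \<beta>" using *(1,2) by auto
        then show ?thesis by (simp add: in_keys_iff)
      qed (use *(3) in simp)
    qed
  qed
  have "?f ` ?A \<subseteq> {ys. set ys \<subseteq> {..d} \<and> length ys = N}"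
  proof
    fix ys assume "ys \<in> ?f ` ?A"
    then obtain \<alpha> where \<alpha>: "\<alpha> \<in> ?A" "ys = ?f \<alpha>" by blast
    have "lookup \<alpha> i \<le> d" for i
    proof (cases "i \<in> keys \<alpha>")
      case True
      then have "lookup \<alpha> i \<le> (\<Sum>i\<in>keys \<alpha>. lookup \<alpha> i)"
        by (intro member_le_sum) auto
      then show ?thesis using \<alpha>(1) by simp
    qed (simp add: in_keys_iff)
    then show "ys \<in> {ys. set ys \<subseteq> {..d} \<and> length ys = N}" using \<alpha>(2) by auto
  qed
  then show "finite (?f ` ?A)" by (rule finite_subset) (simp add: finite_lists_length_eq)
qed

text \<open>Bounded degree makes the restrictions to \<open>N\<close> variables polynomials, with
  \<open>N\<close> large enough for the exponent under consideration. Equality is asked at nonzero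
  arguments only, because those are the eigenvalues of invertible matrices.\<close>

lemma symmetric_function_eqI:
  assumes "symmetric_function f" "symmetric_function g"
    and eq: "\<And>xs. 0 \<notin> set xs \<Longrightarrow> eval_sym f xs = eval_sym g xs"
  shows "f = g"
proof
  fix \<alpha> :: "nat \<Rightarrow>\<^sub>0 nat"
  obtain N where N: "keys \<alpha> \<subseteq> {..<N}" using bounded_keys by blast
  obtain d1 where d1: "\<And>\<alpha>. f \<alpha> \<noteq> 0 \<Longrightarrow> (\<Sum>i\<in>keys \<alpha>. lookup \<alpha> i) \<le> d1"
    using assms(1) unfolding symmetric_function_def by blast
  obtain d2 where d2: "\<And>\<alpha>. g \<alpha> \<noteq> 0 \<Longrightarrow> (\<Sum>i\<in>keys \<alpha>. lookup \<alpha> i) \<le> d2"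
    using assms(2) unfolding symmetric_function_def by blast
  define A where "A = {\<alpha> :: nat \<Rightarrow>\<^sub>0 nat. keys \<alpha> \<subseteq> {..<N} \<and>
    (\<Sum>i\<in>keys \<alpha>. lookup \<alpha> i) \<le> max d1 d2}"
  have finA: "finite A" unfolding A_def by (rule finite_bounded_exponents)
  have "complex_of_int (f \<beta>) - of_int (g \<beta>) = 0" if "\<beta> \<in> A" for \<beta>
  proof (rule monomials_independent[of A N "\<lambda>\<beta>. complex_of_int (f \<beta>) - of_int (g \<beta>)", OF finA _ _ that])
    show "keys \<beta> \<subseteq> {..<N}" if "\<beta> \<in> A" for \<beta> using that by (simp add: A_def)
    fix xs :: "complex list" assume xs: "length xs = N" "0 \<notin> set xs"
    have "eval_sym f xs = (\<Sum>\<alpha>\<in>A. of_int (f \<alpha>) * monomial N xs \<alpha>)"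
      unfolding xs(1)[symmetric] using d1 xs(1)
      by (intro eval_sym_superset finA) (auto simp: A_def le_max_iff_disj)
    moreover have "eval_sym g xs = (\<Sum>\<alpha>\<in>A. of_int (g \<alpha>) * monomial N xs \<alpha>)"
      unfolding xs(1)[symmetric] using d2 xs(1)
      by (intro eval_sym_superset finA) (auto simp: A_def le_max_iff_disj)
    ultimately show "(\<Sum>\<alpha>\<in>A. (complex_of_int (f \<alpha>) - of_int (g \<alpha>)) * monomial N xs \<alpha>) = 0"
      using eq[OF xs(2)] by (simp add: left_diff_distrib sum_subtractf)
  qed
  then show "f \<alpha> = g \<alpha>"
  proof (cases "\<alpha> \<in> A")
    case False
    then have "f \<alpha> = 0" "g \<alpha> = 0" using d1[of \<alpha>] d2[of \<alpha>] N by (auto simp: A_def le_max_iff_disj)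
    then show ?thesis by simp
  qed auto
qed

lemma exists_invertible_with_eigenvalues:
  assumes "0 \<notin> set (xs :: complex list)"
  shows "\<exists>g. g \<in> carrier_mat (length xs) (length xs) \<and> invertible_mat g \<and> char_poly g = (\<Prod>x\<leftarrow>xs. [:- x, 1:])"
proof -
  let ?n = "length xs"
  let ?g = "mat_diag ?n ((!) xs)" and ?h = "mat_diag ?n (\<lambda>i. inverse (xs ! i))"
  have nz: "xs ! i \<noteq> 0" if "i < ?n" for i using assms that by (metis nth_mem)
  have gh: "?g * ?h = 1\<^sub>m ?n" "?h * ?g = 1\<^sub>m ?n"
    unfolding mat_diag_diag using nz by (auto simp: mat_diag_def intro!: eq_matI)
  have "invertible_mat ?g"
    unfolding invertible_mat_def inverts_mat_def using gh by (auto simp: mat_diag_def intro!: exI[of _ ?h])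
  moreover have "char_poly ?g = (\<Prod>x\<leftarrow>xs. [:- x, 1:])"
  proof -
    have "upper_triangular ?g" by (auto simp: mat_diag_def upper_triangular_def)
    moreover have "diag_mat ?g = xs" by (auto simp: diag_mat_def mat_diag_def intro: nth_equalityI)
    ultimately show ?thesis using char_poly_upper_triangular[of ?g ?n] by simp
  qed
  ultimately show ?thesis by (intro exI[of _ ?g]) simp
qed

theorem ch_higher_lie_hook_coeff:
  assumes m: "2 \<le> m"
  shows "ch_higher_lie (m # replicate k 1) = hook_coeff m k"
  unfolding ch_higher_lie_def
proof (rule the_equality)
  interpret cyclic_root m "cis (2 * pi / of_nat m)"
    using m primitive_root_of_unity_cis by unfold_locales auto
  have tr: "trace_on (higher_lie N (m # replicate k 1)) (act_sym g) = eval_sym (hook_coeff m k) xs"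
    if g: "g \<in> carrier_mat N N" "char_poly g = (\<Prod>x\<leftarrow>xs. [:- x, 1:])" for N g xs
  proof -
    \<comment> \<open>The length of \<open>xs\<close> is not among the assumptions; it follows from
      a triangular form of \<open>g\<close>, whose diagonal is \<open>xs\<close>.\<close>
    obtain B P Q where "schur_decomposition g xs = (B, P, Q)" by (cases "schur_decomposition g xs")
    from schur_decomposition[OF g this] have "similar_mat_wit g B P Q" "diag_mat B = xs" by auto
    moreover from this have "B \<in> carrier_mat N N" using similar_mat_witD2(5)[OF g(1)] by blast
    ultimately have "length xs = N" by (auto simp: diag_mat_def)
    from eval_sym_hook_coeff[OF this, of m k] show ?thesis
      unfolding trace_higher_lie_hook[OF g] lie_char_def
      using sum_words_maj_cong_1[OF root, where N = N and x = "(!) xs"] m by simp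
  qed
  then show P: "symmetric_function (hook_coeff m k) \<and> (\<forall>N g xs. g \<in> carrier_mat N N \<and> invertible_mat g \<and>
      char_poly g = (\<Prod>x\<leftarrow>xs. [:- x, 1:]) \<longrightarrow>
      trace_on (higher_lie N (m # replicate k 1)) (act_sym g) = eval_sym (hook_coeff m k) xs)"
    using symmetric_hook_coeff[OF m] by blast
  fix f assume f: "symmetric_function f \<and> (\<forall>N g xs. g \<in> carrier_mat N N \<and> invertible_mat g \<and>
      char_poly g = (\<Prod>x\<leftarrow>xs. [:- x, 1:]) \<longrightarrow>
      trace_on (higher_lie N (m # replicate k 1)) (act_sym g) = eval_sym f xs)"
  show "f = hook_coeff m k"
  proof (rule symmetric_function_eqI)
    fix xs :: "complex list" assume "0 \<notin> set xs"
    then obtain g where "g \<in> carrier_mat (length xs) (length xs)" "invertible_mat g" "char_poly g = (\<Prod>x\<leftarrow>xs. [:- x, 1:])"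
      using exists_invertible_with_eigenvalues by blast
    then show "eval_sym f xs = eval_sym (hook_coeff m k) xs" using f tr by metis
  qed (use f symmetric_hook_coeff[OF m] in auto)
qed

section \<open>Words split at the end of the first block\<close>

text \<open>Position \<open>m\<close>, the junction of the two words, may be a descent; hence only
  the comparisons inside \<open>s\<close> are restricted.\<close>

lemma word_des_append_subset:
  assumes "length v = m"
  shows "word_des (v @ s) \<subseteq> {1..m} \<longleftrightarrow> sorted s"
proof
  assume l: "word_des (v @ s) \<subseteq> {1..m}"
  show "sorted s"
    unfolding sorted_iff_nth_Suc
  proof (intro allI impI)
    fix i assume i: "Suc i < length s"
    then have "m + Suc i \<notin> word_des (v @ s)" using l by auto
    then show "s ! i \<le> s ! Suc i" using i assms by (auto simp: word_des_def nth_append)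
  qed
next
  assume s: "sorted s"
  show "word_des (v @ s) \<subseteq> {1..m}"
  proof
    fix i assume i: "i \<in> word_des (v @ s)"
    show "i \<in> {1..m}"
    proof (rule ccontr)
      assume "i \<notin> {1..m}"
      then have "m < i" using i by (auto simp: word_des_def)
      then obtain j where j: "i = m + Suc j" by (metis add_Suc_right less_imp_Suc_add)
      then show False using i s assms unfolding sorted_iff_nth_Suc
        by (auto simp: word_des_def nth_append not_less[symmetric])
    qed
  qed
qed

lemma word_des_append_less: "length v = m \<Longrightarrow> word_des (v @ s) \<inter> {1..<m} = word_des v"
  by (auto simp: word_des_def nth_append)

text \<open>A word without descents beyond position \<open>m\<close> is a prefix of length
  \<open>m\<close> followed by a sorted list, and a sorted list is a multiset. The range
  \<open>{1..<m}\<close> leaves out the junction, so the sum of its descents is the major index of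
  the prefix.\<close>

lemma card_words_hook:
  "card {u. length u = m + k \<and> (\<forall>i. count_list u i = lookup \<alpha> i) \<and>
      [\<Sum>(word_des u \<inter> {1..<m}) = 1] (mod m) \<and> word_des u \<subseteq> {1..m}} =
    card {p \<in> pairs m k. weight p = \<alpha> \<and> [word_maj (fst p) = 1] (mod m)}" (is "card ?A = card ?B")
proof (rule bij_betw_same_card[symmetric])
  let ?f = "\<lambda>p. fst p @ sorted_list_of_multiset (snd p)"
  show "bij_betw ?f ?B ?A"
  proof (rule bij_betw_imageI)
    show "inj_on ?f ?B"
    proof (rule inj_onI)
      fix p q assume "p \<in> ?B" "q \<in> ?B" and e: "?f p = ?f q"
      then have "p \<in> pairs m k" "q \<in> pairs m k" by blast+
      then have "length (fst p) = length (fst q)" by (simp add: mem_Times_iff)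
      then have "fst p = fst q" "sorted_list_of_multiset (snd p) = sorted_list_of_multiset (snd q)"
        using e by simp_all
      moreover from this have "snd p = snd q" by (metis mset_sorted_list_of_multiset)
      ultimately show "p = q" by (simp add: prod_eq_iff)
    qed
    have f: "?f p \<in> ?A \<longleftrightarrow> weight p = \<alpha> \<and> [word_maj (fst p) = 1] (mod m)" if "p \<in> pairs m k" for p
    proof -
      have l: "length (fst p) = m" "size (snd p) = k" using that by auto
      have "length (sorted_list_of_multiset (snd p)) = k"
        using l(2) by (metis mset_sorted_list_of_multiset size_mset)
      moreover have "count_list (?f p) i = count (mset (fst p) + snd p) i" for i
        by (metis count_mset mset_append mset_sorted_list_of_multiset)
      ultimately show ?thesis
        using word_des_append_subset[OF l(1), of "sorted_list_of_multiset (snd p)"]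
          word_des_append_less[OF l(1), of "sorted_list_of_multiset (snd p)"] l
        by (simp add: weight_eq_iff word_maj_def)
    qed
    show "?f ` ?B = ?A"
    proof (intro equalityI subsetI)
      fix u assume "u \<in> ?f ` ?B"
      then show "u \<in> ?A" using f by blast
    next
      fix u assume u: "u \<in> ?A"
      define p where "p = (take m u, mset (drop m u))"
      have p: "p \<in> pairs m k" using u by (simp add: p_def)
      have "sorted (drop m u)" using word_des_append_subset[of "take m u" m "drop m u"] u by simp
      then have fp: "?f p = u" by (simp add: p_def sorted_sort_id)
      then have "?f p \<in> ?A" using u by metis
      then have "p \<in> ?B" using f[OF p] p by blast
      then show "u \<in> ?f ` ?B" by (rule image_eqI[where f = ?f, OF fp[symmetric]])
    qed
  qed
qed

text \<open>A descent \<open>d\<close> belongs to the first block only if \<open>d + 1\<close> does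
  too, which gives the range \<open>{1..<n - k}\<close>. The other blocks have size one, and a
  congruence modulo 1 always holds.\<close>

lemma SYT_maj_hook:
  assumes "k \<le> n"
  shows "{T \<in> SYT_maj (hook n k) \<mu>. Des T \<subseteq> {1..n - k}} =
    {T \<in> SYT \<mu>. [\<Sum>(Des T \<inter> {1..<n - k}) = 1] (mod (n - k)) \<and> Des T \<subseteq> {1..n - k}}"
proof -
  have b: "Des_block (hook n k) 0 T = Des T \<inter> {1..<n - k}" for T
    unfolding Des_block_def block_def hook_def by auto
  have "(\<forall>i<length (hook n k). [maj_block (hook n k) i T = 1] (mod hook n k ! i)) \<longleftrightarrow>
    [\<Sum>(Des T \<inter> {1..<n - k}) = 1] (mod (n - k))" for T
  proof -
    have "hook n k ! Suc i = 1" if "Suc i < length (hook n k)" for i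
      using that by (simp add: hook_def)
    then have "[maj_block (hook n k) (Suc i) T = 1] (mod hook n k ! Suc i)" if "Suc i < length (hook n k)" for i
      using that by (simp add: cong_def)
    moreover have "maj_block (hook n k) 0 T = \<Sum>(Des T \<inter> {1..<n - k})" "hook n k ! 0 = n - k" "0 < length (hook n k)"
      by (simp_all add: maj_block_def b) (simp_all add: hook_def)
    ultimately show ?thesis by (metis not0_implies_Suc)
  qed
  then show ?thesis by (auto simp: SYT_maj_def)
qed

theorem theorem3p10:
  fixes n k :: nat
  assumes "2 \<le> n" and "k \<le> n - 2"
  shows "ch_higher_lie (hook n k) =
    (\<lambda>\<alpha>. \<Sum>\<mu> | is_partition n \<mu>.
       int (card {T \<in> SYT_maj (hook n k) \<mu>. Des T \<subseteq> {1..n - k}}) * schur \<mu> \<alpha>)"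
proof
  fix \<alpha>
  let ?m = "n - k"
  have m: "2 \<le> ?m" "?m + k = n" "k \<le> n" using assms by auto
  have "ch_higher_lie (hook n k) \<alpha> = hook_coeff ?m k \<alpha>"
    using ch_higher_lie_hook_coeff[OF m(1)] by (simp add: hook_def)
  \<comment> \<open>Both sides count words: the tableaux through insertion, with the congruence and
    the inclusion together as the condition on descent sets, and the coefficient through splitting a
    word after its first \<open>n - k\<close> letters.\<close>
  also have "\<dots> = (\<Sum>\<mu> | is_partition n \<mu>.
      int (card {T \<in> SYT \<mu>. [\<Sum>(Des T \<inter> {1..<?m}) = 1] (mod ?m) \<and> Des T \<subseteq> {1..?m}}) * schur \<mu> \<alpha>)"
    unfolding sum_tableaux_schur[where C = "\<lambda>D. [\<Sum>(D \<inter> {1..<?m}) = 1] (mod ?m) \<and> D \<subseteq> {1..?m}"]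
      hook_coeff_def card_words_hook[symmetric] m(2) ..
  finally show "ch_higher_lie (hook n k) \<alpha> = (\<Sum>\<mu> | is_partition n \<mu>.
      int (card {T \<in> SYT_maj (hook n k) \<mu>. Des T \<subseteq> {1..n - k}}) * schur \<mu> \<alpha>)"
    unfolding SYT_maj_hook[OF m(3)] .
qed

end
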